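(* There exists a non-empty, open, bounded, convex set $\Omega_0\subset\mathbb{R}^2$ that is a maximizer of the variational problem $$\sup\{H(\Omega):\ \Omega\subset\mathbb{R}^2\text{ non-empty, open, bounded, convex}\},\qquad H(\Omega):=\frac{T(\Omega)^{1/2}\,\mathrm{Cap}(\overline\Omega)}{|\Omega|^{3/2}}.$$
   Context: For a bounded open set $\Omega\subset\mathbb{R}^2$: $|\Omega|$ is the area. The torsion function $u_\Omega\in H^1_0(\Omega)$ is the weak solution of $-\Delta u_\Omega=1$ in $\Omega$, and the torsional rigidity is $T(\Omega)=\int_\Omega u_\Omega$. For a compact set $K\subset\mathbb{R}^2$, with $\mathcal{P}(K)$ the Borel probability measures on $K$, the logarithmic potential energy is $I(K)=\inf_{\mu\in\mathcal{P}(K)}\int_{K\times K}\log(|x-y|^{-1})\,d\mu(x)\,d\mu(y)$, and the logarithmic capacity is $\mathrm{Cap}(K)=\exp(-I(K))$. *)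

theory Defs
  imports "HOL-Probability.Probability"
begin

type_synonym plane = "real ^ 2"

section \<open>Test functions and the Sobolev space of functions vanishing on the boundary\<close>

definition grad :: "(plane \<Rightarrow> real) \<Rightarrow> plane \<Rightarrow> plane" where
  "grad f x = (\<chi> i. frechet_derivative f (at x) (axis i 1))"

primrec C_k :: "nat \<Rightarrow> (plane \<Rightarrow> real) \<Rightarrow> bool" where
  "C_k 0 f \<longleftrightarrow> continuous_on UNIV f"
| "C_k (Suc k) f \<longleftrightarrow> f differentiable_on UNIV \<and> (\<forall>i. C_k k (\<lambda>x. grad f x $ i))"

definition test_functions :: "plane set \<Rightarrow> (plane \<Rightarrow> real) set" where
  "test_functions \<Omega> =
     {\<phi>. (\<forall>k. C_k k \<phi>) \<and> compact (closure {x. \<phi> x \<noteq> 0}) \<and> closure {x. \<phi> x \<noteq> 0} \<subseteq> \<Omega>}"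

text \<open>Elements of the function spaces below are represented by functions on the whole plane, of
  which only the values on \<open>\<Omega>\<close> matter; they are Borel representatives of their
  almost-everywhere classes.\<close>

definition L2 :: "plane set \<Rightarrow> (plane \<Rightarrow> 'b::euclidean_space) \<Rightarrow> bool" where
  "L2 \<Omega> f \<longleftrightarrow>
     set_borel_measurable lborel \<Omega> f \<and> set_integrable lborel \<Omega> (\<lambda>x. (norm (f x))\<^sup>2)"

definition weak_gradient :: "plane set \<Rightarrow> (plane \<Rightarrow> real) \<Rightarrow> (plane \<Rightarrow> plane) \<Rightarrow> bool" where
  "weak_gradient \<Omega> u g \<longleftrightarrow>
     (\<forall>\<phi>\<in>test_functions \<Omega>. \<forall>i.
        (LINT x:\<Omega>|lborel. u x * grad \<phi> x $ i) = - (LINT x:\<Omega>|lborel. g x $ i * \<phi> x))"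

definition H1 :: "plane set \<Rightarrow> (plane \<Rightarrow> real) \<Rightarrow> (plane \<Rightarrow> plane) \<Rightarrow> bool" where
  "H1 \<Omega> u g \<longleftrightarrow> L2 \<Omega> u \<and> L2 \<Omega> g \<and> weak_gradient \<Omega> u g"

text \<open>\<open>H10 \<Omega> u g\<close>: the function \<open>u\<close>, with weak gradient \<open>g\<close>, lies in the closure of
  the test functions with respect to the \<open>H1\<close> norm.\<close>

definition H10 :: "plane set \<Rightarrow> (plane \<Rightarrow> real) \<Rightarrow> (plane \<Rightarrow> plane) \<Rightarrow> bool" where
  "H10 \<Omega> u g \<longleftrightarrow> H1 \<Omega> u g \<and>
     (\<exists>\<phi>. (\<forall>n. \<phi> n \<in> test_functions \<Omega>) \<and>
       (\<lambda>n. (LINT x:\<Omega>|lborel. (\<phi> n x - u x)\<^sup>2)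
           + (LINT x:\<Omega>|lborel. (norm (grad (\<phi> n) x - g x))\<^sup>2)) \<longlonglongrightarrow> 0)"

section \<open>Torsional rigidity\<close>

definition is_torsion_function :: "plane set \<Rightarrow> (plane \<Rightarrow> real) \<Rightarrow> bool" where
  "is_torsion_function \<Omega> u \<longleftrightarrow>
     (\<exists>g. H10 \<Omega> u g \<and>
       (\<forall>\<phi>\<in>test_functions \<Omega>.
          (LINT x:\<Omega>|lborel. g x \<bullet> grad \<phi> x) = (LINT x:\<Omega>|lborel. \<phi> x)))"

text \<open>For bounded open \<open>\<Omega>\<close> the weak solution exists and is unique almost everywhere on
  \<open>\<Omega>\<close>, so that its integral does not depend on the choice of the representative.\<close>

definition torsion_function :: "plane set \<Rightarrow> plane \<Rightarrow> real" where
  "torsion_function \<Omega> = (SOME u. is_torsion_function \<Omega> u)"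

definition torsional_rigidity :: "plane set \<Rightarrow> real" where
  "torsional_rigidity \<Omega> = (LINT x:\<Omega>|lborel. torsion_function \<Omega> x)"

section \<open>Logarithmic capacity\<close>

definition borel_prob_measures :: "plane set \<Rightarrow> plane measure set" where
  "borel_prob_measures K = {\<mu>. prob_space \<mu> \<and> sets \<mu> = sets (restrict_space borel K)}"

text \<open>The kernel is infinite on the diagonal, whereas \<open>ln 0 = 0\<close> for the real logarithm.\<close>

definition log_kernel :: "plane \<Rightarrow> plane \<Rightarrow> ereal" where
  "log_kernel x y = (if x = y then \<infinity> else ereal (ln (inverse (norm (x - y)))))"

text \<open>The integral of the positive part minus that of the negative part (\<open>e2ennreal\<close> maps
  negative numbers to \<open>0\<close>). On a bounded set the kernel is bounded below, hence the second
  integral is finite and the difference is meaningful, with values in \<open>(-\<infinity>, \<infinity>]\<close>.\<close>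

definition log_energy :: "plane measure \<Rightarrow> ereal" where
  "log_energy \<mu> =
     enn2ereal (\<integral>\<^sup>+ z. e2ennreal (log_kernel (fst z) (snd z)) \<partial>(\<mu> \<Otimes>\<^sub>M \<mu>))
     - enn2ereal (\<integral>\<^sup>+ z. e2ennreal (- log_kernel (fst z) (snd z)) \<partial>(\<mu> \<Otimes>\<^sub>M \<mu>))"

definition log_potential_energy :: "plane set \<Rightarrow> ereal" where
  "log_potential_energy K = (INF \<mu>\<in>borel_prob_measures K. log_energy \<mu>)"

text \<open>The exponential of \<open>- \<infinity>\<close> is \<open>0\<close>; for compact \<open>K\<close> the energy is never
  \<open>- \<infinity>\<close>.\<close>

definition log_capacity :: "plane set \<Rightarrow> real" where
  "log_capacity K =
     (if log_potential_energy K = \<infinity> then 0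
      else exp (- real_of_ereal (log_potential_energy K)))"

section \<open>The shape functional\<close>

definition shape_functional :: "plane set \<Rightarrow> real" where
  "shape_functional \<Omega> =
     torsional_rigidity \<Omega> powr (1/2) * log_capacity (closure \<Omega>)
       / measure lborel \<Omega> powr (3/2)"

definition admissible :: "plane set \<Rightarrow> bool" where
  "admissible \<Omega> \<longleftrightarrow> \<Omega> \<noteq> {} \<and> open \<Omega> \<and> bounded \<Omega> \<and> convex \<Omega>"

end

theory Submission
  imports Defs "HOL-Complex_Analysis.Complex_Analysis" "HOL-Real_Asymp.Real_Asymp"
begin

text \<open>The functional is invariant under similarities and monotone in each of its three ingredients, so
  if \<open>\<Omega>' \<subseteq> t \<Omega>\<close> and \<open>\<Omega> \<subseteq> t \<Omega>'\<close> then \<open>H(\<Omega>') \<le> t\<^sup>6 H(\<Omega>)\<close>. Hence on convex sets between two fixed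
  concentric discs, where gauges are precompact, the supremum is attained. It remains to exclude that a
  maximizing sequence of diameter \<open>d\<close> becomes flat. Solving the torsion problem on the parallel
  slices orthogonal to a diameter, of lengths \<open>h\<close>, gives \<open>T \<le> (1/12) \<integral>h\<^sup>3\<close>, and as \<open>h\<close> is concave this is at
  most \<open>|\<Omega>|\<^sup>3 / (6 d\<^sup>2)\<close>; since the capacity of flat sets tends to \<open>d/4\<close>, the functional
  is asymptotically at most \<open>1/(4 \<surd>6)\<close>, which is less than the value \<open>1/(\<pi> \<surd>8)\<close> of the disc.\<close>

section \<open>Smooth functions and test functions\<close>

text \<open>\<open>torsion_function\<close> is chosen by \<open>SOME\<close>, so nothing is known
  about T until a weak solution is shown to exist. From then on T is handled only as the supremum of
  2\<integral>\<phi> - \<integral>|\<nabla>\<phi>|^2 over test functions \<phi>: monotonicity and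
  scaling are read off this form, a single test function bounds T from below, and an estimate
  uniform in \<phi> bounds it from above. With the sandwich estimate, the passage to the limit along
  a maximizing sequence reduces to letting t tend to 1. The delicate point is the narrow gap between
  the flat limit 0.102 and the disc 0.113. It forces the sharp constant in the bound for the
  integral of h^3 (the bound h \<le> 2|\<Omega>|/d would lose a factor sqrt 2 in the functional) and
  a bound for the capacity of flat sets within a tenth of d/4. The latter comes from finitely many
  points: the energy of a measure is the mean of the kernel over N sample points, and products of
  distances are controlled by monic polynomials that are small on the set. On [-2, 2] the Chebyshev
  polynomials stay below 2, so a fixed N and a sufficiently thin strip suffice.\<close>

lemma has_derivative_grad:
  assumes "f differentiable (at x)"
  shows "(f has_derivative (\<lambda>h. grad f x \<bullet> h)) (at x)"
proof -
  let ?D = "frechet_derivative f (at x)"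
  have D: "(f has_derivative ?D) (at x)" using assms frechet_derivative_works by blast
  have lin: "linear ?D" using assms by (rule linear_frechet_derivative)
  have "?D h = grad f x \<bullet> h" for h
  proof -
    have "?D h = ?D (\<Sum>i\<in>UNIV. (h $ i) *\<^sub>R axis i 1)"
      by (simp add: basis_expansion[where x=h, unfolded scalar_mult_eq_scaleR])
    also have "\<dots> = (\<Sum>i\<in>UNIV. (h $ i) * ?D (axis i 1))"
      unfolding linear_sum[OF lin] using linear_cmul[OF lin, of "h $ i" "axis i 1" for i] by simp
    finally show ?thesis by (simp add: grad_def inner_vec_def mult.commute)
  qed
  then have "?D = (\<lambda>h. grad f x \<bullet> h)" by auto
  then show ?thesis using D by simp
qed

lemma grad_eqI:
  assumes "(f has_derivative (\<lambda>h. v \<bullet> h)) (at x)"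
  shows "grad f x = v"
  using frechet_derivative_at[OF assms, symmetric] by (simp add: grad_def vec_eq_iff inner_axis)

lemma grad_eqI_axis:
  assumes "(f has_derivative D) (at x)"
  shows "grad f x $ i = D (axis i 1)"
  using frechet_derivative_at[OF assms] by (simp add: grad_def)

lemma grad_add:
  assumes "f differentiable (at x)" "g differentiable (at x)"
  shows "grad (\<lambda>x. f x + g x) x = grad f x + grad g x"
  by (rule grad_eqI) (use has_derivative_add[OF assms[THEN has_derivative_grad]] in \<open>simp add: inner_add_left\<close>)

lemma grad_cmult:
  assumes "f differentiable (at x)"
  shows "grad (\<lambda>x. c * f x) x = c *\<^sub>R grad f x"
  by (rule grad_eqI) (use has_derivative_mult_right[OF assms[THEN has_derivative_grad]] in simp)

lemma grad_mult:
  assumes "f differentiable (at x)" "g differentiable (at x)"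
  shows "grad (\<lambda>x. f x * g x) x = f x *\<^sub>R grad g x + g x *\<^sub>R grad f x"
  by (rule grad_eqI) (use has_derivative_mult[OF assms[THEN has_derivative_grad]] in \<open>simp add: inner_add_left algebra_simps\<close>)

lemma C_k_SucD: "C_k (Suc k) f \<Longrightarrow> f differentiable (at x)"
  by (simp add: differentiable_on_def)

text \<open>The product rule leaves one factor undifferentiated, so the induction for products has
  to give up one order of smoothness for that factor.\<close>

lemma C_k_decr: "C_k (Suc k) f \<Longrightarrow> C_k k f"
proof (induction k arbitrary: f)
  case 0 then show ?case by (auto intro: differentiable_imp_continuous_on)
next
  case (Suc k)
  then have "f differentiable_on UNIV" "\<And>i. C_k (Suc k) (\<lambda>x. grad f x $ i)" by (auto simp del: C_k.simps simp: C_k.simps(2)[of "Suc k"])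
  then show ?case using Suc.IH by auto
qed

lemma C_k_const: "C_k k (\<lambda>x. c)"
proof (induction k arbitrary: c)
  case (Suc k)
  have "grad (\<lambda>x. c) x = 0" for x :: plane by (rule grad_eqI) simp
  with Suc[of 0] show ?case by simp
qed simp

lemma C_k_add: "C_k k f \<Longrightarrow> C_k k g \<Longrightarrow> C_k k (\<lambda>x. f x + g x)"
proof (induction k arbitrary: f g)
  case (Suc k)
  have "grad (\<lambda>x. f x + g x) = (\<lambda>x. grad f x + grad g x)"
    using Suc.prems by (intro ext grad_add C_k_SucD)
  then show ?case using Suc by (auto intro!: derivative_intros)
qed (auto intro!: continuous_intros)

lemma C_k_mult: "C_k k f \<Longrightarrow> C_k k g \<Longrightarrow> C_k k (\<lambda>x. f x * g x)"
proof (induction k arbitrary: f g)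
  case (Suc k)
  have "grad (\<lambda>x. f x * g x) = (\<lambda>x. f x *\<^sub>R grad g x + g x *\<^sub>R grad f x)"
    using Suc.prems by (intro ext grad_mult C_k_SucD)
  moreover have "C_k k (\<lambda>x. f x * grad g x $ i + g x * grad f x $ i)" for i
    using Suc.prems by (intro C_k_add Suc.IH) (auto intro: C_k_decr simp del: C_k.simps simp: C_k.simps(2)[of k])
  ultimately show ?case using Suc.prems by (auto intro!: derivative_intros differentiable_on_mult)
qed (auto intro!: continuous_intros)

definition smooth :: "(plane \<Rightarrow> real) \<Rightarrow> bool" where "smooth f \<longleftrightarrow> (\<forall>k. C_k k f)"

lemma smooth_const [intro]: "smooth (\<lambda>x. c)"
  and smooth_add [intro]: "smooth f \<Longrightarrow> smooth g \<Longrightarrow> smooth (\<lambda>x. f x + g x)"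
  and smooth_mult [intro]: "smooth f \<Longrightarrow> smooth g \<Longrightarrow> smooth (\<lambda>x. f x * g x)"
  by (auto simp: smooth_def C_k_const C_k_add C_k_mult)

lemma smooth_differentiable: "smooth f \<Longrightarrow> f differentiable (at x)"
  unfolding smooth_def using C_k_SucD by blast

lemma smooth_grad: "smooth f \<Longrightarrow> smooth (\<lambda>x. grad f x $ i)"
  unfolding smooth_def using C_k.simps(2) by blast

lemma smooth_continuous: "smooth f \<Longrightarrow> continuous_on UNIV f"
  unfolding smooth_def using C_k.simps(1) by blast

lemma smooth_continuous_grad: "smooth f \<Longrightarrow> continuous_on UNIV (grad f)"
proof -
  assume "smooth f"
  then have "continuous_on UNIV (\<lambda>x. \<chi> i. grad f x $ i)"
    by (intro continuous_on_vec_lambda smooth_continuous smooth_grad)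
  then show ?thesis by simp
qed

text \<open>By the chain rule each partial derivative of the composite is a combination, with
  constant coefficients, of partial derivatives of \<open>f\<close> composed with the same affine
  map, so the induction closes once \<open>f\<close> is generalised.\<close>

lemma C_k_linear_comp:
  assumes "linear A"
  shows "C_k k f \<Longrightarrow> C_k k (\<lambda>x. f (a + A x))"
proof (induction k arbitrary: f)
  case 0
  have "continuous_on UNIV (\<lambda>x. a + A x)"
    using assms by (intro continuous_intros linear_continuous_on linear_conv_bounded_linear[THEN iffD1])
  then show ?case using 0 continuous_on_compose2[of UNIV f UNIV "\<lambda>x. a + A x"] by simp
next
  case (Suc k)
  have bl: "bounded_linear A" using assms by (simp add: linear_conv_bounded_linear)
  have d: "((\<lambda>x. f (a + A x)) has_derivative (\<lambda>h. grad f (a + A x) \<bullet> A h)) (at x)" for x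
  proof -
    have 1: "((\<lambda>x. a + A x) has_derivative A) (at x)"
      using bl by (auto intro!: derivative_eq_intros bounded_linear_imp_has_derivative)
    have 2: "(f has_derivative (\<lambda>h. grad f (a + A x) \<bullet> h)) (at (a + A x))"
      by (rule has_derivative_grad[OF C_k_SucD[OF Suc.prems]])
    show ?thesis using diff_chain_at[OF 1 2] by (simp add: o_def)
  qed
  have "grad (\<lambda>x. f (a + A x)) x $ i = (\<Sum>j\<in>UNIV. A (axis i 1) $ j * grad f (a + A x) $ j)" for x i
    using grad_eqI_axis[OF d] by (simp add: inner_vec_def mult.commute)
  moreover have "C_k k (\<lambda>x. (\<Sum>j\<in>UNIV. A (axis i 1) $ j * grad f (a + A x) $ j))" for i
    using Suc by (simp add: sum_2) (intro C_k_add C_k_mult C_k_const, auto)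
  moreover have "(\<lambda>x. f (a + A x)) differentiable_on UNIV"
    using d by (auto simp: differentiable_on_def differentiable_def)
  ultimately show ?case by simp
qed

lemma smooth_linear_comp: "linear A \<Longrightarrow> smooth f \<Longrightarrow> smooth (\<lambda>x. f (a + A x))"
  unfolding smooth_def using C_k_linear_comp by blast

lemma smooth_nth [intro]: "smooth (\<lambda>x. x $ i)"
  unfolding smooth_def
proof
  fix k
  have "((\<lambda>x. x $ i) has_derivative (\<lambda>h. h $ i)) (at x)" for x :: plane
    by (rule bounded_linear_imp_has_derivative) (rule bounded_linear_vec_nth)
  then have g: "grad (\<lambda>x. x $ i) x = axis i 1" for x
    by (intro grad_eqI) (simp add: inner_axis')
  show "C_k k (\<lambda>x. x $ i)"
  proof (cases k)
    case (Suc m)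
    have "(\<lambda>x::plane. x $ i) differentiable_on UNIV"
      by (simp add: differentiable_on_def bounded_linear_imp_differentiable bounded_linear_vec_nth)
    then show ?thesis using Suc g by (simp add: C_k_const)
  qed (auto intro!: continuous_intros)
qed

section \<open>Test functions: support, algebra and gradients\<close>

lemma test_functions_iff:
  "\<phi> \<in> test_functions \<Omega> \<longleftrightarrow> smooth \<phi> \<and> compact (closure {x. \<phi> x \<noteq> 0}) \<and> closure {x. \<phi> x \<noteq> 0} \<subseteq> \<Omega>"
  by (simp add: test_functions_def smooth_def)

text \<open>Any compact \<open>K\<close> in \<Omega> that carries \<open>\<phi>\<close> will do,
  because the closure of the support is a closed subset of it. Supports of sums, products and
  composites need not be computed.\<close>

lemma test_functionsI:
  assumes "smooth \<phi>" "compact K" "K \<subseteq> \<Omega>" "\<And>x. x \<notin> K \<Longrightarrow> \<phi> x = 0"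
  shows "\<phi> \<in> test_functions \<Omega>"
proof -
  have "closure {x. \<phi> x \<noteq> 0} \<subseteq> K"
    using assms by (intro closure_minimal compact_imp_closed) auto
  then show ?thesis using assms
    by (auto simp: test_functions_iff simp del: compact_closure
       intro: compact_Int_closed[of K "closure {x. \<phi> x \<noteq> 0}", unfolded Int_absorb1[OF \<open>closure {x. \<phi> x \<noteq> 0} \<subseteq> K\<close>]])
qed

text \<open>The same \<open>K\<close> carries the gradient too, since \<open>\<phi>\<close> vanishes
  on the open complement of \<open>K\<close>.\<close>

lemma test_functionsE:
  assumes "\<phi> \<in> test_functions \<Omega>"
  obtains K where "smooth \<phi>" "compact K" "K \<subseteq> \<Omega>" "\<And>x. x \<notin> K \<Longrightarrow> \<phi> x = 0" "\<And>x. x \<notin> K \<Longrightarrow> grad \<phi> x = 0"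
proof -
  define K where "K = closure {x. \<phi> x \<noteq> 0}"
  have K: "smooth \<phi>" "compact K" "K \<subseteq> \<Omega>"
    using assms unfolding test_functions_iff K_def by simp_all
  have z: "\<phi> x = 0" if "x \<notin> K" for x
    using that closure_subset[of "{x. \<phi> x \<noteq> 0}"] unfolding K_def by blast
  have "grad \<phi> x = 0" if x: "x \<notin> K" for x
  proof (rule grad_eqI)
    have "((\<lambda>x. 0) has_derivative (\<lambda>h. 0 \<bullet> h)) (at x)" by simp
    then show "(\<phi> has_derivative (\<lambda>h. 0 \<bullet> h)) (at x)"
    proof (rule has_derivative_transform_within_open[where s="- K"])
      show "open (- K)" using K(2) by (simp add: compact_imp_closed open_Compl)
    qed (use x z in auto)
  qed
  with K z that show thesis by blast
qed

lemma test_functions_zero: "(\<lambda>x. 0) \<in> test_functions \<Omega>"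
  by (rule test_functionsI[of _ "{}"]) auto

lemma test_functions_cmult: "\<phi> \<in> test_functions \<Omega> \<Longrightarrow> (\<lambda>x. c * \<phi> x) \<in> test_functions \<Omega>"
  by (erule test_functionsE, rule test_functionsI) auto

lemma test_functions_add:
  assumes "\<phi> \<in> test_functions \<Omega>" "\<psi> \<in> test_functions \<Omega>"
  shows "(\<lambda>x. \<phi> x + \<psi> x) \<in> test_functions \<Omega>"
proof -
  from assms(1) obtain K where K: "smooth \<phi>" "compact K" "K \<subseteq> \<Omega>" "\<And>x. x \<notin> K \<Longrightarrow> \<phi> x = 0"
    by (rule test_functionsE) blast
  from assms(2) obtain L where L: "smooth \<psi>" "compact L" "L \<subseteq> \<Omega>" "\<And>x. x \<notin> L \<Longrightarrow> \<psi> x = 0"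
    by (rule test_functionsE) blast
  show ?thesis by (rule test_functionsI[of _ "K \<union> L"]) (use K L in auto)
qed

lemma test_functions_diff:
  assumes "\<phi> \<in> test_functions \<Omega>" "\<psi> \<in> test_functions \<Omega>"
  shows "(\<lambda>x. \<phi> x - \<psi> x) \<in> test_functions \<Omega>"
  using test_functions_add[OF assms(1) test_functions_cmult[OF assms(2), of "-1"]] by simp

lemma test_functions_mult_smooth:
  assumes "\<phi> \<in> test_functions \<Omega>" "smooth f"
  shows "(\<lambda>x. f x * \<phi> x) \<in> test_functions \<Omega>"
  using assms by (elim test_functionsE, intro test_functionsI) auto

lemma test_functions_mono: "\<Omega> \<subseteq> \<Omega>' \<Longrightarrow> test_functions \<Omega> \<subseteq> test_functions \<Omega>'"
  unfolding test_functions_def by blast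

lemma test_functions_grad:
  assumes "\<phi> \<in> test_functions \<Omega>" shows "(\<lambda>x. grad \<phi> x $ i) \<in> test_functions \<Omega>"
  using assms by (elim test_functionsE, intro test_functionsI) (auto intro: smooth_grad)

lemma test_functions_differentiable: "\<phi> \<in> test_functions \<Omega> \<Longrightarrow> \<phi> differentiable (at x)"
  by (simp add: test_functions_iff smooth_differentiable)

section \<open>Integrability of test functions, integration by parts, the Poincare
  inequality\<close>

lemma integrable_compact_support:
  fixes f :: "'a::euclidean_space \<Rightarrow> 'b::euclidean_space"
  assumes "continuous_on UNIV f" "compact K" "\<And>x. x \<notin> K \<Longrightarrow> f x = 0"
  shows "integrable lborel f"
proof -
  have "integrable lborel (\<lambda>x. indicator K x *\<^sub>R f x)"
    using assms by (intro borel_integrable_compact) (auto intro: continuous_on_subset)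
  moreover have "(\<lambda>x. indicator K x *\<^sub>R f x) = f"
    using assms(3) by (auto simp: indicator_def)
  ultimately show ?thesis by simp
qed

lemma test_functions_continuous: "\<phi> \<in> test_functions \<Omega> \<Longrightarrow> continuous_on UNIV \<phi>"
  by (simp add: test_functions_iff smooth_continuous)

lemma test_functions_continuous_grad: "\<phi> \<in> test_functions \<Omega> \<Longrightarrow> continuous_on UNIV (grad \<phi>)"
  by (simp add: test_functions_iff smooth_continuous_grad)

lemma test_function_zero_outside: "\<phi> \<in> test_functions \<Omega> \<Longrightarrow> x \<notin> \<Omega> \<Longrightarrow> \<phi> x = 0"
  by (erule test_functionsE) blast

lemma test_function_grad_zero_outside: "\<phi> \<in> test_functions \<Omega> \<Longrightarrow> x \<notin> \<Omega> \<Longrightarrow> grad \<phi> x = 0"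
  by (erule test_functionsE) blast

lemma integrable_test_function: "\<phi> \<in> test_functions \<Omega> \<Longrightarrow> integrable lborel \<phi>"
  by (erule test_functionsE) (auto intro: integrable_compact_support smooth_continuous)

lemma integrable_test_mult:
  assumes "\<phi> \<in> test_functions \<Omega>" "continuous_on UNIV f"
  shows "integrable lborel (\<lambda>x. f x * \<phi> x)"
  using assms
  by (elim test_functionsE, intro integrable_compact_support continuous_on_mult) (auto intro: smooth_continuous)

lemma integrable_grad_inner:
  assumes "\<phi> \<in> test_functions \<Omega>" "continuous_on UNIV f"
  shows "integrable lborel (\<lambda>x. f x \<bullet> grad \<phi> x)"
  using assms
  by (elim test_functionsE, intro integrable_compact_support continuous_on_inner smooth_continuous_grad) auto

lemma integrable_grad_sq:
  assumes "\<phi> \<in> test_functions \<Omega>"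
  shows "integrable lborel (\<lambda>x. (norm (grad \<phi> x))\<^sup>2)"
  using integrable_grad_inner[OF assms test_functions_continuous_grad[OF assms]]
  by (simp add: power2_norm_eq_inner)

text \<open>Integrals are translation invariant, so the difference quotients of \<open>f\<close> integrate to \<open>0\<close>;
  they converge boundedly to the partial derivative.\<close>

lemma integral_grad_eq_0:
  assumes f: "f \<in> test_functions \<Omega>"
  shows "(LINT x|lborel. grad f x $ i) = 0"
proof -
  obtain K where K: "smooth f" "compact K" "\<And>x. x \<notin> K \<Longrightarrow> f x = 0" "\<And>x. x \<notin> K \<Longrightarrow> grad f x = 0"
    using f by (rule test_functionsE) blast
  define e :: plane where "e = axis i 1"
  define q where "q n x = real (Suc n) * (f (x + (1 / real (Suc n)) *\<^sub>R e) - f x)" for n x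
  obtain M where M: "\<And>x. norm (grad f x) \<le> M" "M \<ge> 0"
  proof -
    have "bounded (grad f ` K)"
      using smooth_continuous_grad[OF K(1)] K(2)
      by (intro compact_imp_bounded compact_continuous_image) (auto intro: continuous_on_subset)
    then obtain M where "\<And>x. x \<in> K \<Longrightarrow> norm (grad f x) \<le> M" by (auto simp: bounded_iff)
    then have "norm (grad f x) \<le> max M 0" for x using K(4)[of x] by (cases "x \<in> K") fastforce+
    then show ?thesis using that[of "max M 0"] by simp
  qed
  obtain B where B: "\<And>x. x \<in> K \<Longrightarrow> norm x \<le> B" using K(2) by (meson bounded_iff compact_imp_bounded)
  have int_f: "integrable lborel f" by (rule integrable_test_function[OF f])
  have e1: "norm e = 1" by (simp add: e_def)
  have lip: "norm (f y - f x) \<le> M * norm (y - x)" for x y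
  proof (rule differentiable_bound[where S=UNIV and f'="\<lambda>x h. grad f x \<bullet> h"])
    show "(f has_derivative (\<bullet>) (grad f x)) (at x within UNIV)" for x
      using has_derivative_grad[OF smooth_differentiable[OF K(1)]] by simp
    show "onorm ((\<bullet>) (grad f x)) \<le> M" for x
    proof (rule onorm_le)
      fix h show "norm (grad f x \<bullet> h) \<le> M * norm h"
        unfolding real_norm_def by (rule order_trans[OF Cauchy_Schwarz_ineq2]) (use M in \<open>auto intro: mult_right_mono\<close>)
    qed
  qed auto
  have q0: "(LINT x|lborel. q n x) = 0" for n
  proof -
    have d: "integrable (distr lborel borel ((+) t)) f" "(LINT x|distr lborel borel ((+) t). f x) = (LINT x|lborel. f x)" for t :: plane
      using int_f by (simp_all add: lborel_distr_plus)
    have "integrable lborel (\<lambda>x. f (x + t))" "(LINT x|lborel. f (x + t)) = (LINT x|lborel. f x)" for t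
      using d[of t] int_f by (simp_all add: integrable_distr_eq integral_distr add.commute)
    then show ?thesis using int_f unfolding q_def by simp
  qed
  have lim: "(\<lambda>n. LINT x|lborel. q n x) \<longlonglongrightarrow> (LINT x|lborel. grad f x $ i)"
  \<comment> \<open>The increments have length at most 1, so the quotients vanish once
    \<open>x\<close> is farther than \<open>B + 1\<close> from the origin; inside that ball the
    Lipschitz bound \<open>M\<close> dominates.\<close>
  proof (rule integral_dominated_convergence[where w="\<lambda>x. M * indicator (cball 0 (B + 1)) x"])
    show "(\<lambda>x. grad f x $ i) \<in> borel_measurable lborel"
      using smooth_continuous[OF smooth_grad[OF K(1)]] borel_measurable_continuous_onI by auto
    show "q n \<in> borel_measurable lborel" for n
      unfolding q_def using smooth_continuous[OF K(1)]
      by (auto intro!: borel_measurable_continuous_onI continuous_intros continuous_on_compose2[of UNIV f])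
    show "integrable lborel (\<lambda>x::plane. M * indicator (cball 0 (B + 1)) x)"
      using emeasure_lborel_cball_finite[of "0::plane" "B + 1"]
      by (intro integrable_mult_right integrable_real_indicator) auto
    show "AE x in lborel. (\<lambda>n. q n x) \<longlonglongrightarrow> grad f x $ i"
    proof (rule AE_I2)
      fix x
      have "((\<lambda>t. f (x + t *\<^sub>R e)) has_derivative (\<lambda>t. grad f x \<bullet> (t *\<^sub>R e))) (at 0)"
      proof -
        have 1: "((\<lambda>t. x + t *\<^sub>R e) has_derivative (\<lambda>t. t *\<^sub>R e)) (at 0)"
          by (auto intro!: derivative_eq_intros)
        have 2: "(f has_derivative (\<lambda>h. grad f x \<bullet> h)) (at (x + 0 *\<^sub>R e))"
          using has_derivative_grad[OF smooth_differentiable[OF K(1)]] by simp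
        show ?thesis using diff_chain_at[OF 1 2] by (simp add: o_def)
      qed
      then have "((\<lambda>t. f (x + t *\<^sub>R e)) has_real_derivative (grad f x \<bullet> e)) (at 0)"
        by (rule has_derivative_imp_has_field_derivative) simp
      then have "((\<lambda>t. (f (x + t *\<^sub>R e) - f x) / t) \<longlongrightarrow> grad f x \<bullet> e) (at 0)"
        by (simp add: DERIV_def)
      moreover have "filterlim (\<lambda>n. 1 / real (Suc n)) (at 0) sequentially"
        by real_asymp
      ultimately have "((\<lambda>n. (f (x + (1 / real (Suc n)) *\<^sub>R e) - f x) / (1 / real (Suc n))) \<longlongrightarrow> grad f x \<bullet> e) sequentially"
        by (rule filterlim_compose)
      then show "(\<lambda>n. q n x) \<longlonglongrightarrow> grad f x $ i"
        by (simp add: q_def e_def inner_axis mult.commute)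
    qed
    show "AE x in lborel. norm (q n x) \<le> M * indicator (cball 0 (B + 1)) x" for n
    proof (rule AE_I2)
      fix x
      show "norm (q n x) \<le> M * indicator (cball 0 (B + 1)) x"
      proof (cases "x \<in> cball 0 (B + 1)")
        case True
        have "norm (q n x) \<le> real (Suc n) * (M * norm ((1 / real (Suc n)) *\<^sub>R e))"
          unfolding q_def norm_mult using lip[of "x + (1 / real (Suc n)) *\<^sub>R e" x]
          by (intro mult_mono) auto
        also have "\<dots> = M" using e1 by simp
        finally show ?thesis using True by simp
      next
        case False
        then have "norm x > B + 1" by simp
        moreover have "norm ((1 / real (Suc n)) *\<^sub>R e) \<le> 1" using e1 by (simp add: field_simps)
        moreover have "norm (x + z) > B" if "norm x > B + 1" "norm z \<le> 1" for z
          using norm_triangle_ineq4[of "x + z" z] that by simp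
        ultimately have "norm (x + (1 / real (Suc n)) *\<^sub>R e) > B" "norm x > B" by auto
        then have "x + (1 / real (Suc n)) *\<^sub>R e \<notin> K" "x \<notin> K" using B by force+
        then show ?thesis using K(3) False by (simp add: q_def)
      qed
    qed
  qed
  show ?thesis using lim q0 by (simp add: LIMSEQ_const_iff)
qed

text \<open>The product of \<open>f\<close> with the test function is again a test function, so the
  integral of each partial derivative of the product vanishes.\<close>

lemma integration_by_parts:
  assumes "\<phi> \<in> test_functions \<Omega>" "smooth f"
  shows "(LINT x|lborel. f x * grad \<phi> x $ i) = - (LINT x|lborel. grad f x $ i * \<phi> x)"
proof -
  have c: "continuous_on UNIV f" "continuous_on UNIV (\<lambda>x. grad f x $ i)"
    using assms(2) smooth_continuous smooth_grad by blast+
  have "0 = (LINT x|lborel. grad (\<lambda>x. f x * \<phi> x) x $ i)"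
    using integral_grad_eq_0[OF test_functions_mult_smooth[OF assms]] by simp
  also have "\<dots> = (LINT x|lborel. f x * grad \<phi> x $ i + grad f x $ i * \<phi> x)"
    using assms by (intro Bochner_Integration.integral_cong)
       (auto simp: grad_mult smooth_differentiable test_functions_differentiable)
  also have "\<dots> = (LINT x|lborel. f x * grad \<phi> x $ i) + (LINT x|lborel. grad f x $ i * \<phi> x)"
    using assms by (intro Bochner_Integration.integral_add integrable_test_mult[where \<Omega>=\<Omega>] c test_functions_grad)
  finally show ?thesis by simp
qed

lemma integrable_test_sq: "\<phi> \<in> test_functions \<Omega> \<Longrightarrow> integrable lborel (\<lambda>x. (\<phi> x)\<^sup>2)"
  using integrable_test_mult[OF _ test_functions_continuous, of \<phi> \<Omega> \<phi>] by (simp add: power2_eq_square)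

text \<open>Integrating by parts, \<open>\<integral>\<phi>\<^sup>2 = - 2 \<integral>x\<^sub>1 \<phi> \<partial>\<^sub>1\<phi>\<close>.\<close>

lemma poincare_inequality:
  assumes phi: "\<phi> \<in> test_functions \<Omega>" and R: "\<And>x. x \<in> \<Omega> \<Longrightarrow> norm x \<le> R"
  shows "(LINT x|lborel. (\<phi> x)\<^sup>2) \<le> 4 * R\<^sup>2 * (LINT x|lborel. (norm (grad \<phi> x))\<^sup>2)"
proof -
  have s: "smooth \<phi>" using phi by (simp add: test_functions_iff)
  have c: "continuous_on UNIV (\<lambda>x. x $ 1 * grad \<phi> x $ 1)"
    using s by (intro continuous_intros smooth_continuous smooth_grad)
  have g: "grad (\<lambda>x. x $ 1 * \<phi> x) x $ 1 = x $ 1 * grad \<phi> x $ 1 + \<phi> x" for x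
  proof -
    have "grad (\<lambda>x. x $ 1) x = axis 1 1"
      by (rule grad_eqI) (simp add: inner_axis' bounded_linear_imp_has_derivative bounded_linear_vec_nth)
    then show ?thesis using s by (subst grad_mult) (auto intro: smooth_differentiable)
  qed
  have p: "(LINT x|lborel. (x $ 1 * \<phi> x) * grad \<phi> x $ 1) = - (LINT x|lborel. (x $ 1 * grad \<phi> x $ 1 + \<phi> x) * \<phi> x)"
    using integration_by_parts[OF phi smooth_mult[OF smooth_nth s], of 1 1] unfolding g .
  have i1: "integrable lborel (\<lambda>x. (x $ 1 * grad \<phi> x $ 1) * \<phi> x)"
    by (rule integrable_test_mult[OF phi c])
  have i2: "integrable lborel (\<lambda>x. \<phi> x * \<phi> x)"
    by (rule integrable_test_mult[OF phi smooth_continuous[OF s]])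
  have eq: "(LINT x|lborel. (\<phi> x)\<^sup>2) = - 2 * (LINT x|lborel. (x $ 1 * grad \<phi> x $ 1) * \<phi> x)"
  proof -
    have "(LINT x|lborel. (x $ 1 * grad \<phi> x $ 1 + \<phi> x) * \<phi> x) =
      (LINT x|lborel. (x $ 1 * grad \<phi> x $ 1) * \<phi> x) + (LINT x|lborel. \<phi> x * \<phi> x)"
      unfolding distrib_right by (rule Bochner_Integration.integral_add[OF i1 i2])
    moreover have "(LINT x|lborel. (x $ 1 * \<phi> x) * grad \<phi> x $ 1) = (LINT x|lborel. (x $ 1 * grad \<phi> x $ 1) * \<phi> x)"
      by (simp add: ac_simps)
    ultimately show ?thesis using p by (simp add: power2_eq_square)
  qed
  have "- 2 * (LINT x|lborel. (x $ 1 * grad \<phi> x $ 1) * \<phi> x) =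
        (LINT x|lborel. - 2 * ((x $ 1 * grad \<phi> x $ 1) * \<phi> x))" by simp
  \<comment> \<open>Young's inequality, weighted so that only half of \<integral>\<phi>^2 reappears
    on the right and can be absorbed; this produces the factor 4.\<close>
  also have "\<dots> \<le> (LINT x|lborel. (\<phi> x)\<^sup>2 / 2 + 2 * R\<^sup>2 * (norm (grad \<phi> x))\<^sup>2)"
  proof (rule integral_mono)
    show "integrable lborel (\<lambda>x. - 2 * ((x $ 1 * grad \<phi> x $ 1) * \<phi> x))" using i1 by simp
    show "integrable lborel (\<lambda>x. (\<phi> x)\<^sup>2 / 2 + 2 * R\<^sup>2 * (norm (grad \<phi> x))\<^sup>2)"
      using integrable_test_sq[OF phi] integrable_grad_sq[OF phi] by simp
    fix x
    show "- 2 * ((x $ 1 * grad \<phi> x $ 1) * \<phi> x) \<le> (\<phi> x)\<^sup>2 / 2 + 2 * R\<^sup>2 * (norm (grad \<phi> x))\<^sup>2"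
    proof (cases "x \<in> \<Omega>")
      case True
      define y where "y = x $ 1 * grad \<phi> x $ 1"
      have "y\<^sup>2 \<le> R\<^sup>2 * (norm (grad \<phi> x))\<^sup>2"
      proof -
        have "\<bar>y\<bar> \<le> R * norm (grad \<phi> x)"
          unfolding y_def abs_mult using R[OF True] component_le_norm_cart[of x 1] component_le_norm_cart[of "grad \<phi> x" 1]
          by (intro mult_mono) auto
        then have "\<bar>y\<bar>\<^sup>2 \<le> (R * norm (grad \<phi> x))\<^sup>2" by (intro power_mono) auto
        then show ?thesis by (simp add: power_mult_distrib)
      qed
      moreover have "- 2 * (y * \<phi> x) \<le> (\<phi> x)\<^sup>2 / 2 + 2 * y\<^sup>2"
        using zero_le_power2[of "\<phi> x + 2 * y"] by (simp add: power2_eq_square field_simps)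
      ultimately show ?thesis by (simp add: y_def)
    next
      case False
      then show ?thesis using test_function_zero_outside[OF phi False] by simp
    qed
  qed
  also have "\<dots> = (LINT x|lborel. (\<phi> x)\<^sup>2) / 2 + 2 * R\<^sup>2 * (LINT x|lborel. (norm (grad \<phi> x))\<^sup>2)"
    using integrable_test_sq[OF phi] integrable_grad_sq[OF phi] by simp
  finally show ?thesis using eq by linarith
qed

section \<open>Square integrable functions\<close>

text \<open>Square integrability for an arbitrary measure. Functions given on \<Omega> are
  multiplied by its indicator, so that integrals can run over the whole plane.\<close>

definition sq_int :: "'a measure \<Rightarrow> ('a \<Rightarrow> 'b::euclidean_space) \<Rightarrow> bool" where
  "sq_int M f \<longleftrightarrow> f \<in> borel_measurable M \<and> integrable M (\<lambda>x. (norm (f x))\<^sup>2)"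

lemma norm_add_sq_le: "(norm (a + b :: 'b::euclidean_space))\<^sup>2 \<le> 2 * (norm a)\<^sup>2 + 2 * (norm b)\<^sup>2"
proof -
  have "0 \<le> (norm (a - b))\<^sup>2" by simp
  then show ?thesis
    unfolding power2_norm_eq_inner by (simp add: inner_add_left inner_add_right inner_diff_left inner_diff_right inner_commute)
qed

lemma sq_int_integrable_inner:
  assumes "sq_int M f" "sq_int M g" shows "integrable M (\<lambda>x. f x \<bullet> g x)"
proof (rule Bochner_Integration.integrable_bound)
  show "integrable M (\<lambda>x. (norm (f x))\<^sup>2 + (norm (g x))\<^sup>2)" using assms by (simp add: sq_int_def)
  show "(\<lambda>x. f x \<bullet> g x) \<in> borel_measurable M" using assms by (auto simp: sq_int_def)
  have "\<bar>a \<bullet> b\<bar> \<le> (norm a)\<^sup>2 + (norm b)\<^sup>2" for a b :: 'b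
  proof -
    have "\<bar>a \<bullet> b\<bar> \<le> norm a * norm b" by (rule Cauchy_Schwarz_ineq2)
    also have "\<dots> \<le> (norm a)\<^sup>2 + (norm b)\<^sup>2"
      using sum_squares_bound[of "norm a" "norm b"] mult_nonneg_nonneg[of "norm a" "norm b"] norm_ge_zero[of a] norm_ge_zero[of b] by linarith
    finally show ?thesis .
  qed
  then show "AE x in M. norm (f x \<bullet> g x) \<le> norm ((norm (f x))\<^sup>2 + (norm (g x))\<^sup>2)" by simp
qed

lemma sq_int_add: assumes "sq_int M f" "sq_int M g" shows "sq_int M (\<lambda>x. f x + g x)"
  unfolding sq_int_def
proof
  show m: "(\<lambda>x. f x + g x) \<in> borel_measurable M" using assms by (auto simp: sq_int_def)
  show "integrable M (\<lambda>x. (norm (f x + g x))\<^sup>2)"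
  proof (rule Bochner_Integration.integrable_bound)
    show "integrable M (\<lambda>x. 2 * (norm (f x))\<^sup>2 + 2 * (norm (g x))\<^sup>2)" using assms by (simp add: sq_int_def)
    show "(\<lambda>x. (norm (f x + g x))\<^sup>2) \<in> borel_measurable M" using m by measurable
    show "AE x in M. norm ((norm (f x + g x))\<^sup>2) \<le> norm (2 * (norm (f x))\<^sup>2 + 2 * (norm (g x))\<^sup>2)"
      by (simp add: norm_add_sq_le)
  qed
qed

lemma sq_int_scaleR: assumes "sq_int M f" shows "sq_int M (\<lambda>x. c *\<^sub>R f x)"
  using assms by (auto simp: sq_int_def power_mult_distrib)

lemma sq_int_diff: assumes "sq_int M f" "sq_int M g" shows "sq_int M (\<lambda>x. f x - g x)"
  using sq_int_add[OF assms(1) sq_int_scaleR[OF assms(2), of "-1"]] by simp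

text \<open>As a polynomial in \<open>c\<close> this serves three ends: nonnegativity gives the
  Cauchy-Schwarz inequality, \<open>c = -1\<close> gives convergence of norms, and general
  \<open>c\<close> expands the torsion energy.\<close>

lemma integral_norm_add_sq:
  assumes "sq_int M f" "sq_int M g"
  shows "(LINT x|M. (norm (f x + c *\<^sub>R g x))\<^sup>2) =
    (LINT x|M. (norm (f x))\<^sup>2) + 2 * c * (LINT x|M. f x \<bullet> g x) + c\<^sup>2 * (LINT x|M. (norm (g x))\<^sup>2)"
proof -
  have "(norm (f x + c *\<^sub>R g x))\<^sup>2 = (norm (f x))\<^sup>2 + 2 * c * (f x \<bullet> g x) + c\<^sup>2 * (norm (g x))\<^sup>2" for x
    unfolding power2_norm_eq_inner
    by (simp add: inner_add_left inner_add_right inner_commute power2_eq_square algebra_simps)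
  then show ?thesis
    using assms sq_int_integrable_inner[OF assms] by (simp add: sq_int_def)
qed

text \<open>The quadratic A + 2tB + t^2 C is nonnegative for every t; inserting its vertex bounds
  B^2 by A C.\<close>

lemma integral_inner_Cauchy_Schwarz:
  assumes "sq_int M f" "sq_int M g"
  shows "\<bar>LINT x|M. f x \<bullet> g x\<bar> \<le> sqrt (LINT x|M. (norm (f x))\<^sup>2) * sqrt (LINT x|M. (norm (g x))\<^sup>2)"
proof -
  define A B C where "A = (LINT x|M. (norm (f x))\<^sup>2)" and "B = (LINT x|M. f x \<bullet> g x)" and "C = (LINT x|M. (norm (g x))\<^sup>2)"
  have q: "0 \<le> A + 2 * t * B + t\<^sup>2 * C" for t
    using integral_norm_add_sq[OF assms, of t] by (simp add: A_def B_def C_def integral_nonneg flip: integral_norm_add_sq[OF assms])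
  have "A \<ge> 0" "C \<ge> 0" by (simp_all add: A_def C_def)
  have "B\<^sup>2 \<le> A * C"
  proof (cases "C = 0")
    case True
    have "B = 0"
    proof (rule ccontr)
      assume "B \<noteq> 0"
      \<comment> \<open>For C = 0 the quadratic is affine in t, and this t gives it the value
        -1.\<close>
      then show False using q[of "- (A + 1) / (2 * B)"] True by (simp add: field_simps)
    qed
    then show ?thesis using True by simp
  next
    case False
    then have "C > 0" using \<open>C \<ge> 0\<close> by simp
    then show ?thesis using q[of "- B / C"] by (simp add: power2_eq_square field_simps)
  qed
  then have "sqrt (B\<^sup>2) \<le> sqrt (A * C)" by (rule real_sqrt_le_mono)
  then show ?thesis by (simp add: real_sqrt_mult A_def B_def C_def)
qed

lemma L2_tendsto_inner:
  assumes "\<And>n. sq_int M (f n)" "sq_int M g" "sq_int M h"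
    and lim: "(\<lambda>n. LINT x|M. (norm (f n x - g x))\<^sup>2) \<longlonglongrightarrow> 0"
  shows "(\<lambda>n. LINT x|M. f n x \<bullet> h x) \<longlonglongrightarrow> (LINT x|M. g x \<bullet> h x)"
proof -
  have "(\<lambda>n. sqrt (LINT x|M. (norm (f n x - g x))\<^sup>2) * sqrt (LINT x|M. (norm (h x))\<^sup>2)) \<longlonglongrightarrow> 0"
    using tendsto_mult_left_zero[OF tendsto_real_sqrt[OF lim, simplified]] by simp
  moreover have "norm ((LINT x|M. f n x \<bullet> h x) - (LINT x|M. g x \<bullet> h x))
      \<le> sqrt (LINT x|M. (norm (f n x - g x))\<^sup>2) * sqrt (LINT x|M. (norm (h x))\<^sup>2)" for n
    using integral_inner_Cauchy_Schwarz[OF sq_int_diff[OF assms(1)[of n] assms(2)] assms(3)]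
      sq_int_integrable_inner[OF assms(1)[of n] assms(3)] sq_int_integrable_inner[OF assms(2,3)]
    by (simp add: inner_diff_left)
  ultimately have "(\<lambda>n. (LINT x|M. f n x \<bullet> h x) - (LINT x|M. g x \<bullet> h x)) \<longlonglongrightarrow> 0"
    using Lim_null_comparison[OF always_eventually] by (metis (no_types, lifting))
  then show ?thesis by (simp add: LIM_zero_iff)
qed

lemma L2_tendsto_norm:
  assumes "\<And>n. sq_int M (f n)" "sq_int M g"
    and lim: "(\<lambda>n. LINT x|M. (norm (f n x - g x))\<^sup>2) \<longlonglongrightarrow> 0"
  shows "(\<lambda>n. LINT x|M. (norm (f n x))\<^sup>2) \<longlonglongrightarrow> (LINT x|M. (norm (g x))\<^sup>2)"
proof -
  have eq: "(LINT x|M. (norm (f n x))\<^sup>2) = (LINT x|M. (norm (f n x - g x))\<^sup>2)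
      + 2 * (LINT x|M. f n x \<bullet> g x) - (LINT x|M. (norm (g x))\<^sup>2)" for n
    using integral_norm_add_sq[OF assms(1)[of n] assms(2), of "-1"]
    by (simp)
  have "(\<lambda>n. (LINT x|M. (norm (f n x - g x))\<^sup>2)
      + 2 * (LINT x|M. f n x \<bullet> g x) - (LINT x|M. (norm (g x))\<^sup>2)) \<longlonglongrightarrow>
      0 + 2 * (LINT x|M. g x \<bullet> g x) - (LINT x|M. (norm (g x))\<^sup>2)"
    by (intro tendsto_intros lim L2_tendsto_inner assms)
  then show ?thesis unfolding eq by (simp add: power2_norm_eq_inner)
qed

text \<open>The rate 1/8 is chosen for later use: multiplied by the weight 4^j it still leaves the
  summable (1/2)^j.\<close>

lemma fast_Cauchy_subsequence:
  fixes d :: "nat \<Rightarrow> nat \<Rightarrow> real"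
  assumes "\<And>e. e > 0 \<Longrightarrow> \<exists>N. \<forall>m\<ge>N. \<forall>n\<ge>N. d m n < e"
  obtains k :: "nat \<Rightarrow> nat" where "strict_mono k" "\<And>j. d (k (Suc j)) (k j) \<le> (1/8) ^ j"
proof -
  have "\<exists>N. \<forall>m\<ge>N. \<forall>n\<ge>N. d m n < (1/8)^j" for j :: nat by (rule assms) simp
  then have "\<exists>N. \<forall>j. \<forall>m\<ge>N j. \<forall>n\<ge>N j. d m n < (1/8)^j" by (intro choice allI)
  then obtain N where N: "\<And>j m n. m \<ge> N j \<Longrightarrow> n \<ge> N j \<Longrightarrow> d m n < (1/8)^j" by blast
  \<comment> \<open>Partial sums of \<open>N i + 1\<close> increase strictly, and \<open>k j\<close>
    exceeds \<open>N j\<close>.\<close>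
  define k where "k j = (\<Sum>i\<le>j. N i + 1)" for j
  have "strict_mono k" by (rule strict_mono_Suc_iff[THEN iffD2]) (simp add: k_def)
  moreover have kN: "k j \<ge> N j" "k (Suc j) \<ge> N j" for j
  proof -
    have "N j + 1 \<le> k j" unfolding k_def by (rule member_le_sum) auto
    moreover have "k j \<le> k (Suc j)" by (simp add: k_def)
    ultimately show "k j \<ge> N j" "k (Suc j) \<ge> N j" by auto
  qed
  ultimately show ?thesis using that[of k, OF _ less_imp_le[OF N[OF kN(2) kN(1)]]] by blast
qed

text \<open>Each term of a nonnegative series is at most its finite total C, so the increments are
  bounded by sqrt C times 2^-j and the telescoping series converges absolutely.\<close>

lemma convergent_fast:
  fixes a :: "nat \<Rightarrow> 'b::euclidean_space"
  assumes "(\<Sum>j. ennreal (4 ^ j * (norm (a (Suc j) - a j))\<^sup>2)) \<noteq> \<infinity>"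
  shows "convergent a"
proof -
  define b where "b j = ennreal (4 ^ j * (norm (a (Suc j) - a j))\<^sup>2)" for j
  define C where "C = enn2real (\<Sum>j. b j)"
  have C: "(\<Sum>j. b j) = ennreal C"
    unfolding C_def by (rule ennreal_enn2real[symmetric]) (use assms in \<open>simp add: b_def less_top\<close>)
  have bd: "norm (a (Suc j) - a j) \<le> sqrt C * (1/2) ^ j" for j
  proof -
    have "b j = sum b {j}" by simp
    also have "\<dots> \<le> (\<Sum>j. b j)" by (rule sum_le_suminf) auto
    finally have "ennreal (4 ^ j * (norm (a (Suc j) - a j))\<^sup>2) \<le> ennreal C" by (simp only: C) (simp only: b_def)
    then have "4 ^ j * (norm (a (Suc j) - a j))\<^sup>2 \<le> C" by (subst (asm) ennreal_le_iff) (simp_all add: C_def)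
    then have "sqrt (4 ^ j * (norm (a (Suc j) - a j))\<^sup>2) \<le> sqrt C" by (rule real_sqrt_le_mono)
    moreover have "sqrt (4 ^ j) = (2::real) ^ j" by (simp add: real_sqrt_power)
    ultimately have "2 ^ j * norm (a (Suc j) - a j) \<le> sqrt C" by (simp add: real_sqrt_mult)
    then show ?thesis by (simp add: field_simps power_divide)
  qed
  have "summable (\<lambda>j. a (Suc j) - a j)"
    by (rule summable_comparison_test'[of "\<lambda>j. sqrt C * (1/2) ^ j" 0])
       (use bd in \<open>auto intro!: summable_mult summable_geometric\<close>)
  then have "convergent (\<lambda>n. \<Sum>j<n. a (Suc j) - a j)" by (simp only: summable_iff_convergent)
  then have "convergent (\<lambda>n. (\<Sum>j<n. a (Suc j) - a j) + a 0)" by (intro convergent_add convergent_const)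
  then show ?thesis by (simp add: sum_lessThan_telescope)
qed

text \<open>Along a fast subsequence the increments are geometrically small almost everywhere, which
  gives a pointwise limit; Fatou's lemma turns it into an \<open>L\<^sup>2\<close> limit.\<close>

lemma L2_complete:
  fixes f :: "nat \<Rightarrow> 'a \<Rightarrow> 'b::euclidean_space"
  assumes f: "\<And>n. sq_int M (f n)"
    and cauchy: "\<And>e. e > 0 \<Longrightarrow> \<exists>N. \<forall>m\<ge>N. \<forall>n\<ge>N. (LINT x|M. (norm (f m x - f n x))\<^sup>2) < e"
  obtains g where "sq_int M g" "(\<lambda>n. LINT x|M. (norm (f n x - g x))\<^sup>2) \<longlonglongrightarrow> 0"
proof -
  define d where "d m n = (LINT x|M. (norm (f m x - f n x))\<^sup>2)" for m n
  obtain k :: "nat \<Rightarrow> nat" where k: "strict_mono k" and kd: "\<And>j. d (k (Suc j)) (k j) \<le> (1/8) ^ j"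
    by (rule fast_Cauchy_subsequence[of d]) (use cauchy in \<open>auto simp: d_def\<close>)
  have [measurable]: "f n \<in> borel_measurable M" for n using f by (simp add: sq_int_def)
  have dn: "(\<integral>\<^sup>+x. ennreal ((norm (f m x - f n x))\<^sup>2) \<partial>M) = ennreal (d m n)" for m n
    unfolding d_def using sq_int_diff[OF f f, of m n] by (intro nn_integral_eq_integral) (auto simp: sq_int_def)
  define D where "D j x = f (k (Suc j)) x - f (k j) x" for j x
  have [measurable]: "D j \<in> borel_measurable M" for j unfolding D_def by measurable
  have "(\<integral>\<^sup>+x. (\<Sum>j. ennreal (4 ^ j * (norm (D j x))\<^sup>2)) \<partial>M) = (\<Sum>j. \<integral>\<^sup>+x. ennreal (4 ^ j * (norm (D j x))\<^sup>2) \<partial>M)"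
    by (rule nn_integral_suminf) measurable
  also have "\<dots> \<le> (\<Sum>j. ennreal ((1/2) ^ j))"
  proof (rule suminf_le)
    fix j
    have "(\<integral>\<^sup>+x. ennreal (4 ^ j * (norm (D j x))\<^sup>2) \<partial>M) = ennreal (4 ^ j) * ennreal (d (k (Suc j)) (k j))"
      unfolding dn[symmetric] D_def by (simp add: ennreal_mult nn_integral_cmult)
    also have "\<dots> \<le> ennreal (4 ^ j) * ennreal ((1/8) ^ j)"
      by (intro mult_left_mono ennreal_leI kd) simp
    also have "\<dots> = ennreal ((1/2) ^ j)"
      by (simp add: ennreal_mult[symmetric] power_mult_distrib[symmetric] del: ennreal_power ennreal_numeral power_one_over)
    finally show "(\<integral>\<^sup>+x. ennreal (4 ^ j * (norm (D j x))\<^sup>2) \<partial>M) \<le> ennreal ((1/2) ^ j)" .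
  qed auto
  also have "\<dots> < \<infinity>"
    by (subst suminf_ennreal2) (auto simp: summable_geometric)
  finally have "(\<integral>\<^sup>+x. (\<Sum>j. ennreal (4 ^ j * (norm (D j x))\<^sup>2)) \<partial>M) \<noteq> \<infinity>" by (rule less_imp_neq)
  then have "AE x in M. (\<Sum>j. ennreal (4 ^ j * (norm (D j x))\<^sup>2)) \<noteq> \<infinity>"
    by (rule nn_integral_PInf_AE[rotated]) measurable
  then have conv: "AE x in M. (\<lambda>j. f (k j) x) \<longlonglongrightarrow> lim (\<lambda>j. f (k j) x)"
    unfolding D_def by (rule AE_mp) (intro AE_I2 impI convergent_LIMSEQ_iff[THEN iffD1] convergent_fast)
  define g where "g x = lim (\<lambda>j. f (k j) x)" for x
  have [measurable]: "g \<in> borel_measurable M" unfolding g_def by measurable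
  have fatou: "(\<integral>\<^sup>+x. ennreal ((norm (f n x - g x))\<^sup>2) \<partial>M) \<le> ennreal e"
    if "e > 0" and N: "\<And>m n. m \<ge> N \<Longrightarrow> n \<ge> N \<Longrightarrow> d m n < e" and n: "n \<ge> N" for e N n
  proof -
    have "(\<integral>\<^sup>+x. ennreal ((norm (f n x - g x))\<^sup>2) \<partial>M) = (\<integral>\<^sup>+x. liminf (\<lambda>j. ennreal ((norm (f n x - f (k j) x))\<^sup>2)) \<partial>M)"
    proof (rule nn_integral_cong_AE, use conv in eventually_elim)
      case (elim x)
      then have "(\<lambda>j. ennreal ((norm (f n x - f (k j) x))\<^sup>2)) \<longlonglongrightarrow> ennreal ((norm (f n x - g x))\<^sup>2)"
        unfolding g_def[symmetric] by (intro tendsto_intros tendsto_ennrealI)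
      then show ?case by (rule lim_imp_Liminf[OF sequentially_bot, symmetric])
    qed
    also have "\<dots> \<le> liminf (\<lambda>j. \<integral>\<^sup>+x. ennreal ((norm (f n x - f (k j) x))\<^sup>2) \<partial>M)"
      by (rule nn_integral_liminf) measurable
    also have "\<dots> \<le> liminf (\<lambda>j. ennreal e)"
    proof (rule Liminf_mono)
      have "k j \<ge> N" if "j \<ge> N" for j using seq_suble[OF k, of j] that by simp
      then show "\<forall>\<^sub>F j in sequentially. (\<integral>\<^sup>+x. ennreal ((norm (f n x - f (k j) x))\<^sup>2) \<partial>M) \<le> ennreal e"
        unfolding dn eventually_sequentially using N[OF n] by (intro exI[of _ N]) (auto intro: ennreal_leI less_imp_le)
    qed
    finally show ?thesis by (simp add: Liminf_const)
  qed
  have intd: "sq_int M (\<lambda>x. f n x - g x) \<and> (LINT x|M. (norm (f n x - g x))\<^sup>2) \<le> e"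
    if "e > 0" and N: "\<And>m n. m \<ge> N \<Longrightarrow> n \<ge> N \<Longrightarrow> d m n < e" and n: "n \<ge> N" for e N n
  proof -
    note le = fatou[OF that]
    have i: "integrable M (\<lambda>x. (norm (f n x - g x))\<^sup>2)"
      by (rule integrableI_bounded) (use le in \<open>auto intro: le_less_trans\<close>)
    moreover have "(LINT x|M. (norm (f n x - g x))\<^sup>2) \<le> e"
      using le nn_integral_eq_integral[OF i] \<open>e > 0\<close> by simp
    ultimately show ?thesis by (simp add: sq_int_def)
  qed
  have ex: "\<exists>N. \<forall>m\<ge>N. \<forall>n\<ge>N. d m n < e" if "e > 0" for e using cauchy[OF that] by (simp add: d_def)
  obtain N where N: "\<forall>m\<ge>N. \<forall>n\<ge>N. d m n < 1" using ex[of 1] by auto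
  \<comment> \<open>\<open>g\<close> is recovered as \<open>f N\<close> minus this difference, which
    makes it square integrable.\<close>
  have "sq_int M (\<lambda>x. f N x - g x)" using intd[of 1 N N] N by auto
  from sq_int_diff[OF f[of N] this] have g: "sq_int M g" by simp
  have "(\<lambda>n. LINT x|M. (norm (f n x - g x))\<^sup>2) \<longlonglongrightarrow> 0"
  proof (rule LIMSEQ_I)
    fix r :: real assume "r > 0"
    then obtain N where N: "\<forall>m\<ge>N. \<forall>n\<ge>N. d m n < r / 2" using ex[of "r/2"] by auto
    have "norm ((LINT x|M. (norm (f n x - g x))\<^sup>2) - 0) < r" if "n \<ge> N" for n
      using intd[of "r/2" N n] N that \<open>r > 0\<close> by auto
    then show "\<exists>no. \<forall>n\<ge>no. norm ((LINT x|M. (norm (f n x - g x))\<^sup>2) - 0) < r" by blast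
  qed
  with g show ?thesis by (rule that)
qed

section \<open>The variational characterization of torsional rigidity\<close>

text \<open>Its supremum over the test functions is the torsional rigidity (Dirichlet's principle);
  with the factor 2 the maximal value is exactly the integral of the torsion function.\<close>

definition torsion_energy :: "(plane \<Rightarrow> real) \<Rightarrow> real" where
  "torsion_energy \<phi> = 2 * (LINT x|lborel. \<phi> x) - (LINT x|lborel. (norm (grad \<phi> x))\<^sup>2)"

lemma sq_int_test: "\<phi> \<in> test_functions \<Omega> \<Longrightarrow> sq_int lborel \<phi>"
  using integrable_test_sq[of \<phi> \<Omega>] test_functions_continuous[of \<phi> \<Omega>]
  by (auto simp: sq_int_def borel_measurable_continuous_onI)

lemma sq_int_grad: "\<phi> \<in> test_functions \<Omega> \<Longrightarrow> sq_int lborel (grad \<phi>)"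
  using integrable_grad_sq[of \<phi> \<Omega>] test_functions_continuous_grad[of \<phi> \<Omega>]
  by (auto simp: sq_int_def borel_measurable_continuous_onI)

lemma sq_int_indicator:
  assumes "\<Omega> \<in> sets M" "emeasure M \<Omega> < \<infinity>" shows "sq_int M (indicator \<Omega> :: _ \<Rightarrow> real)"
proof -
  have "(\<lambda>x. (norm (indicator \<Omega> x :: real))\<^sup>2) = indicator \<Omega>" by (auto simp: indicator_def)
  then show ?thesis using assms by (auto simp: sq_int_def)
qed

lemma sq_int_restrict:
  assumes "sq_int M f" "\<Omega> \<in> sets M" shows "sq_int M (\<lambda>x. indicator \<Omega> x *\<^sub>R f x)"
  unfolding sq_int_def
proof
  show m: "(\<lambda>x. indicat_real \<Omega> x *\<^sub>R f x) \<in> borel_measurable M" using assms by (auto simp: sq_int_def)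
  show "integrable M (\<lambda>x. (norm (indicat_real \<Omega> x *\<^sub>R f x))\<^sup>2)"
  proof (rule Bochner_Integration.integrable_bound)
    show "integrable M (\<lambda>x. (norm (f x))\<^sup>2)" using assms by (simp add: sq_int_def)
    show "(\<lambda>x. (norm (indicat_real \<Omega> x *\<^sub>R f x))\<^sup>2) \<in> borel_measurable M" using m by measurable
    show "AE x in M. norm ((norm (indicat_real \<Omega> x *\<^sub>R f x))\<^sup>2) \<le> norm ((norm (f x))\<^sup>2)"
      by (auto simp: indicator_def)
  qed
qed

lemma L2_iff_sq_int:
  assumes "\<Omega> \<in> sets borel"
  shows "L2 \<Omega> f \<longleftrightarrow> sq_int lborel (\<lambda>x. indicator \<Omega> x *\<^sub>R f x)"
proof -
  have "(\<lambda>x. (norm (indicat_real \<Omega> x *\<^sub>R f x))\<^sup>2) = (\<lambda>x. indicat_real \<Omega> x *\<^sub>R (norm (f x))\<^sup>2)"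
    by (auto simp: indicator_def)
  then show ?thesis
    unfolding L2_def sq_int_def set_borel_measurable_def set_integrable_def by simp
qed

lemma bounded_finite_emeasure:
  "bounded \<Omega> \<Longrightarrow> emeasure lborel \<Omega> < \<infinity>" for \<Omega> :: "plane set"
  by (rule emeasure_bounded_finite)

text \<open>Testing the weak equation with the approximating sequence gives T = \<integral>|g|^2.
  Completing the square then shows that the energy of \<open>\<phi>\<close> is T minus the squared
  L^2 distance between \<open>g\<close> and the gradient of \<open>\<phi>\<close>, so T is an upper
  bound that the approximating sequence approaches.\<close>

lemma torsion_function_energy:
  fixes \<Omega> :: "plane set"
  assumes "open \<Omega>" "bounded \<Omega>" and u: "is_torsion_function \<Omega> u"
  defines "T \<equiv> LINT x:\<Omega>|lborel. u x"
  shows "\<phi> \<in> test_functions \<Omega> \<Longrightarrow> torsion_energy \<phi> \<le> T"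
    and "e > 0 \<Longrightarrow> \<exists>\<phi>\<in>test_functions \<Omega>. torsion_energy \<phi> > T - e"
proof -
  have \<Omega>: "\<Omega> \<in> sets borel" using assms(1) by simp
  obtain g \<psi> where L: "L2 \<Omega> u" "L2 \<Omega> g" and \<psi>: "\<And>n. \<psi> n \<in> test_functions \<Omega>"
    and lim: "(\<lambda>n. (LINT x:\<Omega>|lborel. (\<psi> n x - u x)\<^sup>2)
           + (LINT x:\<Omega>|lborel. (norm (grad (\<psi> n) x - g x))\<^sup>2)) \<longlonglongrightarrow> 0"
    and weak: "\<And>\<phi>. \<phi> \<in> test_functions \<Omega> \<Longrightarrow> (LINT x:\<Omega>|lborel. g x \<bullet> grad \<phi> x) = (LINT x:\<Omega>|lborel. \<phi> x)"
    using u unfolding is_torsion_function_def H10_def H1_def by blast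
  define v where "v x = indicator \<Omega> x *\<^sub>R u x" for x
  define h where "h x = indicator \<Omega> x *\<^sub>R g x" for x
  have sv: "sq_int lborel v" and sh: "sq_int lborel h"
    using L unfolding L2_iff_sq_int[OF \<Omega>] v_def h_def by auto
  have e1: "(LINT x:\<Omega>|lborel. (\<phi> x - u x)\<^sup>2) = (LINT x|lborel. (norm (\<phi> x - v x))\<^sup>2)"
    and e2: "(LINT x:\<Omega>|lborel. (norm (grad \<phi> x - g x))\<^sup>2) = (LINT x|lborel. (norm (grad \<phi> x - h x))\<^sup>2)"
    and e3: "(LINT x:\<Omega>|lborel. g x \<bullet> grad \<phi> x) = (LINT x|lborel. h x \<bullet> grad \<phi> x)"
    and e4: "(LINT x:\<Omega>|lborel. \<phi> x) = (LINT x|lborel. \<phi> x)"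
    and e5: "(LINT x|lborel. \<phi> x) = (LINT x|lborel. \<phi> x \<bullet> indicator \<Omega> x)"
    if "\<phi> \<in> test_functions \<Omega>" for \<phi>
    unfolding set_lebesgue_integral_def v_def h_def
    using test_function_zero_outside[OF that] test_function_grad_zero_outside[OF that]
    by (auto intro!: Bochner_Integration.integral_cong simp: indicator_def)
  have T: "T = (LINT x|lborel. v x \<bullet> indicator \<Omega> x)"
    unfolding T_def set_lebesgue_integral_def v_def
    by (auto intro!: Bochner_Integration.integral_cong simp: indicator_def)
  have lim': "(\<lambda>n. (LINT x|lborel. (norm (\<psi> n x - v x))\<^sup>2)
           + (LINT x|lborel. (norm (grad (\<psi> n) x - h x))\<^sup>2)) \<longlonglongrightarrow> 0"
    using lim by (simp add: e1[OF \<psi>] e2[OF \<psi>])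
  have l1: "(\<lambda>n. LINT x|lborel. (norm (\<psi> n x - v x))\<^sup>2) \<longlonglongrightarrow> 0"
    by (rule tendsto_sandwich[OF _ _ tendsto_const lim']) (auto intro!: always_eventually)
  have l2: "(\<lambda>n. LINT x|lborel. (norm (grad (\<psi> n) x - h x))\<^sup>2) \<longlonglongrightarrow> 0"
    by (rule tendsto_sandwich[OF _ _ tendsto_const lim']) (auto intro!: always_eventually)
  have ind: "sq_int lborel (indicator \<Omega> :: plane \<Rightarrow> real)"
    using \<Omega> bounded_finite_emeasure[OF assms(2)] by (intro sq_int_indicator) auto
  have w: "(LINT x|lborel. h x \<bullet> grad \<phi> x) = (LINT x|lborel. \<phi> x)" if "\<phi> \<in> test_functions \<Omega>" for \<phi>
    using weak[OF that] e3[OF that] e4[OF that] by simp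
  have c1: "(\<lambda>n. LINT x|lborel. \<psi> n x) \<longlonglongrightarrow> T"
    unfolding e5[OF \<psi>] T by (rule L2_tendsto_inner[OF sq_int_test[OF \<psi>] sv ind l1])
  have c2: "(\<lambda>n. LINT x|lborel. (norm (grad (\<psi> n) x))\<^sup>2) \<longlonglongrightarrow> (LINT x|lborel. (norm (h x))\<^sup>2)"
    by (rule L2_tendsto_norm[OF sq_int_grad[OF \<psi>] sh l2])
  have "(\<lambda>n. LINT x|lborel. grad (\<psi> n) x \<bullet> h x) \<longlonglongrightarrow> (LINT x|lborel. h x \<bullet> h x)"
    by (rule L2_tendsto_inner[OF sq_int_grad[OF \<psi>] sh sh l2])
  then have "(\<lambda>n. LINT x|lborel. \<psi> n x) \<longlonglongrightarrow> (LINT x|lborel. (norm (h x))\<^sup>2)"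
    using w[OF \<psi>] by (simp add: inner_commute power2_norm_eq_inner)
  with c1 have Th: "T = (LINT x|lborel. (norm (h x))\<^sup>2)" by (rule LIMSEQ_unique)
  show "torsion_energy \<phi> \<le> T" if \<phi>: "\<phi> \<in> test_functions \<Omega>"
  proof -
    have "0 \<le> (LINT x|lborel. (norm (h x + (-1) *\<^sub>R grad \<phi> x))\<^sup>2)" by simp
    also have "\<dots> = (LINT x|lborel. (norm (h x))\<^sup>2) + 2 * (-1) * (LINT x|lborel. h x \<bullet> grad \<phi> x)
         + (-1)\<^sup>2 * (LINT x|lborel. (norm (grad \<phi> x))\<^sup>2)"
      by (rule integral_norm_add_sq[OF sh sq_int_grad[OF \<phi>]])
    finally show ?thesis by (simp add: torsion_energy_def Th w[OF \<phi>])
  qed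
  show "\<exists>\<phi>\<in>test_functions \<Omega>. torsion_energy \<phi> > T - e" if "e > 0"
  proof -
    have "(\<lambda>n. torsion_energy (\<psi> n)) \<longlonglongrightarrow> 2 * T - T"
      unfolding torsion_energy_def using c1 c2 Th by (intro tendsto_intros) auto
    then have "\<forall>\<^sub>F n in sequentially. torsion_energy (\<psi> n) > T - e"
      using that by (intro order_tendstoD) auto
    then show ?thesis using \<psi> by (auto simp: eventually_sequentially)
  qed
qed

text \<open>Young's inequality with weight 4 R^2 produces exactly the multiple of
  \<integral>\<phi>^2 that the Poincare inequality trades for the gradient term, which then
  cancels.\<close>

lemma torsion_energy_bounded:
  assumes \<Omega>: "open \<Omega>" and R: "R > 0" "\<And>x. x \<in> \<Omega> \<Longrightarrow> norm x \<le> R" and \<phi>: "\<phi> \<in> test_functions \<Omega>"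
  shows "torsion_energy \<phi> \<le> 4 * R\<^sup>2 * measure lborel \<Omega>"
proof -
  have "bounded \<Omega>" using R(2) by (auto simp: bounded_iff)
  then have fin: "emeasure lborel \<Omega> < \<infinity>" by (rule bounded_finite_emeasure)
  have "2 * (LINT x|lborel. \<phi> x) = (LINT x|lborel. 2 * \<phi> x)" by simp
  also have "\<dots> \<le> (LINT x|lborel. 4 * R\<^sup>2 * indicator \<Omega> x + (\<phi> x)\<^sup>2 / (4 * R\<^sup>2))"
  proof (rule integral_mono)
    show "integrable lborel (\<lambda>x. 4 * R\<^sup>2 * indicator \<Omega> x + (\<phi> x)\<^sup>2 / (4 * R\<^sup>2))"
      using integrable_test_sq[OF \<phi>] fin \<Omega>
      by (intro Bochner_Integration.integrable_add integrable_mult_right integrable_divide) auto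
    fix x
    have "2 * y \<le> a + y\<^sup>2 / a" if "a > 0" for a y :: real
    proof -
      have "0 \<le> (a - y)\<^sup>2 / a" using that by simp
      also have "(a - y)\<^sup>2 / a = a + y\<^sup>2 / a - 2 * y"
        using that by (simp add: power2_eq_square field_simps)
      finally show ?thesis by simp
    qed
    from this[of "4 * R\<^sup>2" "\<phi> x"] R(1) show "2 * \<phi> x \<le> 4 * R\<^sup>2 * indicator \<Omega> x + (\<phi> x)\<^sup>2 / (4 * R\<^sup>2)"
      using test_function_zero_outside[OF \<phi>, of x] by (cases "x \<in> \<Omega>") auto
  qed (use integrable_test_function[OF \<phi>] in auto)
  also have "\<dots> = 4 * R\<^sup>2 * measure lborel \<Omega> + (LINT x|lborel. (\<phi> x)\<^sup>2) / (4 * R\<^sup>2)"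
    using integrable_test_sq[OF \<phi>] fin \<Omega> by (subst Bochner_Integration.integral_add) auto
  also have "(LINT x|lborel. (\<phi> x)\<^sup>2) / (4 * R\<^sup>2) \<le> (LINT x|lborel. (norm (grad \<phi> x))\<^sup>2)"
    using poincare_inequality[OF \<phi> R(2)] R(1) by (simp add: divide_le_eq mult.commute)
  finally show ?thesis by (simp add: torsion_energy_def)
qed

text \<open>The coefficient of 2t is the defect of \<open>\<phi>\<close> in the weak equation tested
  with \<open>\<psi>\<close>. The expansion is used at t = 1 and t = 1/2 to compare two gradients,
  and for all t to derive the weak equation in the limit.\<close>

lemma torsion_energy_perturb:
  assumes "\<phi> \<in> test_functions \<Omega>" "\<psi> \<in> test_functions \<Omega>"
  shows "torsion_energy (\<lambda>x. \<phi> x + t * \<psi> x) = torsion_energy \<phi>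
     + 2 * t * ((LINT x|lborel. \<psi> x) - (LINT x|lborel. grad \<phi> x \<bullet> grad \<psi> x))
     - t\<^sup>2 * (LINT x|lborel. (norm (grad \<psi> x))\<^sup>2)"
proof -
  have g: "grad (\<lambda>x. \<phi> x + t * \<psi> x) x = grad \<phi> x + t *\<^sub>R grad \<psi> x" for x
    using assms by (simp add: grad_add grad_cmult test_functions_differentiable test_functions_cmult
        test_functions_differentiable[OF test_functions_cmult])
  show ?thesis unfolding torsion_energy_def g
    using integral_norm_add_sq[OF sq_int_grad[OF assms(1)] sq_int_grad[OF assms(2)], of t]
      integrable_test_function[OF assms(1)] integrable_test_function[OF assms(2)]
    by (simp add: algebra_simps)
qed

text \<open>The direct method: the parallelogram identity makes a maximising sequence Cauchy.\<close>

lemma torsion_function_exists: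
  fixes \<Omega> :: "plane set"
  assumes "open \<Omega>" "bounded \<Omega>"
  shows "\<exists>u. is_torsion_function \<Omega> u"
proof -
  have \<Omega>: "\<Omega> \<in> sets borel" using assms(1) by simp
  obtain R where R: "R > 0" "\<And>x. x \<in> \<Omega> \<Longrightarrow> norm x \<le> R" using assms(2) by (auto simp: bounded_pos)
  define J where "J = torsion_energy ` test_functions \<Omega>"
  define S where "S = Sup J"
  have bdd: "bdd_above J"
    unfolding J_def using torsion_energy_bounded[OF assms(1) R] by (rule bdd_aboveI2)
  have J: "torsion_energy \<phi> \<le> S" if "\<phi> \<in> test_functions \<Omega>" for \<phi>
    unfolding S_def using that bdd by (intro cSup_upper) (auto simp: J_def)
  have "\<exists>\<phi>\<in>test_functions \<Omega>. torsion_energy \<phi> > S - 1 / real (Suc n)" for n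
    using less_cSup_iff[of J "S - 1 / real (Suc n)"] bdd test_functions_zero[of \<Omega>]
    unfolding S_def[symmetric] by (auto simp: J_def)
  then obtain \<phi> where \<phi>: "\<And>n. \<phi> n \<in> test_functions \<Omega>"
    and J\<phi>: "\<And>n. torsion_energy (\<phi> n) > S - 1 / real (Suc n)" by metis
  have limJ: "(\<lambda>n. torsion_energy (\<phi> n)) \<longlonglongrightarrow> S"
  proof (rule tendsto_sandwich[of "\<lambda>n. S - 1 / real (Suc n)" _ _ "\<lambda>n. S"])
    show "(\<lambda>n. S - 1 / real (Suc n)) \<longlonglongrightarrow> S" by real_asymp
  qed (use J\<phi> J[OF \<phi>] in \<open>auto intro!: always_eventually less_imp_le\<close>)
  define D where "D m n = (LINT x|lborel. (norm (grad (\<phi> m) x - grad (\<phi> n) x))\<^sup>2)" for m n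
  have gd: "grad (\<lambda>x. \<phi> m x - \<phi> n x) x = grad (\<phi> m) x - grad (\<phi> n) x" for m n x
    using grad_add[OF test_functions_differentiable[OF \<phi>[of m]] test_functions_differentiable[OF test_functions_cmult[OF \<phi>[of n], of "-1"]]]
      grad_cmult[OF test_functions_differentiable[OF \<phi>[of n]], of "-1"] by simp
  have Dle: "D m n \<le> 2 / real (Suc m) + 2 / real (Suc n)" for m n
  proof -
    note d = test_functions_diff[OF \<phi>[of n] \<phi>[of m]]
    have gd': "(norm (grad (\<lambda>x. \<phi> n x - \<phi> m x) x))\<^sup>2 = (norm (grad (\<phi> m) x - grad (\<phi> n) x))\<^sup>2" for x
      unfolding gd by (simp add: norm_minus_commute)
    \<comment> \<open>Eliminating the linear term between t = 1 and t = 1/2 shows that the energy at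
      the midpoint exceeds the mean of the two energies by a quarter of \<open>D m n\<close>; being
      at most \<open>S\<close>, it forces \<open>D m n\<close> to be small.\<close>
    have 1: "torsion_energy (\<lambda>x. \<phi> m x + 1 * (\<phi> n x - \<phi> m x)) = torsion_energy (\<phi> m)
     + 2 * 1 * ((LINT x|lborel. \<phi> n x - \<phi> m x) - (LINT x|lborel. grad (\<phi> m) x \<bullet> grad (\<lambda>x. \<phi> n x - \<phi> m x) x)) - 1\<^sup>2 * D m n"
      using torsion_energy_perturb[OF \<phi>[of m] d, of 1] unfolding gd' D_def .
    have 2: "torsion_energy (\<lambda>x. \<phi> m x + (1/2) * (\<phi> n x - \<phi> m x)) = torsion_energy (\<phi> m)
     + 2 * (1/2) * ((LINT x|lborel. \<phi> n x - \<phi> m x) - (LINT x|lborel. grad (\<phi> m) x \<bullet> grad (\<lambda>x. \<phi> n x - \<phi> m x) x)) - (1/2)\<^sup>2 * D m n"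
      using torsion_energy_perturb[OF \<phi>[of m] d, of "1/2"] unfolding gd' D_def .
    have 3: "torsion_energy (\<lambda>x. \<phi> m x + (1/2) * (\<phi> n x - \<phi> m x)) \<le> S"
      by (intro J test_functions_add \<phi> test_functions_cmult d)
    show ?thesis using 1 2 3 J\<phi>[of m] J\<phi>[of n] by (simp add: power2_eq_square)
  qed
  have "\<exists>N. \<forall>m\<ge>N. \<forall>n\<ge>N. D m n < e" if "e > 0" for e
  proof -
    obtain N where "1 / real (Suc N) < e / 4" using nat_approx_posE[of "e / 4"] \<open>e > 0\<close> by auto
    then have N: "4 / real (Suc N) < e" by (simp add: field_simps)
    have "D m n < e" if "m \<ge> N" "n \<ge> N" for m n
    proof -
      have "2 / real (Suc m) \<le> 2 / real (Suc N)" "2 / real (Suc n) \<le> 2 / real (Suc N)"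
        using that by (auto intro!: divide_left_mono)
      then show ?thesis using Dle[of m n] N by simp
    qed
    then show ?thesis by blast
  qed
  note cauchyD = this
  obtain g0 where g0: "sq_int lborel g0" and lg0: "(\<lambda>n. LINT x|lborel. (norm (grad (\<phi> n) x - g0 x))\<^sup>2) \<longlonglongrightarrow> 0"
    using L2_complete[OF sq_int_grad[OF \<phi>] cauchyD[unfolded D_def]] by blast
  have "\<exists>N. \<forall>m\<ge>N. \<forall>n\<ge>N. (LINT x|lborel. (norm (\<phi> m x - \<phi> n x))\<^sup>2) < e" if "e > 0" for e
  proof -
    obtain N where N: "\<forall>m\<ge>N. \<forall>n\<ge>N. D m n < e / (4 * R\<^sup>2)"
      using cauchyD[of "e / (4 * R\<^sup>2)"] \<open>e > 0\<close> R(1) by auto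
    have "(LINT x|lborel. (norm (\<phi> m x - \<phi> n x))\<^sup>2) < e" if "m \<ge> N" "n \<ge> N" for m n
    proof -
      have "(LINT x|lborel. (\<phi> m x - \<phi> n x)\<^sup>2) \<le> 4 * R\<^sup>2 * D m n"
        using poincare_inequality[OF test_functions_diff[OF \<phi>[of m] \<phi>[of n]] R(2)] unfolding gd D_def .
      also have "\<dots> < 4 * R\<^sup>2 * (e / (4 * R\<^sup>2))"
        using N that R(1) by (intro mult_strict_left_mono) auto
      finally show ?thesis using R(1) by simp
    qed
    then show ?thesis by blast
  qed
  note cauchyP = this
  obtain u0 where u0: "sq_int lborel u0" and lu0: "(\<lambda>n. LINT x|lborel. (norm (\<phi> n x - u0 x))\<^sup>2) \<longlonglongrightarrow> 0"
    using L2_complete[OF sq_int_test[OF \<phi>] cauchyP] by blast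
  \<comment> \<open>Cutting off outside \<Omega> can only improve the approximation, since every
    \<open>\<phi> n\<close> and its gradient vanish there.\<close>
  define u where "u x = indicator \<Omega> x *\<^sub>R u0 x" for x
  define g where "g x = indicator \<Omega> x *\<^sub>R g0 x" for x
  have su: "sq_int lborel u" and sg: "sq_int lborel g"
    unfolding u_def g_def using \<Omega> sq_int_restrict[OF u0, of \<Omega>] sq_int_restrict[OF g0, of \<Omega>] by auto
  have lu: "(\<lambda>n. LINT x|lborel. (norm (\<phi> n x - u x))\<^sup>2) \<longlonglongrightarrow> 0"
  proof (rule tendsto_sandwich[OF _ _ tendsto_const lu0])
    show "\<forall>\<^sub>F n in sequentially. (LINT x|lborel. (norm (\<phi> n x - u x))\<^sup>2) \<le> (LINT x|lborel. (norm (\<phi> n x - u0 x))\<^sup>2)"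
      using test_function_zero_outside[OF \<phi>] sq_int_diff[OF sq_int_test[OF \<phi>] su] sq_int_diff[OF sq_int_test[OF \<phi>] u0]
      by (intro always_eventually allI integral_mono) (auto simp: u_def indicator_def sq_int_def)
  qed auto
  have lg: "(\<lambda>n. LINT x|lborel. (norm (grad (\<phi> n) x - g x))\<^sup>2) \<longlonglongrightarrow> 0"
  proof (rule tendsto_sandwich[OF _ _ tendsto_const lg0])
    show "\<forall>\<^sub>F n in sequentially. (LINT x|lborel. (norm (grad (\<phi> n) x - g x))\<^sup>2) \<le> (LINT x|lborel. (norm (grad (\<phi> n) x - g0 x))\<^sup>2)"
      using test_function_grad_zero_outside[OF \<phi>] sq_int_diff[OF sq_int_grad[OF \<phi>] sg] sq_int_diff[OF sq_int_grad[OF \<phi>] g0]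
      by (intro always_eventually allI integral_mono) (auto simp: g_def indicator_def sq_int_def)
  qed auto
  have [simp]: "indicat_real \<Omega> x * u x = u x" "indicat_real \<Omega> x *\<^sub>R g x = g x" for x
    by (auto simp: u_def g_def indicator_def)
  have "H10 \<Omega> u g"
    unfolding H10_def H1_def
  proof (intro conjI exI[of _ \<phi>] allI \<phi>)
    show "L2 \<Omega> u" "L2 \<Omega> g" using su sg by (simp_all add: L2_iff_sq_int[OF \<Omega>])
    have "(\<lambda>n. (LINT x:\<Omega>|lborel. (\<phi> n x - u x)\<^sup>2) + (LINT x:\<Omega>|lborel. (norm (grad (\<phi> n) x - g x))\<^sup>2)) =
        (\<lambda>n. (LINT x|lborel. (norm (\<phi> n x - u x))\<^sup>2) + (LINT x|lborel. (norm (grad (\<phi> n) x - g x))\<^sup>2))"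
      unfolding set_lebesgue_integral_def
      using test_function_zero_outside[OF \<phi>] test_function_grad_zero_outside[OF \<phi>]
      by (intro ext arg_cong2[where f="(+)"] Bochner_Integration.integral_cong) (auto simp: indicator_def u_def g_def)
    then show "(\<lambda>n. (LINT x:\<Omega>|lborel. (\<phi> n x - u x)\<^sup>2) + (LINT x:\<Omega>|lborel. (norm (grad (\<phi> n) x - g x))\<^sup>2)) \<longlonglongrightarrow> 0"
      using tendsto_add[OF lu lg] by simp
    show "weak_gradient \<Omega> u g"
      unfolding weak_gradient_def
    proof (intro ballI allI)
      fix \<psi> i assume \<psi>: "\<psi> \<in> test_functions \<Omega>"
      \<comment> \<open>Pairing vector fields with \<open>\<psi>\<close> times a unit vector
        extracts the i-th component from the L^2 convergence of the gradients.\<close>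
      have s\<psi>: "sq_int lborel (\<lambda>x. \<psi> x *\<^sub>R (axis i 1 :: plane))"
        using sq_int_test[OF \<psi>] by (auto simp: sq_int_def)
      have l: "(\<lambda>n. LINT x|lborel. \<phi> n x * grad \<psi> x $ i) \<longlonglongrightarrow> (LINT x|lborel. u x * grad \<psi> x $ i)"
        using L2_tendsto_inner[OF sq_int_test[OF \<phi>] su sq_int_test[OF test_functions_grad[OF \<psi>]] lu] by simp
      have r: "(\<lambda>n. LINT x|lborel. grad (\<phi> n) x $ i * \<psi> x) \<longlonglongrightarrow> (LINT x|lborel. g x $ i * \<psi> x)"
        using L2_tendsto_inner[OF sq_int_grad[OF \<phi>] sg s\<psi> lg] by (simp add: inner_axis mult.commute)
      have "(LINT x|lborel. \<phi> n x * grad \<psi> x $ i) = - (LINT x|lborel. grad (\<phi> n) x $ i * \<psi> x)" for n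
        using \<phi>[of n] by (intro integration_by_parts[OF \<psi>]) (simp add: test_functions_iff)
      then have "(\<lambda>n. LINT x|lborel. \<phi> n x * grad \<psi> x $ i) \<longlonglongrightarrow> - (LINT x|lborel. g x $ i * \<psi> x)"
        using tendsto_minus[OF r] by simp
      with l have "(LINT x|lborel. u x * grad \<psi> x $ i) = - (LINT x|lborel. g x $ i * \<psi> x)"
        by (rule LIMSEQ_unique)
      moreover have "(LINT x:\<Omega>|lborel. u x * grad \<psi> x $ i) = (LINT x|lborel. u x * grad \<psi> x $ i)"
        "(LINT x:\<Omega>|lborel. g x $ i * \<psi> x) = (LINT x|lborel. g x $ i * \<psi> x)"
        unfolding set_lebesgue_integral_def
        by (auto intro!: Bochner_Integration.integral_cong simp: indicator_def u_def g_def)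
      ultimately show "(LINT x:\<Omega>|lborel. u x * grad \<psi> x $ i) = - (LINT x:\<Omega>|lborel. g x $ i * \<psi> x)" by simp
    qed
  qed
  moreover have "(LINT x:\<Omega>|lborel. g x \<bullet> grad \<psi> x) = (LINT x:\<Omega>|lborel. \<psi> x)" if \<psi>: "\<psi> \<in> test_functions \<Omega>" for \<psi>
  proof -
    define \<alpha> where "\<alpha> = (LINT x|lborel. \<psi> x) - (LINT x|lborel. g x \<bullet> grad \<psi> x)"
    define D where "D = (LINT x|lborel. (norm (grad \<psi> x))\<^sup>2)"
    have "2 * t * \<alpha> \<le> t\<^sup>2 * D" for t
    proof -
      have "(\<lambda>n. torsion_energy (\<phi> n) + 2 * t * ((LINT x|lborel. \<psi> x) - (LINT x|lborel. grad (\<phi> n) x \<bullet> grad \<psi> x)) - t\<^sup>2 * D)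
        \<longlonglongrightarrow> S + 2 * t * \<alpha> - t\<^sup>2 * D"
        unfolding \<alpha>_def
        by (intro tendsto_intros limJ L2_tendsto_inner[OF sq_int_grad[OF \<phi>] sg sq_int_grad[OF \<psi>] lg])
      moreover have "torsion_energy (\<phi> n) + 2 * t * ((LINT x|lborel. \<psi> x) - (LINT x|lborel. grad (\<phi> n) x \<bullet> grad \<psi> x)) - t\<^sup>2 * D \<le> S" for n
        unfolding D_def torsion_energy_perturb[OF \<phi>[of n] \<psi>, symmetric]
        by (intro J test_functions_add \<phi> test_functions_cmult \<psi>)
      ultimately have "S + 2 * t * \<alpha> - t\<^sup>2 * D \<le> S" by (intro LIMSEQ_le_const2) auto
      then show ?thesis by simp
    qed
    note le = this
    have D: "D \<ge> 0" by (simp add: D_def)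
    \<comment> \<open>Dividing by \<open>D + 1\<close> stays meaningful when D = 0, and the
      inequality at t = \<beta> reduces to \<beta>^2 (D + 2) \<le> 0.\<close>
    define \<beta> where "\<beta> = \<alpha> / (D + 1)"
    have \<alpha>: "\<alpha> = \<beta> * (D + 1)" using D by (simp add: \<beta>_def)
    have "\<beta>\<^sup>2 * (D + 2) \<le> 0" using le[of \<beta>] unfolding \<alpha> by (simp add: power2_eq_square algebra_simps)
    then have "\<alpha> = 0" using D by (simp add: mult_le_0_iff \<alpha>)
    moreover have "(LINT x:\<Omega>|lborel. g x \<bullet> grad \<psi> x) = (LINT x|lborel. g x \<bullet> grad \<psi> x)"
      "(LINT x:\<Omega>|lborel. \<psi> x) = (LINT x|lborel. \<psi> x)"
      unfolding set_lebesgue_integral_def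
      using test_function_zero_outside[OF \<psi>] test_function_grad_zero_outside[OF \<psi>]
      by (auto intro!: Bochner_Integration.integral_cong simp: indicator_def)
    ultimately show ?thesis by (simp add: \<alpha>_def)
  qed
  ultimately show ?thesis unfolding is_torsion_function_def by blast
qed

text \<open>Existence makes the \<open>SOME\<close> in \<open>torsion_function\<close> meaningful.
  The two bounds hold for any torsion function, and every later fact about
  \<open>torsional_rigidity\<close> is derived from them.\<close>

lemma torsional_rigidity_energy:
  fixes \<Omega> :: "plane set"
  assumes "open \<Omega>" "bounded \<Omega>"
  shows torsion_energy_le_rigidity: "\<phi> \<in> test_functions \<Omega> \<Longrightarrow> torsion_energy \<phi> \<le> torsional_rigidity \<Omega>"
    and torsional_rigidity_approx: "e > 0 \<Longrightarrow> \<exists>\<phi>\<in>test_functions \<Omega>. torsion_energy \<phi> > torsional_rigidity \<Omega> - e"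
proof -
  have "is_torsion_function \<Omega> (torsion_function \<Omega>)"
    unfolding torsion_function_def using torsion_function_exists[OF assms] by (rule someI_ex)
  note * = torsion_function_energy[OF assms this, folded torsional_rigidity_def]
  show "\<phi> \<in> test_functions \<Omega> \<Longrightarrow> torsion_energy \<phi> \<le> torsional_rigidity \<Omega>"
    "e > 0 \<Longrightarrow> \<exists>\<phi>\<in>test_functions \<Omega>. torsion_energy \<phi> > torsional_rigidity \<Omega> - e"
    using * by blast+
qed

lemma torsional_rigidity_leI:
  fixes \<Omega> :: "plane set"
  assumes "open \<Omega>" "bounded \<Omega>" "\<And>\<phi>. \<phi> \<in> test_functions \<Omega> \<Longrightarrow> torsion_energy \<phi> \<le> C"
  shows "torsional_rigidity \<Omega> \<le> C"
proof (rule field_le_epsilon)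
  fix e :: real assume "e > 0"
  then obtain \<phi> where "\<phi> \<in> test_functions \<Omega>" "torsion_energy \<phi> > torsional_rigidity \<Omega> - e"
    using torsional_rigidity_approx[OF assms(1,2)] by blast
  then show "torsional_rigidity \<Omega> \<le> C + e" using assms(3) by fastforce
qed

text \<open>A test function on the smaller set is one on the larger set, with the same
  energy.\<close>

lemma torsional_rigidity_mono:
  fixes \<Omega> \<Omega>' :: "plane set"
  assumes "open \<Omega>" "open \<Omega>'" "bounded \<Omega>'" "\<Omega> \<subseteq> \<Omega>'"
  shows "torsional_rigidity \<Omega> \<le> torsional_rigidity \<Omega>'"
proof (rule torsional_rigidity_leI)
  show "torsion_energy \<phi> \<le> torsional_rigidity \<Omega>'" if "\<phi> \<in> test_functions \<Omega>" for \<phi>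
    using that test_functions_mono[OF assms(4)] by (intro torsion_energy_le_rigidity assms) auto
qed (use assms bounded_subset in auto)

lemma torsional_rigidity_nonneg:
  fixes \<Omega> :: "plane set"
  assumes "open \<Omega>" "bounded \<Omega>" shows "torsional_rigidity \<Omega> \<ge> 0"
proof -
  have "torsion_energy (\<lambda>x. 0) = 0"
    using grad_eqI[of "\<lambda>x. 0" 0] by (simp add: torsion_energy_def)
  then show ?thesis using torsion_energy_le_rigidity[OF assms test_functions_zero] by simp
qed

section \<open>Similarities\<close>

text \<open>Rotations will turn a diameter to the horizontal axis. \<open>lborel\<close> is
  determined by its values on boxes, and the preimage of a box is its image under the inverse
  orthogonal map, which keeps Lebesgue measure.\<close>

lemma distr_lborel_orthogonal:
  fixes f :: "plane \<Rightarrow> plane"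
  assumes f: "orthogonal_transformation f"
  shows "distr lborel borel f = lborel"
proof (rule lborel_eqI[symmetric])
  have lin: "linear f" using f by (rule orthogonal_transformation_linear)
  have m: "f \<in> borel_measurable borel"
    by (intro borel_measurable_continuous_onI linear_continuous_on lin[unfolded linear_conv_bounded_linear])
  fix l u :: plane assume lu: "\<And>b. b \<in> Basis \<Longrightarrow> l \<bullet> b \<le> u \<bullet> b"
  have "emeasure (distr lborel borel f) (box l u) = emeasure lborel (f -` box l u)"
    using m by (simp add: emeasure_distr)
  also have "f -` box l u = inv f ` box l u"
    using orthogonal_transformation_bij[OF f] by (simp add: bij_vimage_eq_inv_image)
  also have "emeasure lborel (inv f ` box l u) = emeasure lebesgue (inv f ` box l u)"
    using bij_vimage_eq_inv_image[OF orthogonal_transformation_bij[OF f], of "box l u"] measurable_sets[OF m, of "box l u"]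
    by (simp add: emeasure_completion)
  also have "\<dots> = ennreal (measure lebesgue (inv f ` box l u))"
    by (rule emeasure_eq_measure2) (rule measurable_orthogonal_image[OF orthogonal_transformation_inv[OF f]], simp)
  also have "\<dots> = ennreal (measure lebesgue (box l u))"
    using measure_orthogonal_image[OF orthogonal_transformation_inv[OF f], of "box l u"] by simp
  also have "\<dots> = emeasure lborel (box l u)"
    by (simp add: emeasure_eq_measure2 flip: emeasure_completion) 
  also have "\<dots> = (\<Prod>b\<in>Basis. (u - l) \<bullet> b)"
    using lu by (rule emeasure_lborel_box)
  finally show "emeasure (distr lborel borel f) (box l u) = (\<Prod>b\<in>Basis. (u - l) \<bullet> b)" .
qed simp

definition similarity :: "real \<Rightarrow> (plane \<Rightarrow> plane) \<Rightarrow> bool" where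
  "similarity c S \<longleftrightarrow> c > 0 \<and> (\<exists>a f. orthogonal_transformation f \<and> S = (\<lambda>x. a + c *\<^sub>R f x))"

lemma similarityI: "c > 0 \<Longrightarrow> orthogonal_transformation f \<Longrightarrow> similarity c (\<lambda>x. a + c *\<^sub>R f x)"
  unfolding similarity_def by blast

lemma similarity_scale: "c > 0 \<Longrightarrow> similarity c ((*\<^sub>R) c)"
  using similarityI[OF _ orthogonal_transformation_id, of c 0] by simp

lemma similarity_translate: "similarity 1 ((+) a)"
  using similarityI[OF _ orthogonal_transformation_id, of 1 a] by simp

lemma similarity_dist:
  assumes "similarity c S" shows "norm (S x - S y) = c * norm (x - y)"
proof -
  obtain a f where f: "orthogonal_transformation f" "c > 0" and S: "S = (\<lambda>x. a + c *\<^sub>R f x)"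
    using assms by (auto simp: similarity_def)
  have "S x - S y = c *\<^sub>R f (x - y)"
    by (simp add: S linear_diff[OF orthogonal_transformation_linear[OF f(1)]] algebra_simps)
  then show ?thesis using f by (simp add: orthogonal_transformation_norm)
qed

lemma similarity_inverse:
  assumes "similarity c S"
  obtains S' where "similarity (1/c) S'" "\<And>x. S' (S x) = x" "\<And>x. S (S' x) = x"
proof -
  obtain a f where f: "orthogonal_transformation f" "c > 0" and S: "S = (\<lambda>x. a + c *\<^sub>R f x)"
    using assms by (auto simp: similarity_def)
  have g: "orthogonal_transformation (inv f)" by (rule orthogonal_transformation_inv[OF f(1)])
  have gf: "inv f (f x) = x" "f (inv f x) = x" for x
    using orthogonal_transformation_bij[OF f(1)] by (auto simp: bij_is_inj bij_is_surj surj_f_inv_f)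
  define S' where "S' x = - (1/c) *\<^sub>R inv f a + (1/c) *\<^sub>R inv f x" for x
  have lf: "linear f" "linear (inv f)" using f(1) g by (auto intro: orthogonal_transformation_linear)
  have "similarity (1/c) S'" unfolding S'_def using f(2) g by (intro similarityI) auto
  moreover have "S' (S x) = x" for x
    using f(2) by (simp add: S S'_def linear_add[OF lf(2)] linear_cmul[OF lf(2)] gf algebra_simps)
  moreover have "S (S' x) = x" for x
  proof -
    have "f (S' x) = - (1/c) *\<^sub>R a + (1/c) *\<^sub>R x"
      unfolding S'_def by (simp only: linear_add[OF lf(1)] linear_cmul[OF lf(1)] gf)
    then have "S (S' x) = a + c *\<^sub>R (- (1/c) *\<^sub>R a + (1/c) *\<^sub>R x)" by (simp only: S)
    then show ?thesis using f(2) by (simp add: scaleR_diff_right)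
  qed
  ultimately show ?thesis by (rule that)
qed

lemma similarity_continuous:
  assumes "similarity c S" shows "continuous_on UNIV S"
proof -
  obtain a f where f: "orthogonal_transformation f" and S: "S = (\<lambda>x. a + c *\<^sub>R f x)"
    using assms by (auto simp: similarity_def)
  have "continuous_on UNIV f"
    using orthogonal_transformation_linear[OF f] by (intro linear_continuous_on) (simp add: linear_conv_bounded_linear)
  then show ?thesis unfolding S by (intro continuous_intros)
qed

lemma similarity_vimage:
  assumes "similarity c S" "\<And>x. S' (S x) = x" "\<And>x. S (S' x) = x"
  shows "S ` A = S' -` A"
  using assms(2,3) by (auto simp: image_iff) metis

lemma similarity_open:
  assumes "similarity c S" "open A" shows "open (S ` A)"
proof -
  obtain S' where S': "similarity (1/c) S'" "\<And>x. S' (S x) = x" "\<And>x. S (S' x) = x"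
    using similarity_inverse[OF assms(1)] by blast
  show ?thesis
    unfolding similarity_vimage[OF assms(1) S'(2,3)] using similarity_continuous[OF S'(1)] assms(2)
    by (simp add: open_vimage)
qed

lemma similarity_convex:
  assumes "similarity c S" "convex A" shows "convex (S ` A)"
proof -
  obtain a f where f: "orthogonal_transformation f" and S: "S = (\<lambda>x. a + c *\<^sub>R f x)"
    using assms by (auto simp: similarity_def)
  have "linear (\<lambda>x. c *\<^sub>R f x)"
    using orthogonal_transformation_linear[OF f] by (rule linear_compose_scale_right)
  then have "convex ((\<lambda>x. c *\<^sub>R f x) ` A)" using assms(2) by (rule convex_linear_image)
  then have "convex ((+) a ` (\<lambda>x. c *\<^sub>R f x) ` A)" by (rule convex_translation)
  then show ?thesis by (simp add: S image_image)
qed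

lemma similarity_bounded:
  assumes "similarity c S" "bounded A" shows "bounded (S ` A)"
proof -
  have "compact (S ` closure A)"
    using assms similarity_continuous[OF assms(1)]
    by (intro compact_continuous_image) (auto intro: continuous_on_subset simp: compact_closure)
  then show ?thesis
    by (rule bounded_subset[OF compact_imp_bounded]) (use closure_subset in auto)
qed

lemma similarity_closure:
  assumes "similarity c S" shows "closure (S ` A) = S ` closure A"
proof
  obtain S' where S': "similarity (1/c) S'" "\<And>x. S' (S x) = x" "\<And>x. S (S' x) = x"
    using similarity_inverse[OF assms(1)] by blast
  have "closed (S ` closure A)"
    unfolding similarity_vimage[OF assms(1) S'(2,3)] using similarity_continuous[OF S'(1)]
    by (simp add: closed_vimage)
  then show "closure (S ` A) \<subseteq> S ` closure A"
    by (rule closure_minimal[rotated]) (use closure_subset in auto)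
  show "S ` closure A \<subseteq> closure (S ` A)"
    using similarity_continuous[OF assms] closure_subset[of "S ` A"]
    by (intro image_closure_subset) (auto intro: continuous_on_subset)
qed

lemma similarity_admissible:
  assumes "similarity c S" "admissible A" shows "admissible (S ` A)"
  using assms by (auto simp: admissible_def intro: similarity_open similarity_convex similarity_bounded)

section \<open>Integrals, area and torsional rigidity under similarities\<close>

lemma similarity_distr:
  assumes "similarity c S"
  shows "lborel = density (distr lborel borel S) (\<lambda>_. ennreal (c\<^sup>2))"
proof -
  obtain a f where f: "orthogonal_transformation f" "c > 0" and S: "S = (\<lambda>x. a + c *\<^sub>R f x)"
    using assms by (auto simp: similarity_def)
  have m: "f \<in> borel_measurable borel"
    using orthogonal_transformation_linear[OF f(1)]
    by (intro borel_measurable_continuous_onI linear_continuous_on) (simp add: linear_conv_bounded_linear)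
  have "distr lborel borel S = distr (distr lborel borel f) borel (\<lambda>x. a + c *\<^sub>R x)"
    using m by (simp add: distr_distr S o_def)
  also have "\<dots> = distr lborel borel (\<lambda>x. a + c *\<^sub>R x)"
    by (simp add: distr_lborel_orthogonal[OF f(1)])
  finally show ?thesis using lborel_affine[of c a] f(2) by simp
qed

lemma similarity_measurable: "similarity c S \<Longrightarrow> S \<in> borel_measurable borel"
  by (intro borel_measurable_continuous_onI similarity_continuous)

lemma similarity_integral:
  fixes F :: "plane \<Rightarrow> real"
  assumes S: "similarity c S" and F: "F \<in> borel_measurable borel"
  shows "(LINT x|lborel. F x) = c\<^sup>2 * (LINT x|lborel. F (S x))"
proof -
  have "(LINT x|lborel. F x) = (LINT x|density (distr lborel borel S) (\<lambda>_. ennreal (c\<^sup>2)). F x)"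
    using similarity_distr[OF S] by simp
  also have "\<dots> = (LINT x|distr lborel borel S. c\<^sup>2 * F x)"
    using F by (subst integral_density) auto
  also have "\<dots> = (LINT x|lborel. c\<^sup>2 * F (S x))"
    using F similarity_measurable[OF S] by (subst integral_distr) auto
  finally show ?thesis by simp
qed

lemma similarity_measure:
  assumes S: "similarity c S" and A: "A \<in> sets borel"
  shows "measure lborel (S ` A) = c\<^sup>2 * measure lborel A"
proof -
  obtain S' where S': "similarity (1/c) S'" "\<And>x. S' (S x) = x" "\<And>x. S (S' x) = x"
    using similarity_inverse[OF assms(1)] by blast
  have m: "S ` A \<in> sets borel"
    unfolding similarity_vimage[OF S S'(2,3)] using measurable_sets[OF similarity_measurable[OF S'(1)] A] by simp
  have "measure lborel (S ` A) = (LINT x|lborel. indicator (S ` A) x)" using m by simp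
  also have "\<dots> = c\<^sup>2 * (LINT x|lborel. indicator (S ` A) (S x))"
    by (rule similarity_integral[OF S]) (use m in simp)
  also have "(\<lambda>x. indicat_real (S ` A) (S x)) = indicator A"
    using S'(2) by (auto simp: indicator_def fun_eq_iff) metis
  finally show ?thesis using A by simp
qed

text \<open>A test function on the image is pulled back and divided by c^2. The gradient norm then
  gains a factor 1/c and the change of variables a factor 1/c^2, so both terms of the energy scale
  by c^-4.\<close>

lemma torsional_rigidity_similarity_le:
  assumes S: "similarity c S" and \<Omega>: "open \<Omega>" "bounded \<Omega>"
  shows "torsional_rigidity (S ` \<Omega>) \<le> c ^ 4 * torsional_rigidity \<Omega>"
proof (rule torsional_rigidity_leI)
  show "open (S ` \<Omega>)" "bounded (S ` \<Omega>)" using similarity_open[OF S] similarity_bounded[OF S] \<Omega> by auto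
  fix \<phi> assume \<phi>: "\<phi> \<in> test_functions (S ` \<Omega>)"
  obtain a f where f: "orthogonal_transformation f" and c: "c > 0" and Sf: "S = (\<lambda>x. a + c *\<^sub>R f x)"
    using S by (auto simp: similarity_def)
  obtain S' where S': "similarity (1/c) S'" "\<And>x. S' (S x) = x" "\<And>x. S (S' x) = x"
    using similarity_inverse[OF S] by blast
  obtain K where K: "smooth \<phi>" "compact K" "K \<subseteq> S ` \<Omega>" "\<And>x. x \<notin> K \<Longrightarrow> \<phi> x = 0"
    using \<phi> by (rule test_functionsE) blast
  define \<psi> where "\<psi> x = (1/c\<^sup>2) * \<phi> (S x)" for x
  have lin: "linear (\<lambda>x. c *\<^sub>R f x)"
    using orthogonal_transformation_linear[OF f] by (rule linear_compose_scale_right)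
  have sm: "smooth (\<lambda>x. \<phi> (S x))" unfolding Sf using smooth_linear_comp[OF lin K(1)] .
  have \<psi>: "\<psi> \<in> test_functions \<Omega>"
  proof (rule test_functionsI[where K="S' ` K"])
    show "smooth \<psi>" unfolding \<psi>_def by (rule smooth_mult[OF smooth_const sm])
    show "compact (S' ` K)"
      using similarity_continuous[OF S'(1)] K(2) by (intro compact_continuous_image) (auto intro: continuous_on_subset)
    show "S' ` K \<subseteq> \<Omega>" using K(3) S'(2) by force
    show "\<psi> x = 0" if "x \<notin> S' ` K" for x
      using that K(4)[of "S x"] S'(2)[of x] by (force simp: \<psi>_def)
  qed
  have gr: "norm (grad \<psi> x) = (1/c) * norm (grad \<phi> (S x))" for x
  proof -
    have bl: "bounded_linear (\<lambda>x. c *\<^sub>R f x)" using lin by (simp add: linear_conv_bounded_linear)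
    have 1: "(S has_derivative (\<lambda>x. c *\<^sub>R f x)) (at x)"
      unfolding Sf using has_derivative_add[OF has_derivative_const bounded_linear_imp_has_derivative[OF bl]] by simp
    have 2: "(\<phi> has_derivative (\<lambda>h. grad \<phi> (S x) \<bullet> h)) (at (S x))"
      by (rule has_derivative_grad[OF smooth_differentiable[OF K(1)]])
    \<comment> \<open>The adjoint of the orthogonal map \<open>f\<close> is its inverse, so
      \<open>f\<close> can be moved to the gradient, whose norm it preserves.\<close>
    have 3: "grad \<phi> (S x) \<bullet> (c *\<^sub>R f h) = (c *\<^sub>R inv f (grad \<phi> (S x))) \<bullet> h" for h
    proof -
      have "f (inv f (grad \<phi> (S x))) = grad \<phi> (S x)"
        using orthogonal_transformation_surj[OF f] by (simp add: surj_f_inv_f)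
      then have "grad \<phi> (S x) \<bullet> f h = f (inv f (grad \<phi> (S x))) \<bullet> f h" by simp
      also have "\<dots> = inv f (grad \<phi> (S x)) \<bullet> h" using f by (simp add: orthogonal_transformation_def)
      finally show ?thesis by simp
    qed
    have "((\<lambda>x. \<phi> (S x)) has_derivative (\<lambda>h. (c *\<^sub>R inv f (grad \<phi> (S x))) \<bullet> h)) (at x)"
      using diff_chain_at[OF 1 2] by (simp only: o_def 3)
    from has_derivative_mult_right[OF this, of "1/c\<^sup>2"]
    have "(\<psi> has_derivative (\<lambda>h. ((1/c\<^sup>2) *\<^sub>R c *\<^sub>R inv f (grad \<phi> (S x))) \<bullet> h)) (at x)"
      by (simp add: \<psi>_def[abs_def])
    from grad_eqI[OF this] show ?thesis
      using c by (simp add: orthogonal_transformation_norm[OF orthogonal_transformation_inv[OF f]] power2_eq_square)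
  qed
  have mp: "\<phi> \<in> borel_measurable borel" "(\<lambda>x. (norm (grad \<phi> x))\<^sup>2) \<in> borel_measurable borel"
    using smooth_continuous[OF K(1)] smooth_continuous_grad[OF K(1)]
    by (auto intro!: borel_measurable_continuous_onI continuous_intros)
  have i\<psi>: "(LINT x|lborel. \<psi> x) = (1/c\<^sup>2) * (LINT x|lborel. \<phi> (S x))" by (simp add: \<psi>_def)
  have "c ^ 4 * torsion_energy \<psi> = torsion_energy \<phi>"
    unfolding torsion_energy_def gr similarity_integral[OF S mp(1)] similarity_integral[OF S mp(2)] i\<psi>
    using c by (simp add: power_mult_distrib field_simps power2_eq_square power4_eq_xxxx)
  moreover have "torsion_energy \<psi> \<le> torsional_rigidity \<Omega>"
    by (rule torsion_energy_le_rigidity[OF \<Omega> \<psi>])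
  ultimately show "torsion_energy \<phi> \<le> c ^ 4 * torsional_rigidity \<Omega>"
    using c by (metis mult_left_mono zero_le_power less_imp_le)
qed

text \<open>The reverse inequality is the previous one for the inverse similarity.\<close>

lemma torsional_rigidity_similarity:
  assumes S: "similarity c S" and \<Omega>: "open \<Omega>" "bounded \<Omega>"
  shows "torsional_rigidity (S ` \<Omega>) = c ^ 4 * torsional_rigidity \<Omega>"
proof (rule antisym)
  show "torsional_rigidity (S ` \<Omega>) \<le> c ^ 4 * torsional_rigidity \<Omega>"
    by (rule torsional_rigidity_similarity_le[OF assms])
  have c: "c > 0" using S by (simp add: similarity_def)
  obtain S' where S': "similarity (1/c) S'" "\<And>x. S' (S x) = x" "\<And>x. S (S' x) = x"
    using similarity_inverse[OF S] by blast
  have "S' ` S ` \<Omega> = \<Omega>" using S'(2) by (simp add: image_image)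
  then have "torsional_rigidity \<Omega> \<le> (1/c) ^ 4 * torsional_rigidity (S ` \<Omega>)"
    using torsional_rigidity_similarity_le[OF S'(1) similarity_open[OF S \<Omega>(1)] similarity_bounded[OF S \<Omega>(2)]] by simp
  then show "c ^ 4 * torsional_rigidity \<Omega> \<le> torsional_rigidity (S ` \<Omega>)"
    using c by (simp add: field_simps power_divide)
qed

section \<open>Logarithmic energy and capacity\<close>

lemma log_kernel_measurable:
  "(\<lambda>z. log_kernel (fst z) (snd z)) \<in> borel_measurable (borel \<Otimes>\<^sub>M borel)"
proof -
  have "closed {z :: plane \<times> plane. fst z = snd z}"
    by (intro closed_Collect_eq continuous_intros)
  then have [measurable]: "{z :: plane \<times> plane. fst z = snd z} \<in> sets (borel \<Otimes>\<^sub>M borel)"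
    unfolding borel_prod by (rule borel_closed)
  have "(\<lambda>z. log_kernel (fst z) (snd z)) =
    (\<lambda>z. if z \<in> {z. fst z = snd z} then \<infinity> else ereal (ln (inverse (norm (fst z - snd z)))))"
    by (auto simp: log_kernel_def)
  then show ?thesis by simp
qed

section \<open>Energies of Borel probability measures as nonnegative integrals\<close>

lemma borel_prob_measuresD:
  assumes "\<mu> \<in> borel_prob_measures K"
  shows "prob_space \<mu>" "sets \<mu> = sets (restrict_space borel K)" "space \<mu> = K"
  using assms sets_eq_imp_space_eq[of \<mu> "restrict_space borel K"]
  by (auto simp: borel_prob_measures_def space_restrict_space)

lemma borel_prob_measures_measurable:
  assumes "\<mu> \<in> borel_prob_measures K" "f \<in> measurable borel N"
  shows "f \<in> measurable \<mu> N"
  using measurable_restrict_space1[OF assms(2), of K] borel_prob_measuresD(2)[OF assms(1)]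
  by (simp cong: measurable_cong_sets)

lemma log_kernel_measurable_pair:
  assumes "\<mu> \<in> borel_prob_measures K"
  shows "(\<lambda>z. log_kernel (fst z) (snd z)) \<in> borel_measurable (\<mu> \<Otimes>\<^sub>M \<mu>)"
proof -
  have "(\<lambda>z. (fst z, snd z)) \<in> measurable (\<mu> \<Otimes>\<^sub>M \<mu>) (borel \<Otimes>\<^sub>M borel)"
    using borel_prob_measures_measurable[OF assms measurable_ident]
    by (intro measurable_Pair measurable_compose[OF measurable_fst] measurable_compose[OF measurable_snd]) (auto simp: id_def)
  from measurable_compose[OF this log_kernel_measurable] show ?thesis by simp
qed

text \<open>With positive and negative parts this reads k^+ + C = (k + C)^+ + k^- for k \<ge> -C.
  After integration it replaces a difference of two integrals by a single one.\<close>

lemma e2ennreal_shift: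
  assumes "k \<ge> - ereal C" "C \<ge> 0"
  shows "e2ennreal k + ennreal C = e2ennreal (k + ereal C) + e2ennreal (- k)"
proof (cases k)
  case (real r)
  then have "r \<ge> - C" using assms by simp
  have "ennreal r + ennreal C = ennreal (r + C) + ennreal (- r)"
  proof (cases "r \<ge> 0")
    case True then show ?thesis using assms(2) by (simp add: ennreal_plus ennreal_neg)
  next
    case False
    then have "ennreal (r + C) + ennreal (- r) = ennreal (r + C + (- r))"
      using \<open>r \<ge> - C\<close> by (intro ennreal_plus[symmetric]) auto
    then show ?thesis using False by (simp add: ennreal_neg)
  qed
  then show ?thesis using real by (simp add: ennreal.abs_eq[symmetric] e2ennreal_ereal)
qed (use assms in auto)

lemma log_kernel_ge:
  assumes "norm (x - y) \<le> exp C" shows "log_kernel x y \<ge> - ereal C"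
proof (cases "x = y")
  case False
  then have "ln (norm (x - y)) \<le> C" using assms by (metis ln_exp ln_le_cancel_iff exp_gt_zero zero_less_norm_iff right_minus_eq)
  then show ?thesis using False by (simp add: log_kernel_def ln_inverse)
qed (simp add: log_kernel_def)

text \<open>The kernel is at least -C on a set of diameter at most exp C, so its shift by C is
  nonnegative. The energy becomes one nonnegative integral, to which the theorems of Tonelli and
  Fatou and pushforwards apply.\<close>

lemma log_energy_shift:
  assumes \<mu>: "\<mu> \<in> borel_prob_measures K" and C: "C \<ge> 0" "\<forall>x\<in>K. \<forall>y\<in>K. norm (x - y) \<le> exp C"
  shows "log_energy \<mu> =
    enn2ereal (\<integral>\<^sup>+z. e2ennreal (log_kernel (fst z) (snd z) + ereal C) \<partial>(\<mu> \<Otimes>\<^sub>M \<mu>)) - ereal C"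
proof -
  interpret prob_space \<mu> by (rule borel_prob_measuresD(1)[OF \<mu>])
  interpret P: pair_prob_space \<mu> \<mu> ..
  let ?k = "\<lambda>z. log_kernel (fst z) (snd z)"
  have m[measurable]: "?k \<in> borel_measurable (\<mu> \<Otimes>\<^sub>M \<mu>)" by (rule log_kernel_measurable_pair[OF \<mu>])
  define P where "P = (\<integral>\<^sup>+z. e2ennreal (?k z) \<partial>(\<mu> \<Otimes>\<^sub>M \<mu>))"
  define N where "N = (\<integral>\<^sup>+z. e2ennreal (- ?k z) \<partial>(\<mu> \<Otimes>\<^sub>M \<mu>))"
  define E where "E = (\<integral>\<^sup>+z. e2ennreal (?k z + ereal C) \<partial>(\<mu> \<Otimes>\<^sub>M \<mu>))"
  have k: "?k z \<ge> - ereal C" if "z \<in> space (\<mu> \<Otimes>\<^sub>M \<mu>)" for z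
    using that borel_prob_measuresD(3)[OF \<mu>] C(2) by (intro log_kernel_ge) (auto simp: space_pair_measure)
  have "P + ennreal C = (\<integral>\<^sup>+z. e2ennreal (?k z) + ennreal C \<partial>(\<mu> \<Otimes>\<^sub>M \<mu>))"
    unfolding P_def by (subst nn_integral_add) (auto simp: P.emeasure_space_1)
  also have "\<dots> = (\<integral>\<^sup>+z. e2ennreal (?k z + ereal C) + e2ennreal (- ?k z) \<partial>(\<mu> \<Otimes>\<^sub>M \<mu>))"
    by (intro nn_integral_cong e2ennreal_shift k C)
  also have "\<dots> = E + N"
    unfolding E_def N_def by (rule nn_integral_add) auto
  finally have eq: "P + ennreal C = E + N" .
  \<comment> \<open>The negative part is bounded by C, so its integral is finite and may be
    subtracted even when the positive part has infinite integral.\<close>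
  have "N \<le> (\<integral>\<^sup>+z. ennreal C \<partial>(\<mu> \<Otimes>\<^sub>M \<mu>))"
    unfolding N_def
  proof (rule nn_integral_mono)
    fix z assume "z \<in> space (\<mu> \<Otimes>\<^sub>M \<mu>)"
    from k[OF this] have "- ?k z \<le> ereal C" by (metis ereal_minus_le_minus ereal_uminus_uminus)
    then show "e2ennreal (- ?k z) \<le> ennreal C" using e2ennreal_mono[of "- ?k z" "ereal C"] by (simp add: e2ennreal_ereal)
  qed
  then have "N \<le> ennreal C" by (simp add: P.emeasure_space_1)
  then obtain n where n: "N = ennreal n" "n \<ge> 0"
    by (metis ennreal_cases ennreal_less_top leD order_le_less_trans)
  have "enn2ereal P - enn2ereal N = enn2ereal E - ereal C"
  proof (cases P)
    case (real p)
    then obtain e where e: "E = ennreal e" "e \<ge> 0" using eq n C(1)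
      by (metis ennreal_cases ennreal_add_eq_top ennreal_neq_top)
    have "ennreal (p + C) = ennreal (e + n)" using eq real e n C(1) by simp
    then have "p + C = e + n" using real e n C(1) by (subst (asm) ennreal_inj) auto
    then show ?thesis using real e n C(1) by (simp add: enn2ereal_ennreal)
  next
    case top
    then have "E = top" using eq n by (metis ennreal_add_eq_top ennreal_neq_top)
    then show ?thesis using top n by (simp add: enn2ereal_ennreal top_ereal_def)
  qed
  then show ?thesis by (simp add: log_energy_def P_def N_def E_def)
qed

text \<open>Allowing every larger exponent leaves room to choose shifts that suit two sets at
  once.\<close>

lemma bounded_norm_diff_le_exp:
  fixes K :: "plane set"
  assumes "bounded K"
  obtains C where "C \<ge> 0" "\<And>D. D \<ge> C \<Longrightarrow> \<forall>x\<in>K. \<forall>y\<in>K. norm (x - y) \<le> exp D"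
proof -
  obtain B where B: "\<And>x. x \<in> K \<Longrightarrow> norm x \<le> B" using assms by (auto simp: bounded_iff)
  have "norm (x - y) \<le> exp D" if "D \<ge> \<bar>2 * B\<bar>" "x \<in> K" "y \<in> K" for D x y
  proof -
    have "norm (x - y) \<le> norm x + norm y" by (rule norm_triangle_ineq4)
    also have "\<dots> \<le> D" using B[of x] B[of y] that by simp
    also have "\<dots> \<le> exp D" using exp_ge_add_one_self[of D] by linarith
    finally show ?thesis .
  qed
  then show ?thesis using that[of "\<bar>2 * B\<bar>"] by auto
qed

lemma log_energy_bounded_below:
  fixes K :: "plane set"
  assumes "bounded K"
  obtains C where "\<And>\<mu>. \<mu> \<in> borel_prob_measures K \<Longrightarrow> log_energy \<mu> \<ge> ereal C"
proof -
  obtain C where C: "C \<ge> 0" "\<And>D. D \<ge> C \<Longrightarrow> \<forall>x\<in>K. \<forall>y\<in>K. norm (x - y) \<le> exp D"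
    using bounded_norm_diff_le_exp[OF assms] by metis
  have "log_energy \<mu> \<ge> ereal (- C)" if "\<mu> \<in> borel_prob_measures K" for \<mu>
    unfolding log_energy_shift[OF that C(1) C(2)[OF order_refl]]
    using ereal_minus_mono[of 0 _ "ereal C" "ereal C"] by simp
  then show ?thesis by (rule that)
qed

lemma log_potential_energy_not_minf:
  assumes "bounded K" shows "log_potential_energy K \<noteq> - \<infinity>"
proof -
  obtain C where C: "\<And>\<mu>. \<mu> \<in> borel_prob_measures K \<Longrightarrow> log_energy \<mu> \<ge> ereal C"
    using log_energy_bounded_below[OF assms] by blast
  have "ereal C \<le> log_potential_energy K" unfolding log_potential_energy_def by (rule INF_greatest) (rule C)
  then show ?thesis by auto
qed

lemma log_capacity_leI:
  assumes "\<And>\<mu>. \<mu> \<in> borel_prob_measures K \<Longrightarrow> log_energy \<mu> \<ge> ereal r"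
  shows "log_capacity K \<le> exp (- r)"
proof -
  have "ereal r \<le> log_potential_energy K" unfolding log_potential_energy_def by (rule INF_greatest) (rule assms)
  then show ?thesis by (cases "log_potential_energy K") (auto simp: log_capacity_def)
qed

lemma log_capacity_geI:
  assumes "bounded K" "log_potential_energy K \<le> ereal r"
  shows "log_capacity K \<ge> exp (- r)"
  using assms(2) log_potential_energy_not_minf[OF assms(1)]
  by (cases "log_potential_energy K") (auto simp: log_capacity_def)

text \<open>Push \<open>\<mu>\<close> forward: multiplying distances by c lowers the kernel by ln c
  off the diagonal, while on the diagonal both kernels are infinite.\<close>

lemma log_energy_map:
  assumes \<mu>: "\<mu> \<in> borel_prob_measures K" and K: "bounded K" and K': "bounded K'"
    and S: "S \<in> borel_measurable borel" "S ` K \<subseteq> K'" and c: "c > 0"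
    and dist: "\<And>x y. x \<in> K \<Longrightarrow> y \<in> K \<Longrightarrow> norm (S x - S y) = c * norm (x - y)"
  shows "\<exists>\<nu>\<in>borel_prob_measures K'. log_energy \<nu> = log_energy \<mu> - ereal (ln c)"
proof -
  interpret prob_space \<mu> by (rule borel_prob_measuresD(1)[OF \<mu>])
  define \<nu> where "\<nu> = distr \<mu> (restrict_space borel K') S"
  have mS: "S \<in> measurable \<mu> (restrict_space borel K')"
    using borel_prob_measures_measurable[OF \<mu> S(1)] S(2) borel_prob_measuresD(3)[OF \<mu>]
    by (intro measurable_restrict_space2) auto
  have \<nu>: "\<nu> \<in> borel_prob_measures K'"
    unfolding borel_prob_measures_def \<nu>_def using prob_space_distr[OF mS] by simp
  interpret N: prob_space \<nu> by (rule borel_prob_measuresD(1)[OF \<nu>])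
  obtain C1 where C1: "C1 \<ge> 0" "\<And>D. D \<ge> C1 \<Longrightarrow> \<forall>x\<in>K. \<forall>y\<in>K. norm (x - y) \<le> exp D"
    using bounded_norm_diff_le_exp[OF K] by metis
  obtain C2 where C2: "C2 \<ge> 0" "\<And>D. D \<ge> C2 \<Longrightarrow> \<forall>x\<in>K'. \<forall>y\<in>K'. norm (x - y) \<le> exp D"
    using bounded_norm_diff_le_exp[OF K'] by metis
  \<comment> \<open>With this choice the shift C suits \<open>K\<close>, and C + ln c is nonnegative
    and suits \<open>K'\<close>.\<close>
  define C where "C = C1 + C2 + \<bar>ln c\<bar>"
  have C: "C \<ge> C1" "C + ln c \<ge> C2" "C \<ge> 0" "C + ln c \<ge> 0" using C1(1) C2(1) by (auto simp: C_def)
  have ker: "log_kernel (S x) (S y) + ereal (C + ln c) = log_kernel x y + ereal C" if "x \<in> K" "y \<in> K" for x y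
  proof (cases "x = y")
    case False
    then have "norm (S x - S y) > 0" using dist[OF that] c by simp
    then have "S x \<noteq> S y" by auto
    then show ?thesis using False c by (simp add: log_kernel_def dist[OF that] ln_inverse ln_mult)
  qed (simp add: log_kernel_def)
  have m: "(\<lambda>z. e2ennreal (log_kernel (fst z) (snd z) + ereal (C + ln c)))
     \<in> borel_measurable (restrict_space borel K' \<Otimes>\<^sub>M restrict_space borel K')"
    using log_kernel_measurable_pair[OF \<nu>] sets_pair_measure_cong[OF borel_prob_measuresD(2)[OF \<nu>] borel_prob_measuresD(2)[OF \<nu>]]
    by (simp cong: measurable_cong_sets)
  have "\<nu> \<Otimes>\<^sub>M \<nu> = distr (\<mu> \<Otimes>\<^sub>M \<mu>) (restrict_space borel K' \<Otimes>\<^sub>M restrict_space borel K') (\<lambda>(x, y). (S x, S y))"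
    unfolding \<nu>_def using N.sigma_finite_measure_axioms unfolding \<nu>_def
    by (intro pair_measure_distr mS)
  then have "(\<integral>\<^sup>+z. e2ennreal (log_kernel (fst z) (snd z) + ereal (C + ln c)) \<partial>(\<nu> \<Otimes>\<^sub>M \<nu>)) =
     (\<integral>\<^sup>+z. e2ennreal (log_kernel (S (fst z)) (S (snd z)) + ereal (C + ln c)) \<partial>(\<mu> \<Otimes>\<^sub>M \<mu>))"
    using m mS by (simp add: nn_integral_distr case_prod_beta)
  also have "\<dots> = (\<integral>\<^sup>+z. e2ennreal (log_kernel (fst z) (snd z) + ereal C) \<partial>(\<mu> \<Otimes>\<^sub>M \<mu>))"
    using borel_prob_measuresD(3)[OF \<mu>] by (intro nn_integral_cong) (auto simp: ker space_pair_measure)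
  finally have eq: "log_energy \<nu> = enn2ereal (\<integral>\<^sup>+z. e2ennreal (log_kernel (fst z) (snd z) + ereal C) \<partial>(\<mu> \<Otimes>\<^sub>M \<mu>)) - ereal (C + ln c)"
    using log_energy_shift[OF \<nu> C(4) C2(2)[OF C(2)]] by simp
  have "log_energy \<nu> = log_energy \<mu> - ereal (ln c)"
    unfolding eq log_energy_shift[OF \<mu> C(3) C1(2)[OF C(1)]]
    by (cases "enn2ereal (\<integral>\<^sup>+z. e2ennreal (log_kernel (fst z) (snd z) + ereal C) \<partial>(\<mu> \<Otimes>\<^sub>M \<mu>))") auto
  then show ?thesis using \<nu> by blast
qed

text \<open>Pushing competitors forward bounds the energy of \<open>K'\<close> by that of
  \<open>K\<close> minus ln c. Similarities and, with the identity and c = 1, inclusions are both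
  instances.\<close>

lemma log_capacity_map_le:
  assumes K: "bounded K" and K': "bounded K'"
    and S: "S \<in> borel_measurable borel" "S ` K \<subseteq> K'" and c: "c > 0"
    and dist: "\<And>x y. x \<in> K \<Longrightarrow> y \<in> K \<Longrightarrow> norm (S x - S y) = c * norm (x - y)"
  shows "c * log_capacity K \<le> log_capacity K'"
proof (cases "log_potential_energy K")
  case (real r)
  have "log_potential_energy K' + ereal (ln c) \<le> log_potential_energy K"
    unfolding log_potential_energy_def[of K]
  proof (rule INF_greatest)
    fix \<mu> assume "\<mu> \<in> borel_prob_measures K"
    then obtain \<nu> where \<nu>: "\<nu> \<in> borel_prob_measures K'" "log_energy \<nu> = log_energy \<mu> - ereal (ln c)"
      using log_energy_map[OF _ K K' S c dist] by blast
    have "log_potential_energy K' \<le> log_energy \<nu>"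
      unfolding log_potential_energy_def by (rule INF_lower) (rule \<nu>(1))
    then show "log_potential_energy K' + ereal (ln c) \<le> log_energy \<mu>"
      unfolding \<nu>(2) by (cases "log_energy \<mu>"; cases "log_potential_energy K'") auto
  qed
  then have "log_potential_energy K' \<le> ereal (r - ln c)"
    unfolding real by (cases "log_potential_energy K'") auto
  from log_capacity_geI[OF K' this] have "exp (ln c - r) \<le> log_capacity K'" by simp
  then show ?thesis using real c by (simp add: log_capacity_def exp_diff exp_minus field_simps)
next
  case PInf
  then show ?thesis by (simp add: log_capacity_def)
next
  case MInf
  then show ?thesis using log_potential_energy_not_minf[OF K] by simp
qed

lemma log_capacity_nonneg: "log_capacity K \<ge> 0"
  by (simp add: log_capacity_def)

lemma log_capacity_mono:
  assumes "bounded K'" "K \<subseteq> K'" shows "log_capacity K \<le> log_capacity K'"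
  using log_capacity_map_le[of K K' "\<lambda>x. x" 1] assms bounded_subset by auto

section \<open>Capacity of flat sets\<close>

text \<open>The sum is the coefficient of x^n in the Lagrange interpolant of \<open>P\<close> at n +
  1 points, and that interpolant is \<open>P\<close> itself.\<close>

lemma lagrange_leading_coeff:
  fixes z :: "'i \<Rightarrow> complex" and P :: "complex poly"
  assumes I: "finite I" "card I = Suc n" and inj: "inj_on z I"
    and P: "degree P = n" "lead_coeff P = 1"
  shows "(\<Sum>i\<in>I. poly P (z i) / (\<Prod>j\<in>I - {i}. z i - z j)) = 1"
proof -
  define a where "a i = poly P (z i) / (\<Prod>j\<in>I - {i}. z i - z j)" for i
  define Q where "Q i = (\<Prod>j\<in>I - {i}. [:- z j, 1:])" for i
  define L where "L = (\<Sum>i\<in>I. smult (a i) (Q i))"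
  have dQ: "degree (Q i) = n" "coeff (Q i) n = 1" if "i \<in> I" for i
  proof -
    have "degree (Q i) = (\<Sum>j\<in>I - {i}. degree [:- z j, 1:])"
      unfolding Q_def by (rule degree_prod_eq_sum_degree) auto
    also have "\<dots> = n" using I that by simp
    finally show d: "degree (Q i) = n" .
    have "lead_coeff (Q i) = 1" unfolding Q_def lead_coeff_prod by simp
    then show "coeff (Q i) n = 1" by (simp add: d)
  qed
  have ne: "(\<Prod>j\<in>I - {i}. z i - z j) \<noteq> 0" if "i \<in> I" for i
    using I inj that by (auto simp: inj_on_def)
  have pQ: "poly (Q i) (z k) = (if k = i then (\<Prod>j\<in>I - {i}. z i - z j) else 0)" if "i \<in> I" "k \<in> I" for i k
    using that I by (auto simp: Q_def poly_prod)
  have "poly L (z k) = poly P (z k)" if k: "k \<in> I" for k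
  proof -
    have "poly L (z k) = (\<Sum>i\<in>I. a i * poly (Q i) (z k))" by (simp add: L_def poly_sum)
    also have "\<dots> = (\<Sum>i\<in>I. if k = i then a i * (\<Prod>j\<in>I - {i}. z i - z j) else 0)"
      by (intro sum.cong refl) (simp add: pQ k)
    also have "\<dots> = poly P (z k)" using I k ne[OF k] by (simp add: a_def)
    finally show ?thesis .
  qed
  moreover have "degree L \<le> n" unfolding L_def
    by (rule degree_sum_le) (use I dQ in \<open>auto intro: order_trans[OF degree_smult_le]\<close>)
  moreover have "card (z ` I) = Suc n" using I inj by (simp add: card_image)
  ultimately have "L = P" using P by (intro poly_eqI_degree[of "z ` I"]) auto
  then have "coeff L n = 1" using P by simp
  then show ?thesis using dQ(2) by (simp add: L_def coeff_sum a_def)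
qed

text \<open>The previous sum has n + 1 terms and value 1, so its terms cannot all be smaller than
  1/(n + 1) in modulus.\<close>

lemma exists_small_product:
  fixes z :: "'i \<Rightarrow> complex" and P :: "complex poly"
  assumes I: "finite I" "card I = Suc n" and inj: "inj_on z I"
    and P: "degree P = n" "lead_coeff P = 1" "\<And>i. i \<in> I \<Longrightarrow> norm (poly P (z i)) \<le> M"
  shows "\<exists>i\<in>I. (\<Prod>j\<in>I - {i}. norm (z i - z j)) \<le> real (Suc n) * M"
proof (rule ccontr)
  assume "\<not> ?thesis"
  then have big: "(\<Prod>j\<in>I - {i}. norm (z i - z j)) > real (Suc n) * M" if "i \<in> I" for i
    using that by force
  have ne: "I \<noteq> {}" using I by auto
  have "1 = norm (\<Sum>i\<in>I. poly P (z i) / (\<Prod>j\<in>I - {i}. z i - z j))"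
    by (simp add: lagrange_leading_coeff[OF I inj P(1,2)])
  also have "\<dots> \<le> (\<Sum>i\<in>I. norm (poly P (z i) / (\<Prod>j\<in>I - {i}. z i - z j)))" by (rule norm_sum)
  also have "\<dots> < (\<Sum>i\<in>I. 1 / real (Suc n))"
  proof (rule sum_strict_mono[OF I(1) ne])
    fix i assume i: "i \<in> I"
    have "M \<ge> 0" using P(3)[OF i] norm_ge_zero order_trans by blast
    define p where "p = (\<Prod>j\<in>I - {i}. norm (z i - z j))"
    have p: "p > real (Suc n) * M" unfolding p_def by (rule big[OF i])
    then have "p > 0" using \<open>M \<ge> 0\<close> by (meson le_less_trans mult_nonneg_nonneg of_nat_0_le_iff)
    have "norm (poly P (z i)) * real (Suc n) \<le> M * real (Suc n)" using P(3)[OF i] by (rule mult_right_mono) simp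
    also have "\<dots> < p" using p by (simp add: mult.commute)
    finally have "norm (poly P (z i)) / p < 1 / real (Suc n)" using \<open>p > 0\<close> by (simp add: field_simps)
    then show "norm (poly P (z i) / (\<Prod>j\<in>I - {i}. z i - z j)) < 1 / real (Suc n)"
      by (simp add: norm_divide p_def prod_norm)
  qed
  also have "\<dots> = 1" using I by simp
  finally show False by simp
qed

text \<open>Remove a point whose product of distances to the others is small, and repeat. The
  removed point contributes its distances twice, once in each order, hence the factor 2. Monic
  polynomials of all degrees below N are needed because each stage has one point fewer.\<close>

lemma sum_log_distances_le:
  fixes z :: "'i \<Rightarrow> complex"
  assumes P: "\<And>k. k < N \<Longrightarrow> degree (P k) = k \<and> lead_coeff (P k) = 1 \<and> (\<forall>x\<in>E. norm (poly (P k) x) \<le> M)"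
    and "M \<ge> 1" "N \<ge> 1"
  shows "finite I \<Longrightarrow> card I \<le> N \<Longrightarrow> inj_on z I \<Longrightarrow> z ` I \<subseteq> E \<Longrightarrow>
    (\<Sum>i\<in>I. \<Sum>j\<in>I - {i}. ln (norm (z i - z j))) \<le> 2 * real (card I) * ln (real N * M)"
proof (induction "card I" arbitrary: I)
  case 0
  then show ?case by simp
next
  case (Suc n)
  have n: "n < N" using Suc by simp
  have I: "finite I" "card I = Suc n" using Suc by auto
  obtain i where i: "i \<in> I" "(\<Prod>j\<in>I - {i}. norm (z i - z j)) \<le> real (Suc n) * M"
    using exists_small_product[OF I Suc.prems(3), of "P n" M] P[OF n] Suc.prems(4) by blast
  have pos: "norm (z i - z j) > 0" if "j \<in> I - {i}" for j
    using that i(1) inj_onD[OF Suc.prems(3), of i j]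
    by (metis DiffD1 DiffD2 insertI1 right_minus_eq zero_less_norm_iff)
  have pp: "0 < (\<Prod>j\<in>I - {i}. norm (z i - z j))" by (rule prod_pos) (rule pos)
  have "(\<Sum>j\<in>I - {i}. ln (norm (z i - z j))) = ln (\<Prod>j\<in>I - {i}. norm (z i - z j))"
    using pos I by (subst ln_prod) auto
  also have "\<dots> \<le> ln (real (Suc n) * M)"
    using order.strict_trans2[OF pp i(2)] by (rule ln_le_cancel_iff[THEN iffD2, OF pp _ i(2)])
  also have "\<dots> \<le> ln (real N * M)"
    using n assms(2) by (intro ln_mono) auto
  finally have A: "(\<Sum>j\<in>I - {i}. ln (norm (z i - z j))) \<le> ln (real N * M)" .
  define J where "J = I - {i}"
  have IJ: "I = insert i J" "i \<notin> J" "finite J" "card J = n" using i(1) I by (auto simp: J_def)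
  have B: "(\<Sum>k\<in>J. \<Sum>j\<in>J - {k}. ln (norm (z k - z j))) \<le> 2 * real (card J) * ln (real N * M)"
    using Suc IJ by (intro Suc.hyps(1)) (auto simp: inj_on_def)
  have "(\<Sum>k\<in>J. \<Sum>j\<in>I - {k}. ln (norm (z k - z j))) = (\<Sum>k\<in>J. ln (norm (z k - z i)) + (\<Sum>j\<in>J - {k}. ln (norm (z k - z j))))"
  proof (rule sum.cong[OF refl])
    fix k assume "k \<in> J"
    then have "I - {k} = insert i (J - {k})" using IJ by auto
    then show "(\<Sum>j\<in>I - {k}. ln (norm (z k - z j))) = ln (norm (z k - z i)) + (\<Sum>j\<in>J - {k}. ln (norm (z k - z j)))"
      using IJ by simp
  qed
  also have "\<dots> = (\<Sum>k\<in>J. ln (norm (z i - z k))) + (\<Sum>k\<in>J. \<Sum>j\<in>J - {k}. ln (norm (z k - z j)))"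
    by (simp add: sum.distrib norm_minus_commute)
  finally have C: "(\<Sum>k\<in>J. \<Sum>j\<in>I - {k}. ln (norm (z k - z j))) =
     (\<Sum>k\<in>J. ln (norm (z i - z k))) + (\<Sum>k\<in>J. \<Sum>j\<in>J - {k}. ln (norm (z k - z j)))" .
  have "sum g I = g i + sum g J" for g :: "'i \<Rightarrow> real"
    unfolding IJ(1) by (rule sum.insert[OF IJ(3,2)])
  from this[of "\<lambda>k. \<Sum>j\<in>I - {k}. ln (norm (z k - z j))"]
  have "(\<Sum>k\<in>I. \<Sum>j\<in>I - {k}. ln (norm (z k - z j))) =
     2 * (\<Sum>j\<in>J. ln (norm (z i - z j))) + (\<Sum>k\<in>J. \<Sum>j\<in>J - {k}. ln (norm (z k - z j)))"
    unfolding C J_def[symmetric] by linarith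
  with A B show ?case unfolding J_def[symmetric] I(2) IJ(4) by (simp add: algebra_simps)
qed

text \<open>Restriction to the two coordinates pushes the product measure to the product over just
  these two.\<close>

lemma nn_integral_PiM_pair:
  assumes "prob_space \<mu>" "finite J" "i \<in> J" "j \<in> J" "i \<noteq> j"
    and F: "case_prod F \<in> borel_measurable (\<mu> \<Otimes>\<^sub>M \<mu>)"
  shows "(\<integral>\<^sup>+x. F (x i) (x j) \<partial>PiM J (\<lambda>_. \<mu>)) = (\<integral>\<^sup>+z. F (fst z) (snd z) \<partial>(\<mu> \<Otimes>\<^sub>M \<mu>))"
proof -
  interpret prob_space \<mu> by fact
  interpret product_prob_space "\<lambda>_. \<mu>" J by unfold_locales
  have sub: "{i, j} \<subseteq> J" using assms by auto
  have m: "(\<lambda>x. F (x i) (x j)) \<in> borel_measurable (PiM {i, j} (\<lambda>_. \<mu>))"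
    using measurable_compose[OF _ F, of "\<lambda>x. (x i, x j)" "PiM {i, j} (\<lambda>_. \<mu>)"] by simp
  have "(\<integral>\<^sup>+x. F (x i) (x j) \<partial>PiM {i, j} (\<lambda>_. \<mu>)) =
     (\<integral>\<^sup>+x. F (x i) (x j) \<partial>distr (PiM J (\<lambda>_. \<mu>)) (PiM {i, j} (\<lambda>_. \<mu>)) (\<lambda>f. restrict f {i, j}))"
    by (subst (1) distr_restrict[OF sub assms(2)]) simp
  also have "\<dots> = (\<integral>\<^sup>+x. F (x i) (x j) \<partial>PiM J (\<lambda>_. \<mu>))"
    using m measurable_restrict_subset[OF sub] by (subst nn_integral_distr) auto
  finally show ?thesis using product_nn_integral_pair[OF F assms(5)] by simp
qed

section \<open>Bounding capacity by complex polynomials\<close>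

definition to_complex :: "plane \<Rightarrow> complex" where "to_complex x = Complex (x $ 1) (x $ 2)"

lemma norm_to_complex_diff: "norm (to_complex x - to_complex y) = norm (x - y)"
  by (simp add: to_complex_def cmod_def norm_vec_def L2_set_def sum_2)

text \<open>Averaging the logarithm of the Vandermonde product of \<open>N\<close> points over \<open>\<mu>\<^sup>N\<close> gives
  \<open>N (N - 1)\<close> times the energy, so a bound for the product bounds the energy from below.\<close>

lemma log_capacity_le_polynomials:
  assumes K: "bounded K" "to_complex ` K \<subseteq> E"
    and P: "\<And>k. k < N \<Longrightarrow> degree (P k) = k \<and> lead_coeff (P k) = 1 \<and> (\<forall>x\<in>E. norm (poly (P k) x) \<le> M)"
    and "M \<ge> 1" "N \<ge> 2"
  shows "log_capacity K \<le> exp (2 * ln (real N * M) / (real N - 1))"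
proof -
  define r where "r = - (2 * ln (real N * M) / (real N - 1))"
  have "log_energy \<mu> \<ge> ereal r" if \<mu>: "\<mu> \<in> borel_prob_measures K" for \<mu>
  proof -
    interpret prob_space \<mu> by (rule borel_prob_measuresD(1)[OF \<mu>])
    obtain C where C: "C \<ge> 0" "\<And>D. D \<ge> C \<Longrightarrow> \<forall>x\<in>K. \<forall>y\<in>K. norm (x - y) \<le> exp D"
      using bounded_norm_diff_le_exp[OF K(1)] by metis
    define F where "F x y = e2ennreal (log_kernel x y + ereal C)" for x y
    define E0 where "E0 = (\<integral>\<^sup>+z. F (fst z) (snd z) \<partial>(\<mu> \<Otimes>\<^sub>M \<mu>))"
    define J where "J = {..<N}"
    define PS where "PS = Sigma J (\<lambda>i. J - {i})"
    have PS: "finite PS" "card PS = N * (N - 1)" by (simp_all add: PS_def J_def)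
    have mF: "case_prod F \<in> borel_measurable (\<mu> \<Otimes>\<^sub>M \<mu>)"
      unfolding F_def case_prod_beta using log_kernel_measurable_pair[OF \<mu>] by simp
    have mFx: "(\<lambda>x. F (x (fst p)) (x (snd p))) \<in> borel_measurable (PiM J (\<lambda>_. \<mu>))" if "p \<in> PS" for p
    proof -
      have "(\<lambda>x. (x (fst p), x (snd p))) \<in> measurable (PiM J (\<lambda>_. \<mu>)) (\<mu> \<Otimes>\<^sub>M \<mu>)"
        using that by (intro measurable_Pair measurable_component_singleton) (auto simp: PS_def)
      from measurable_compose[OF this mF] show ?thesis by simp
    qed
    have PJ: "prob_space (PiM J (\<lambda>_. \<mu>))" by (intro prob_space_PiM borel_prob_measuresD(1)[OF \<mu>])
    have "(\<integral>\<^sup>+x. (\<Sum>p\<in>PS. F (x (fst p)) (x (snd p))) \<partial>PiM J (\<lambda>_. \<mu>)) = (\<Sum>p\<in>PS. E0)"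
      using mFx
    proof (subst nn_integral_sum, simp, intro sum.cong refl)
      fix p assume "p \<in> PS"
      then show "(\<integral>\<^sup>+x. F (x (fst p)) (x (snd p)) \<partial>PiM J (\<lambda>_. \<mu>)) = E0"
        unfolding E0_def
        by (intro nn_integral_PiM_pair borel_prob_measuresD(1)[OF \<mu>] mF) (auto simp: PS_def J_def)
    qed
    also have "\<dots> = ennreal (real N * (real N - 1)) * E0"
      using PS assms(5) by (simp add: of_nat_diff ennreal_of_nat_eq_real_of_nat)
    finally have avg: "(\<integral>\<^sup>+x. (\<Sum>p\<in>PS. F (x (fst p)) (x (snd p))) \<partial>PiM J (\<lambda>_. \<mu>)) = ennreal (real N * (real N - 1)) * E0" .
    \<comment> \<open>The total shift over all ordered pairs of distinct indices, minus the bound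
      for the sum of the logarithms.\<close>
    define R where "R = real N * (real N - 1) * C - 2 * real N * ln (real N * M)"
    have low: "ennreal R \<le> (\<Sum>p\<in>PS. F (x (fst p)) (x (snd p)))" if x: "x \<in> space (PiM J (\<lambda>_. \<mu>))" for x
    proof -
      have xK: "x i \<in> K" if "i \<in> J" for i
        using x that borel_prob_measuresD(3)[OF \<mu>] by (auto simp: space_PiM PiE_def)
      show ?thesis
      proof (cases "inj_on x J")
        case True
        have Fp: "F (x (fst p)) (x (snd p)) = ennreal (C - ln (norm (x (fst p) - x (snd p))))"
          and nn: "C - ln (norm (x (fst p) - x (snd p))) \<ge> 0" if p: "p \<in> PS" for p
        proof -
          have ne: "x (fst p) \<noteq> x (snd p)" using True p by (auto simp: PS_def inj_on_def)
          then show "F (x (fst p)) (x (snd p)) = ennreal (C - ln (norm (x (fst p) - x (snd p))))"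
            by (simp add: F_def log_kernel_def ln_inverse e2ennreal_ereal)
          have "norm (x (fst p) - x (snd p)) \<le> exp C"
            using C(2)[OF order_refl] p xK by (auto simp: PS_def)
          then have "ln (norm (x (fst p) - x (snd p))) \<le> C"
            using ne by (metis ln_exp ln_le_cancel_iff exp_gt_zero zero_less_norm_iff right_minus_eq)
          then show "C - ln (norm (x (fst p) - x (snd p))) \<ge> 0" by simp
        qed
        have ic: "inj_on (\<lambda>i. to_complex (x i)) J"
        proof (rule inj_onI)
          fix i j assume "i \<in> J" "j \<in> J" "to_complex (x i) = to_complex (x j)"
          then have "norm (x i - x j) = 0" using norm_to_complex_diff[of "x i" "x j"] by simp
          then show "i = j" using True \<open>i \<in> J\<close> \<open>j \<in> J\<close> by (auto simp: inj_on_def)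
        qed
        have "(\<Sum>i\<in>J. \<Sum>j\<in>J - {i}. ln (norm (to_complex (x i) - to_complex (x j)))) \<le> 2 * real (card J) * ln (real N * M)"
          using assms(5) ic xK K(2) by (intro sum_log_distances_le[where E=E and P=P, OF P assms(4)]) (auto simp: J_def)
        moreover have "(\<Sum>p\<in>PS. ln (norm (x (fst p) - x (snd p)))) = (\<Sum>i\<in>J. \<Sum>j\<in>J - {i}. ln (norm (x i - x j)))"
          unfolding PS_def by (subst sum.Sigma) (auto simp: J_def case_prod_beta)
        ultimately have "(\<Sum>p\<in>PS. ln (norm (x (fst p) - x (snd p)))) \<le> 2 * real N * ln (real N * M)"
          by (simp add: norm_to_complex_diff J_def)
        then have "R \<le> (\<Sum>p\<in>PS. C - ln (norm (x (fst p) - x (snd p))))"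
          using PS assms(5) by (simp add: R_def sum_subtractf of_nat_diff)
        then show ?thesis using Fp nn by (simp add: sum_ennreal ennreal_leI)
      next
        \<comment> \<open>If two sample points coincide the kernel is infinite there, so the whole
          sum is infinite and the bound is trivial.\<close>
        case False
        then obtain i j where ij: "i \<in> J" "j \<in> J" "i \<noteq> j" "x i = x j" by (auto simp: inj_on_def)
        then have "(i, j) \<in> PS" by (simp add: PS_def)
        moreover have "F (x (fst (i, j))) (x (snd (i, j))) = top" using ij by (simp add: F_def log_kernel_def)
        ultimately have "(\<Sum>p\<in>PS. F (x (fst p)) (x (snd p))) = top"
          using PS(1) sum.remove[of PS "(i, j)" "\<lambda>p. F (x (fst p)) (x (snd p))"] by simp
        then show ?thesis by simp
      qed
    qed
    have "ennreal R = (\<integral>\<^sup>+x. ennreal R \<partial>PiM J (\<lambda>_. \<mu>))" by (simp add: prob_space.emeasure_space_1[OF PJ])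
    also have "\<dots> \<le> ennreal (real N * (real N - 1)) * E0"
      unfolding avg[symmetric] by (intro nn_integral_mono low)
    finally have le: "ennreal R \<le> ennreal (real N * (real N - 1)) * E0" .
    have Np: "real N * (real N - 1) > 0" using assms(5) by simp
    have Nr: "real N * (real N - 1) * r = - (2 * real N * ln (real N * M))"
      using assms(5) by (simp add: r_def)
    have "ereal r \<le> enn2ereal E0 - ereal C"
    proof (cases E0)
      case (real e)
      have "ennreal R \<le> ennreal (real N * (real N - 1) * e)"
        using le real Np by (simp add: ennreal_mult)
      \<comment> \<open>For negative \<open>R\<close> the \<open>ennreal\<close> inequality carries
        no information, but then \<open>R\<close> lies below the nonnegative right side.\<close>
      then have "R \<le> real N * (real N - 1) * e"
        using real Np by (cases "R \<ge> 0") (auto intro: order_trans[of _ 0])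
      then have "real N * (real N - 1) * (C + r) \<le> real N * (real N - 1) * e"
        by (simp only: distrib_left Nr) (simp add: R_def)
      then have "C + r \<le> e" using mult_le_cancel_left_pos[OF Np] by blast
      then show ?thesis using real by (simp add: enn2ereal_ennreal)
    qed (simp add: top_ereal_def)
    then show ?thesis
      using log_energy_shift[OF \<mu> C(1) C(2)[OF order_refl]] by (simp add: E0_def F_def)
  qed
  from log_capacity_leI[OF this] show ?thesis by (simp add: r_def)
qed

text \<open>These are 2 T_n(x/2) with T_n the Chebyshev polynomials: monic for n \<ge> 1 and bounded
  by 2 on [-2, 2], a segment of capacity 1. \<open>pCons 0\<close> is multiplication by x; the value
  2 at index 0 is what the recurrence requires.\<close>

fun cheb :: "nat \<Rightarrow> complex poly" where
  "cheb 0 = [:2:]"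
| "cheb (Suc 0) = [:0, 1:]"
| "cheb (Suc (Suc n)) = pCons 0 (cheb (Suc n)) - cheb n"

text \<open>The shifted index excludes \<open>cheb 0\<close>, whose leading coefficient is 2. The
  last conjunct ensures that the polynomial subtracted in the recurrence does not reach the leading
  coefficient.\<close>

lemma cheb_degree: "degree (cheb (Suc n)) = Suc n \<and> lead_coeff (cheb (Suc n)) = 1 \<and> degree (cheb n) \<le> n"
proof (induction n)
  case (Suc n)
  have ne: "cheb (Suc n) \<noteq> 0" using Suc by auto
  have d: "degree (pCons 0 (cheb (Suc n))) = Suc (Suc n)" using Suc ne by (simp add: degree_pCons_eq)
  have "degree (cheb (Suc (Suc n))) = Suc (Suc n)"
    unfolding cheb.simps diff_conv_add_uminus using Suc d by (subst degree_add_eq_left) auto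
  moreover have "coeff (cheb (Suc (Suc n))) (Suc (Suc n)) = 1"
  proof -
    have "coeff (cheb (Suc n)) (Suc n) = 1" using Suc by metis
    then show ?thesis using Suc by (simp add: coeff_eq_0)
  qed
  ultimately show ?case using Suc by simp
qed simp

lemma cheb_cos: "poly (cheb n) (of_real (2 * cos t)) = of_real (2 * cos (real n * t))"
proof (induction n rule: cheb.induct)
  case (3 n)
  have "2 * cos t * (2 * cos (real (Suc n) * t)) = 2 * cos (real (Suc (Suc n)) * t) + 2 * cos (real n * t)"
    using cos_times_cos[of t "real (Suc n) * t"] by (simp add: algebra_simps)
  then show ?case using 3 by (simp flip: of_real_mult of_real_diff)
qed auto

lemma cheb_bound_segment:
  assumes "\<bar>x\<bar> \<le> 2" shows "norm (poly (cheb n) (of_real x)) \<le> 2"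
proof -
  have "x = 2 * cos (arccos (x / 2))" using assms by (simp add: cos_arccos_abs)
  then have "poly (cheb n) (of_real x) = of_real (2 * cos (real n * arccos (x / 2)))"
    using cheb_cos[of n "arccos (x / 2)"] by simp
  then show ?thesis by (simp add: abs_mult)
qed

definition strip :: "real \<Rightarrow> complex set" where "strip e = {z. \<bar>Re z\<bar> \<le> 2 \<and> \<bar>Im z\<bar> \<le> e}"

text \<open>By uniform continuity on a compact rectangle, moving a short way off the segment changes
  the value by less than 1, so the bound 2 on the segment becomes 3.\<close>

lemma cheb_bound_strip: "\<exists>e>0. \<forall>z\<in>strip e. norm (poly (cheb n) z) \<le> 3"
proof -
  have "uniformly_continuous_on (cbox (Complex (-2) (-1)) (Complex 2 1)) (poly (cheb n))"
    by (intro compact_uniformly_continuous) (auto intro!: continuous_intros)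
  then obtain d where d: "d > 0" "\<And>x y. x \<in> cbox (Complex (-2) (-1)) (Complex 2 1) \<Longrightarrow> y \<in> cbox (Complex (-2) (-1)) (Complex 2 1)
      \<Longrightarrow> dist y x < d \<Longrightarrow> dist (poly (cheb n) y) (poly (cheb n) x) < 1"
    unfolding uniformly_continuous_on_def by (meson zero_less_one)
  have "norm (poly (cheb n) z) \<le> 3" if "z \<in> strip (min 1 (d / 2))" for z
  proof -
    have z: "\<bar>Re z\<bar> \<le> 2" "\<bar>Im z\<bar> \<le> 1" "\<bar>Im z\<bar> \<le> d / 2" using that by (auto simp: strip_def)
    have "dist z (of_real (Re z)) = \<bar>Im z\<bar>" by (simp add: dist_norm cmod_def)
    then have "dist (poly (cheb n) z) (poly (cheb n) (of_real (Re z))) < 1"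
      using z d(1) by (intro d(2)) (auto simp: in_cbox_complex_iff)
    moreover have "norm (poly (cheb n) (of_real (Re z))) \<le> 2" by (rule cheb_bound_segment) (use z in simp)
    ultimately show ?thesis
      using norm_triangle_sub[of "poly (cheb n) z" "poly (cheb n) (of_real (Re z))"] by (simp add: dist_norm)
  qed
  then show ?thesis using d(1) by (intro exI[of _ "min 1 (d / 2)"]) auto
qed

lemma cheb_bound_strip_uniform: "\<exists>e>0. \<forall>k<N. \<forall>z\<in>strip e. norm (poly (cheb k) z) \<le> 3"
proof (induction N)
  case 0 show ?case by (intro exI[of _ 1]) auto
next
  case (Suc N)
  then obtain e where e: "e > 0" "\<forall>k<N. \<forall>z\<in>strip e. norm (poly (cheb k) z) \<le> 3" by blast
  obtain e' where e': "e' > 0" "\<forall>z\<in>strip e'. norm (poly (cheb N) z) \<le> 3" using cheb_bound_strip by blast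
  have "strip (min e e') \<subseteq> strip e" "strip (min e e') \<subseteq> strip e'" by (auto simp: strip_def)
  then show ?case using e e' by (intro exI[of _ "min e e'"]) (auto simp: less_Suc_eq)
qed

text \<open>The bound comes from \<open>256\<close> points and polynomials bounded by \<open>3\<close>, so \<open>768 = 256 * 3\<close>.\<close>

lemma log_capacity_thin:
  "\<exists>e>0. \<forall>K :: plane set. (\<forall>x\<in>K. \<bar>x $ 1\<bar> \<le> 2 \<and> \<bar>x $ 2\<bar> \<le> e) \<longrightarrow> log_capacity K \<le> exp (2 * ln 768 / 255)"
proof -
  obtain e where e: "e > 0" "\<forall>k<256. \<forall>z\<in>strip e. norm (poly (cheb k) z) \<le> 3"
    using cheb_bound_strip_uniform by blast
  have "log_capacity K \<le> exp (2 * ln 768 / 255)" if K: "\<forall>x\<in>K. \<bar>x $ 1\<bar> \<le> 2 \<and> \<bar>x $ 2\<bar> \<le> e" for K :: "plane set"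
  proof -
    have "bounded K"
    proof (rule boundedI)
      fix x assume "x \<in> K"
      then show "norm x \<le> 2 + e" using K norm_le_l1_cart[of x] by (fastforce simp: sum_2)
    qed
    moreover have "to_complex ` K \<subseteq> strip e" using K by (auto simp: to_complex_def strip_def)
    \<comment> \<open>Degree 0 is served by the constant 1, since \<open>cheb 0\<close> is not
      monic.\<close>
    moreover have "degree (if k = 0 then 1 else cheb k) = k \<and> lead_coeff (if k = 0 then 1 else cheb k) = 1
        \<and> (\<forall>x\<in>strip e. norm (poly (if k = 0 then 1 else cheb k) x) \<le> 3)" if "k < 256" for k
      using that e(2) cheb_degree[of "k - 1"] by (cases k) auto
    ultimately have "log_capacity K \<le> exp (2 * ln (real 256 * 3) / (real 256 - 1))"
      by (intro log_capacity_le_polynomials) auto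
    then show ?thesis by simp
  qed
  then show ?thesis using e(1) by blast
qed

section \<open>Torsional rigidity of the disc\<close>

text \<open>Derivatives of these functions stay in the span of the family with larger
  \<open>m\<close>, which gives smoothness across 0. The factor exp(-e/t) tends to 1 as
  \<open>e\<close> tends to 0, so smoothing with small \<open>e\<close> costs little.\<close>

definition flat_exp :: "real \<Rightarrow> nat \<Rightarrow> real \<Rightarrow> real" where
  "flat_exp e m t = (if t > 0 then (inverse t) ^ m * exp (- e * inverse t) else 0)"

lemma flat_exp_div_tendsto_0:
  fixes e :: real
  assumes "e > 0" shows "((\<lambda>t. (inverse t) ^ m * exp (- e * inverse t)) \<longlongrightarrow> 0) (at_right 0)"
proof -
  have "((\<lambda>x. x ^ m / exp x) \<longlongrightarrow> (0::real)) at_top" by (rule tendsto_power_div_exp_0)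
  moreover have "filterlim (\<lambda>t. e * inverse t) at_top (at_right 0)"
    by (rule filterlim_tendsto_pos_mult_at_top[OF tendsto_const assms]) (rule filterlim_inverse_at_top_right)
  ultimately have "((\<lambda>t. (e * inverse t) ^ m / exp (e * inverse t)) \<longlongrightarrow> 0) (at_right 0)"
    by (rule filterlim_compose)
  from tendsto_mult_left[OF this, of "1 / e ^ m"]
  have "((\<lambda>t. (1 / e ^ m) * ((e * inverse t) ^ m / exp (e * inverse t))) \<longlongrightarrow> 0) (at_right 0)" by simp
  moreover have "(1 / e ^ m) * ((e * inverse t) ^ m / exp (e * inverse t)) = (inverse t) ^ m * exp (- e * inverse t)" for t
    using assms by (simp add: power_mult_distrib exp_minus field_simps)
  ultimately show ?thesis by simp
qed

text \<open>For t > 0 this is the product rule. At 0 the difference quotient from the right is the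
  member of the family with exponent m + 1, which tends to 0.\<close>

lemma DERIV_flat_exp:
  assumes "e > 0"
  shows "(flat_exp e m has_real_derivative (- real m * flat_exp e (Suc m) t + e * flat_exp e (Suc (Suc m)) t)) (at t)"
proof (cases "t > 0")
  case True
  have "((\<lambda>t. (inverse t) ^ m) has_real_derivative (- real m * inverse t ^ Suc m)) (at t)"
  proof (rule DERIV_cong[OF DERIV_power[OF DERIV_inverse]])
    show "real m * (- (inverse t ^ Suc (Suc 0)) * inverse t ^ (m - Suc 0)) = - real m * inverse t ^ Suc m"
      by (cases m) (auto simp: algebra_simps)
  qed (use True in simp)
  moreover have "((\<lambda>t. exp (- e * inverse t)) has_real_derivative (e * (inverse t)\<^sup>2 * exp (- e * inverse t))) (at t)"
    using True by (auto intro!: derivative_eq_intros simp: power2_eq_square)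
  ultimately have "((\<lambda>t. (inverse t) ^ m * exp (- e * inverse t)) has_real_derivative
     (- real m * flat_exp e (Suc m) t + e * flat_exp e (Suc (Suc m)) t)) (at t)"
    by (rule DERIV_cong[OF DERIV_mult]) (use True in \<open>simp add: flat_exp_def power2_eq_square algebra_simps\<close>)
  then show ?thesis
    by (rule has_field_derivative_transform_within_open[where S="{0<..}"]) (use True in \<open>auto simp: flat_exp_def\<close>)
next
  case False
  show ?thesis
  proof (cases "t = 0")
    case True
    have "((\<lambda>h. flat_exp e m h / h) \<longlongrightarrow> 0) (at 0)"
    proof (rule filterlim_split_at)
      show "((\<lambda>h. flat_exp e m h / h) \<longlongrightarrow> 0) (at_left 0)"
        by (rule tendsto_eventually) (auto simp: flat_exp_def eventually_at_filter)
      have "((\<lambda>h. (inverse h) ^ Suc m * exp (- e * inverse h)) \<longlongrightarrow> 0) (at_right 0)"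
        by (rule flat_exp_div_tendsto_0[OF assms])
      then show "((\<lambda>h. flat_exp e m h / h) \<longlongrightarrow> 0) (at_right 0)"
        by (rule Lim_transform_eventually) (auto simp: flat_exp_def eventually_at_filter field_simps)
    qed
    then show ?thesis using True by (simp add: DERIV_def flat_exp_def[of e "Suc _" 0] flat_exp_def[of e m 0])
  next
    case neg: False
    have "((\<lambda>t. 0) has_real_derivative 0) (at t)" by simp
    then have "(flat_exp e m has_real_derivative 0) (at t)"
      by (rule has_field_derivative_transform_within_open[where S="{..<0}"]) (use False neg in \<open>auto simp: flat_exp_def\<close>)
    then show ?thesis using False by (simp add: flat_exp_def[of e "Suc _" t])
  qed
qed

text \<open>On the disc of radius \<open>r\<close> about 0 this is four times its torsion
  function.\<close>

definition bump_arg :: "real \<Rightarrow> plane \<Rightarrow> real" where "bump_arg r x = r\<^sup>2 - (norm x)\<^sup>2"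

lemma bump_arg_eq: "bump_arg r x = r\<^sup>2 + (-1) * (x $ 1 * x $ 1 + x $ 2 * x $ 2)"
  by (simp add: bump_arg_def power2_norm_eq_inner inner_vec_def sum_2)

lemma smooth_bump_arg: "smooth (bump_arg r)"
  unfolding bump_arg_eq[abs_def] by (intro smooth_add smooth_mult smooth_const smooth_nth)

lemma bump_arg_derivative: "(bump_arg r has_derivative (\<lambda>h. ((-2) *\<^sub>R x) \<bullet> h)) (at x)"
  unfolding bump_arg_def[abs_def] power2_norm_eq_inner
  by (auto intro!: derivative_eq_intros simp: inner_commute)

lemma DERIV_comp_bump_arg:
  assumes "\<And>t. (\<eta> has_real_derivative \<eta>' t) (at t)"
  shows "((\<lambda>x. \<eta> (bump_arg r x)) has_derivative (\<lambda>h. (\<eta>' (bump_arg r x) *\<^sub>R (-2) *\<^sub>R x) \<bullet> h)) (at x)"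
proof -
  have "(\<eta> has_derivative (\<lambda>k. k * \<eta>' (bump_arg r x))) (at (bump_arg r x))"
    using assms[of "bump_arg r x"] by (simp add: has_field_derivative_def mult.commute[of _ "\<eta>' _"])
  from diff_chain_at[OF bump_arg_derivative this] show ?thesis
    by (simp add: o_def algebra_simps)
qed

text \<open>Differentiation raises the exponent \<open>m\<close>, so the induction over the order of
  smoothness treats all \<open>m\<close> at once.\<close>

lemma smooth_flat_exp_bump:
  assumes "e > 0" shows "smooth (\<lambda>x. flat_exp e m (bump_arg r x))"
proof -
  have d: "((\<lambda>x. flat_exp e m (bump_arg r x)) has_derivative
    (\<lambda>h. ((- real m * flat_exp e (Suc m) (bump_arg r x) + e * flat_exp e (Suc (Suc m)) (bump_arg r x)) *\<^sub>R (-2) *\<^sub>R x) \<bullet> h)) (at x)" for m x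
    by (rule DERIV_comp_bump_arg) (rule DERIV_flat_exp[OF assms])
  have "C_k k (\<lambda>x. flat_exp e m (bump_arg r x))" for k
  proof (induction k arbitrary: m)
    case 0
    have "isCont (\<lambda>x. flat_exp e m (bump_arg r x)) x" for x
      using d has_derivative_continuous by blast
    then show ?case by (simp add: continuous_at_imp_continuous_on)
  next
    case (Suc k)
    have "grad (\<lambda>x. flat_exp e m (bump_arg r x)) x $ i =
      (- real m * flat_exp e (Suc m) (bump_arg r x) + e * flat_exp e (Suc (Suc m)) (bump_arg r x)) * ((-2) * x $ i)" for x i
      by (simp add: grad_eqI[OF d])
    moreover have "C_k k (\<lambda>x. x $ i)" for i using smooth_nth[of i] by (simp add: smooth_def)
    moreover have "(\<lambda>x. flat_exp e m (bump_arg r x)) differentiable_on UNIV"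
      using d by (auto simp: differentiable_on_def differentiable_def)
    ultimately show ?case
      using Suc by (simp only: C_k.simps) (intro conjI allI C_k_mult C_k_add C_k_const, auto)
  qed
  then show ?thesis by (simp add: smooth_def)
qed

text \<open>The torsion function s/4 of the disc of radius \<open>r\<close>, with s = r^2 - |x|^2,
  damped by exp(-e/s) so that it is smooth across the circle. Taking r < 1 keeps its support inside
  the open unit disc.\<close>

definition ball_test :: "real \<Rightarrow> real \<Rightarrow> plane \<Rightarrow> real" where
  "ball_test e r x = (1/4) * (bump_arg r x * flat_exp e 0 (bump_arg r x))"

lemma bump_arg_pos_iff: "r > 0 \<Longrightarrow> bump_arg r x > 0 \<longleftrightarrow> x \<in> ball 0 r"
  by (auto simp: bump_arg_def intro: power_strict_mono dest: power_less_imp_less_base)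

lemma ball_test_test_function:
  assumes "e > 0" "0 < r" "r < 1" shows "ball_test e r \<in> test_functions (ball 0 1)"
proof (rule test_functionsI[where K="cball 0 r"])
  show "smooth (ball_test e r)" unfolding ball_test_def[abs_def]
    by (intro smooth_mult smooth_const smooth_bump_arg smooth_flat_exp_bump assms)
  show "ball_test e r x = 0" if "x \<notin> cball 0 r" for x
    using that bump_arg_pos_iff[OF assms(2), of x] by (auto simp: ball_test_def flat_exp_def)
qed (use assms in auto)

text \<open>By exp(-y) \<ge> 1 - y with y = e/s, damping lowers s by at most e.\<close>

lemma ball_test_ge:
  assumes "e > 0" "0 < r" shows "ball_test e r x \<ge> (bump_arg r x - e) / 4 * indicator (ball 0 r) x"
proof (cases "x \<in> ball 0 r")
  case True
  define s where "s = bump_arg r x"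
  have s: "s > 0" using True bump_arg_pos_iff[OF assms(2)] by (simp add: s_def)
  have "s * (1 + (- e * inverse s)) \<le> s * exp (- e * inverse s)"
    using s exp_ge_add_one_self[of "- e * inverse s"] by (intro mult_left_mono) auto
  then have "s - e \<le> s * exp (- e * inverse s)" using s by (simp add: algebra_simps)
  then show ?thesis using True s by (simp add: ball_test_def flat_exp_def s_def[symmetric])
next
  case False
  then show ?thesis using bump_arg_pos_iff[OF assms(2), of x] by (auto simp: ball_test_def flat_exp_def)
qed

text \<open>Since (1 + y) exp(-y) \<le> 1 for y = e/s, the derivative of s exp(-e/s) lies between 0
  and 1, so damping does not enlarge the gradient.\<close>

lemma ball_test_grad_le:
  assumes "e > 0" "0 < r"
  shows "(norm (grad (ball_test e r) x))\<^sup>2 \<le> (norm x)\<^sup>2 / 4 * indicator (ball 0 r) x"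
proof -
  define \<eta>' where "\<eta>' t = (1/4) * (flat_exp e 0 t + t * (e * flat_exp e 2 t))" for t
  have "((\<lambda>t. (1/4) * (t * flat_exp e 0 t)) has_real_derivative \<eta>' t) (at t)" for t
    using DERIV_flat_exp[OF assms(1), of 0 t]
    by (auto intro!: derivative_eq_intros simp: \<eta>'_def numeral_2_eq_2)
  from DERIV_comp_bump_arg[OF this] have g: "grad (ball_test e r) x = \<eta>' (bump_arg r x) *\<^sub>R (-2) *\<^sub>R x"
    unfolding ball_test_def[abs_def] by (rule grad_eqI)
  have le: "\<bar>\<eta>' t\<bar> \<le> 1/4" for t
  proof (cases "t > 0")
    case True
    have "flat_exp e 0 t + t * (e * flat_exp e 2 t) = (1 + e * inverse t) * exp (- (e * inverse t))"
      using True by (simp add: flat_exp_def power2_eq_square algebra_simps)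
    also have "\<dots> \<le> exp (e * inverse t) * exp (- (e * inverse t))"
      by (intro mult_right_mono exp_ge_add_one_self) auto
    also have "\<dots> = 1" by (simp flip: exp_add)
    finally have "flat_exp e 0 t + t * (e * flat_exp e 2 t) \<le> 1" .
    moreover have "0 \<le> flat_exp e 0 t + t * (e * flat_exp e 2 t)" using True assms by (simp add: flat_exp_def)
    ultimately show ?thesis by (simp add: \<eta>'_def)
  qed (simp add: \<eta>'_def flat_exp_def)
  show ?thesis
  proof (cases "x \<in> ball 0 r")
    case True
    have "norm (grad (ball_test e r) x) \<le> norm x / 2"
      using mult_right_mono[OF le[of "bump_arg r x"], of "2 * norm x"] by (simp add: g)
    then have "(norm (grad (ball_test e r) x))\<^sup>2 \<le> (norm x / 2)\<^sup>2" by (intro power_mono) auto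
    then show ?thesis using True by (simp add: power_divide)
  next
    case False
    then show ?thesis using bump_arg_pos_iff[OF assms(2), of x] by (auto simp: g \<eta>'_def flat_exp_def)
  qed
qed

section \<open>The second moment of the disc and its torsional rigidity\<close>

definition ball_moment :: "real \<Rightarrow> real" where
  "ball_moment r = (LINT x|lborel. (norm (x::plane))\<^sup>2 * indicator (ball 0 r) x)"

lemma ball_moment_measurable: "(\<lambda>x::plane. (norm x)\<^sup>2 * indicator (ball 0 r) x :: real) \<in> borel_measurable borel"
proof -
  have [measurable]: "ball (0::plane) r \<in> sets borel" by (intro borel_open open_ball)
  show ?thesis by (intro borel_measurable_times borel_measurable_power borel_measurable_norm borel_measurable_indicator) auto
qed

lemma integrable_ball_moment: "integrable lborel (\<lambda>x::plane. (norm x)\<^sup>2 * indicator (ball 0 r) x)"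
proof (rule Bochner_Integration.integrable_bound)
  show "integrable lborel (\<lambda>x::plane. r\<^sup>2 * indicator (ball 0 r) x)"
    using emeasure_lborel_ball_finite[of "0::plane" r] by (intro integrable_mult_right integrable_real_indicator) auto
  show "AE x::plane in lborel. norm ((norm x)\<^sup>2 * indicat_real (ball 0 r) x) \<le> norm (r\<^sup>2 * indicat_real (ball 0 r) x)"
    by (auto simp: indicator_def intro!: AE_I2 power_mono)
qed (use ball_moment_measurable in simp)

lemma measure_ball_plane: "r \<ge> 0 \<Longrightarrow> measure lborel (ball (0::plane) r) = pi * r\<^sup>2"
  using content_ball[of r "0::plane"] unit_ball_vol_2 by simp

lemma ball_moment_scale:
  assumes "r > 0" shows "ball_moment r = r ^ 4 * ball_moment 1"
proof -
  have "ball_moment r = r\<^sup>2 * (LINT x|lborel. (norm (r *\<^sub>R (x::plane)))\<^sup>2 * indicator (ball 0 r) (r *\<^sub>R x))"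
    unfolding ball_moment_def by (rule similarity_integral[OF similarity_scale[OF assms] ball_moment_measurable])
  also have "(\<lambda>x::plane. (norm (r *\<^sub>R x))\<^sup>2 * indicat_real (ball 0 r) (r *\<^sub>R x)) = (\<lambda>x. r\<^sup>2 * ((norm x)\<^sup>2 * indicator (ball 0 1) x))"
    using assms by (auto simp: indicator_def fun_eq_iff power_mult_distrib)
  finally show ?thesis by (simp add: ball_moment_def power4_eq_xxxx power2_eq_square)
qed

text \<open>Comparing the discs of radius \<open>1\<close> and \<open>q\<close>: the second moment scales by \<open>q\<^sup>4\<close>, and on
  the annulus between them it is at most the area.\<close>

lemma ball_moment_le: "ball_moment 1 \<le> pi / 2"
proof -
  have "ball_moment 1 * (1 + q\<^sup>2) \<le> pi" if q: "0 < q" "q < 1" for q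
  proof -
    have "ball_moment 1 - ball_moment q = (LINT x|lborel. (norm (x::plane))\<^sup>2 * indicator (ball 0 1) x - (norm x)\<^sup>2 * indicator (ball 0 q) x)"
      unfolding ball_moment_def using integrable_ball_moment by (intro Bochner_Integration.integral_diff[symmetric])
    also have "\<dots> \<le> (LINT x|lborel. indicator (ball 0 1) x - indicator (ball (0::plane) q) x)"
    proof (rule integral_mono)
      show "integrable lborel (\<lambda>x. indicat_real (ball 0 1) x - indicat_real (ball (0::plane) q) x)"
        using emeasure_lborel_ball_finite[of "0::plane"] by (intro Bochner_Integration.integrable_diff integrable_real_indicator) auto
      fix x :: plane
      show "(norm x)\<^sup>2 * indicat_real (ball 0 1) x - (norm x)\<^sup>2 * indicat_real (ball 0 q) x \<le> indicat_real (ball 0 1) x - indicat_real (ball 0 q) x"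
        using q by (auto simp: indicator_def power_le_one)
    qed (intro Bochner_Integration.integrable_diff integrable_ball_moment)
    also have "\<dots> = pi - pi * q\<^sup>2"
      using emeasure_lborel_ball_finite[of "0::plane"] measure_ball_plane[of 1] measure_ball_plane[of q] q
      by (subst Bochner_Integration.integral_diff) auto
    finally have "ball_moment 1 * (1 - q ^ 4) \<le> pi * (1 - q\<^sup>2)"
      using ball_moment_scale[OF q(1)] by (simp add: algebra_simps)
    moreover have "1 - q ^ 4 = (1 + q\<^sup>2) * (1 - q\<^sup>2)" by (simp add: algebra_simps power4_eq_xxxx power2_eq_square)
    ultimately have "(ball_moment 1 * (1 + q\<^sup>2)) * (1 - q\<^sup>2) \<le> pi * (1 - q\<^sup>2)" by (simp add: mult.assoc)
    moreover have "1 - q\<^sup>2 > 0" using q by (simp add: power_less_one_iff)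
    ultimately show ?thesis by (rule mult_right_le_imp_le)
  qed
  note le = this
  \<comment> \<open>Let q tend to 1; the resulting bound \<pi>/2 is the exact second moment.\<close>
  have "(\<lambda>n. ball_moment 1 * (1 + (1 - 1 / real (n + 2))\<^sup>2)) \<longlonglongrightarrow> ball_moment 1 * (1 + 1\<^sup>2)"
    by (intro tendsto_intros) real_asymp
  then have "ball_moment 1 * (1 + 1\<^sup>2) \<le> pi"
    by (rule LIMSEQ_le_const2) (intro exI[of _ 0] allI impI le, auto simp: field_simps)
  then show ?thesis by simp
qed

text \<open>As the damping tends to 0 and r to 1, the lower bound for the energy tends to 2(\<pi>/4
  - m/4) - m/4 with second moment m \<le> \<pi>/2, which is at least \<pi>/8.\<close>

lemma torsional_rigidity_disc: "torsional_rigidity (ball 0 1) \<ge> pi / 8"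
proof -
  have le: "torsional_rigidity (ball 0 1) \<ge> pi * r ^ 4 / 8 - e * pi * r\<^sup>2 / 2" if "e > 0" "0 < r" "r < 1" for e r
  proof -
    let ?I = "indicat_real (ball (0::plane) r)"
    note tf = ball_test_test_function[OF that]
    have ii: "integrable lborel ?I" using emeasure_lborel_ball_finite[of "0::plane" r] by simp
    have int1: "integrable lborel (\<lambda>x. (bump_arg r x - e) / 4 * ?I x)"
      and val1: "(LINT x|lborel. (bump_arg r x - e) / 4 * ?I x) = (r\<^sup>2 - e) / 4 * (pi * r\<^sup>2) - ball_moment r / 4"
    proof -
      have eq: "(bump_arg r x - e) / 4 * ?I x = (r\<^sup>2 - e) / 4 * ?I x - (1/4) * ((norm x)\<^sup>2 * ?I x)" for x
        by (simp add: bump_arg_def algebra_simps diff_divide_distrib)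
      show "integrable lborel (\<lambda>x. (bump_arg r x - e) / 4 * ?I x)" unfolding eq
        by (intro Bochner_Integration.integrable_diff integrable_mult_right ii integrable_ball_moment)
      have "(LINT x|lborel. (r\<^sup>2 - e) / 4 * ?I x - (1/4) * ((norm x)\<^sup>2 * ?I x)) =
        (LINT x|lborel. (r\<^sup>2 - e) / 4 * ?I x) - (LINT x|lborel. (1/4) * ((norm x)\<^sup>2 * ?I x))"
        by (intro Bochner_Integration.integral_diff integrable_mult_right ii integrable_ball_moment)
      also have "\<dots> = (r\<^sup>2 - e) / 4 * (pi * r\<^sup>2) - ball_moment r / 4"
        using measure_ball_plane[of r] that by (simp add: ball_moment_def)
      finally show "(LINT x|lborel. (bump_arg r x - e) / 4 * ?I x) = (r\<^sup>2 - e) / 4 * (pi * r\<^sup>2) - ball_moment r / 4"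
        unfolding eq .
    qed
    have "(r\<^sup>2 - e) / 4 * (pi * r\<^sup>2) - ball_moment r / 4 \<le> (LINT x|lborel. ball_test e r x)"
      unfolding val1[symmetric] by (intro integral_mono int1 integrable_test_function[OF tf] ball_test_ge that)
    moreover have "(LINT x|lborel. (norm (grad (ball_test e r) x))\<^sup>2) \<le> ball_moment r / 4"
    proof -
      have "(LINT x|lborel. (norm (grad (ball_test e r) x))\<^sup>2) \<le> (LINT x|lborel. (1/4) * ((norm (x::plane))\<^sup>2 * ?I x))"
        using ball_test_grad_le[OF that(1,2)]
        by (intro integral_mono integrable_grad_sq[OF tf] integrable_mult_right integrable_ball_moment) simp
      then show ?thesis by (simp add: ball_moment_def)
    qed
    moreover have "ball_moment r \<le> r ^ 4 * (pi / 2)"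
      unfolding ball_moment_scale[OF that(2)] using ball_moment_le that by (intro mult_left_mono) auto
    moreover have "torsion_energy (ball_test e r) \<le> torsional_rigidity (ball 0 1)"
      by (intro torsion_energy_le_rigidity tf) auto
    ultimately show ?thesis
      unfolding torsion_energy_def by (simp add: algebra_simps power4_eq_xxxx power2_eq_square)
  qed
  \<comment> \<open>Both parameters move together: e = 1/(n + 2) and r = 1 - e.\<close>
  have "(\<lambda>n. pi * (1 - 1 / real (n + 2)) ^ 4 / 8 - (1 / real (n + 2)) * pi * (1 - 1 / real (n + 2))\<^sup>2 / 2)
      \<longlonglongrightarrow> pi / 8"
    by real_asymp
  then show ?thesis
    by (rule LIMSEQ_le_const2) (intro exI[of _ 0] allI impI le, auto simp: field_simps)
qed

section \<open>A reverse Hoelder inequality for concave functions\<close>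

lemma concave_indicator_measurable:
  fixes h :: "real \<Rightarrow> real"
  assumes "concave_on {a<..<b} h"
  shows "(\<lambda>x. indicator {a<..<b} x * h x) \<in> borel_measurable borel"
proof -
  have "continuous_on {a<..<b} (\<lambda>x. - (- h x))"
    using assms by (intro continuous_on_minus convex_on_continuous) (auto simp: concave_on_def)
  then show ?thesis
    using borel_measurable_continuous_on_indicator[of "{a<..<b}" h] by simp
qed

lemma superlevel_borel:
  fixes h :: "real \<Rightarrow> real"
  assumes "concave_on {a<..<b} h"
  shows "{x\<in>{a<..<b}. h x \<ge> t} \<in> sets borel"
proof -
  note [measurable] = concave_indicator_measurable[OF assms]
  have "{x\<in>{a<..<b}. h x \<ge> t} = {x \<in> space borel. x \<in> {a<..<b} \<and> indicator {a<..<b} x * h x \<ge> t}" by auto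
  also have "\<dots> \<in> sets borel" by measurable
  finally show ?thesis .
qed

text \<open>Convexity of the superlevel sets: \<open>{h \<ge> \<lambda> t}\<close> contains a convex combination of the whole
  interval with \<open>{h \<ge> t}\<close>.\<close>

lemma superlevel_measure_concave:
  fixes h :: "real \<Rightarrow> real"
  assumes "a < b" and conc: "concave_on {a<..<b} h" and nn: "\<And>x. x \<in> {a<..<b} \<Longrightarrow> h x \<ge> 0"
    and ne: "\<exists>x\<in>{a<..<b}. h x \<ge> t" and l: "0 \<le> l" "l \<le> 1"
  shows "measure lborel {x\<in>{a<..<b}. h x \<ge> l * t} \<ge> (1 - l) * (b - a) + l * measure lborel {x\<in>{a<..<b}. h x \<ge> t}"
proof -
  define I where "I s = {x\<in>{a<..<b}. h x \<ge> s}" for s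
  have cv: "convex (I s)" for s
  proof (rule convexI)
    fix x y u v :: real assume x: "x \<in> I s" and y: "y \<in> I s" and uv: "0 \<le> u" "0 \<le> v" "u + v = 1"
    have xy: "x \<in> {a<..<b}" "y \<in> {a<..<b}" "h x \<ge> s" "h y \<ge> s" using x y by (auto simp: I_def)
    have u: "u = 1 - v" using uv by simp
    have "s = u * s + v * s" using uv by (simp flip: distrib_right)
    also have "\<dots> \<le> u * h x + v * h y" using xy uv by (intro add_mono mult_left_mono) auto
    also have "\<dots> \<le> h (u *\<^sub>R x + v *\<^sub>R y)"
      using concave_onD[OF conc uv(2) _ xy(1,2)] uv unfolding u by simp
    finally have "h (u *\<^sub>R x + v *\<^sub>R y) \<ge> s" .
    moreover have "u *\<^sub>R x + v *\<^sub>R y \<in> {a<..<b}" using convexD[OF convex_real_interval(8) xy(1,2) uv] by simp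
    ultimately show "u *\<^sub>R x + v *\<^sub>R y \<in> I s" by (simp add: I_def)
  qed
  have Ib: "I s \<subseteq> {a..b}" for s by (auto simp: I_def)
  have Im: "I s \<in> sets borel" for s unfolding I_def by (rule superlevel_borel[OF conc])
  have fin: "emeasure lborel (I s) < \<infinity>" for s
    using le_less_trans[OF emeasure_mono[OF Ib[of s], of lborel]] \<open>a < b\<close> by simp
  show ?thesis unfolding I_def[symmetric]
  proof (rule field_le_epsilon)
    fix e :: real assume "e > 0"
    \<comment> \<open>The ends of the interval are excluded, and the infimum and supremum of the
      superlevel set need not be attained. All four are approximated within \<open>d\<close>, with a
      total loss of 2d.\<close>
    define d where "d = min (e / 4) ((b - a) / 4)"
    have "d \<le> e / 4" "d \<le> (b - a) / 4" unfolding d_def by (rule min.cobounded1, rule min.cobounded2)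
    moreover have "d > 0" using \<open>e > 0\<close> \<open>a < b\<close> by (simp add: d_def)
    ultimately have d: "d > 0" "d \<le> e / 4" "d \<le> (b - a) / 4" by auto
    have I: "I t \<noteq> {}" "bdd_below (I t)" "bdd_above (I t)"
      using ne bdd_below_mono[OF bdd_below_Icc Ib[of t]] bdd_above_mono[OF bdd_above_Icc Ib[of t]]
      unfolding I_def by blast+
    obtain y1 where y1: "y1 \<in> I t" "y1 < Inf (I t) + d"
      using cInf_lessD[OF I(1), of "Inf (I t) + d"] d by auto
    obtain y2 where y2: "y2 \<in> I t" "y2 > Sup (I t) - d"
      using less_cSupD[OF I(1), of "Sup (I t) - d"] d by auto
    have "I t \<subseteq> {Inf (I t)..Sup (I t)}" using I by (auto intro: cInf_lower cSup_upper)
    then have "measure lborel (I t) \<le> measure lborel {Inf (I t)..Sup (I t)}"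
      using Im by (intro measure_mono_fmeasurable) (auto simp: fmeasurable_def emeasure_lborel_Icc_eq)
    also have "\<dots> = Sup (I t) - Inf (I t)"
      using cInf_lower[OF y1(1) I(2)] cSup_upper[OF y1(1) I(3)] by simp
    finally have mt: "measure lborel (I t) \<le> y2 - y1 + 2 * d" using y1 y2 by simp
    define w1 where "w1 = (1 - l) * (a + d) + l * y1"
    define w2 where "w2 = (1 - l) * (b - d) + l * y2"
    have w: "(1 - l) * x + l * y \<in> I (l * t)" if x: "x \<in> {a<..<b}" and y: "y \<in> I t" for x y
    proof -
      have y': "y \<in> {a<..<b}" "h y \<ge> t" using y by (auto simp: I_def)
      have "(1 - l) * x + l * y \<in> {a<..<b}"
        using convexD[OF convex_real_interval(8)[of a b] x y'(1), of "1 - l" l] l by simp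
      moreover have "h ((1 - l) * x + l * y) \<ge> (1 - l) * h x + l * h y"
        using concave_onD[OF conc l x y'(1)] by simp
      moreover have "(1 - l) * h x \<ge> 0" using nn[OF x] l by simp
      moreover have "l * h y \<ge> l * t" using y' l by (intro mult_left_mono) auto
      ultimately show ?thesis by (auto simp: I_def)
    qed
    have "w1 \<in> I (l * t)" unfolding w1_def using d \<open>a < b\<close> y1 by (intro w) auto
    moreover have "w2 \<in> I (l * t)" unfolding w2_def using d \<open>a < b\<close> y2 by (intro w) auto
    ultimately have "{w1..w2} \<subseteq> I (l * t)"
      using cv[of "l * t"] by (auto simp: convex_contains_segment closed_segment_eq_real_ivl split: if_splits)
        (meson atLeastAtMost_iff order_trans subset_eq)
    then have "measure lborel {w1..w2} \<le> measure lborel (I (l * t))"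
      using Im fin by (intro measure_mono_fmeasurable) (auto simp: fmeasurable_def)
    then have 1: "w2 - w1 \<le> measure lborel (I (l * t))"
      by (cases "w1 \<le> w2") (auto intro: order_trans[OF _ measure_nonneg])
    have "w2 - w1 = (1 - l) * (b - a) + l * (y2 - y1) - (1 - l) * (2 * d)"
      by (simp add: w1_def w2_def algebra_simps)
    moreover have "l * measure lborel (I t) \<le> l * (y2 - y1 + 2 * d)" using mt l by (intro mult_left_mono) auto
    moreover have "l * (y2 - y1 + 2 * d) = l * (y2 - y1) + l * (2 * d)" "(1 - l) * (2 * d) + l * (2 * d) = 2 * d"
      by (simp_all add: algebra_simps)
    ultimately show "(1 - l) * (b - a) + l * measure lborel (I t) \<le> measure lborel (I (l * t)) + e"
      using 1 d by linarith
  qed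
qed

text \<open>For concave \<open>h\<close> with supremum \<open>M\<close>, the distribution function \<open>m\<close> is concave. The
  derivative of \<open>q(s) = s\<^sup>3 - (3/2) M\<^sup>2 s + M\<^sup>3/2\<close> changes sign at \<open>M/\<surd>2\<close>, so replacing \<open>m\<close> by its
  chord through \<open>0\<close> and \<open>M/\<surd>2\<close> increases \<open>\<integral>q' m\<close>; for an affine function this integral is explicit.\<close>

lemma cubic_layer_cake_le:
  fixes h :: "real \<Rightarrow> real"
  assumes "a < b" and conc: "concave_on {a<..<b} h" and pos: "\<And>x. x \<in> {a<..<b} \<Longrightarrow> h x > 0"
    and M: "M > 0" "\<And>x. x \<in> {a<..<b} \<Longrightarrow> h x \<le> M" "\<And>t. t < M \<Longrightarrow> \<exists>x\<in>{a<..<b}. h x \<ge> t"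
  shows "(LINT x|lborel. indicator {a<..<b} x * ((h x)^3 - 3/2 * M\<^sup>2 * h x + M^3/2)) \<le> 0"
proof -
  define J where "J = {a<..<b}"
  define q' where "q' t = 3 * t\<^sup>2 - 3/2 * M\<^sup>2" for t
  define m where "m t = measure lborel {x\<in>J. h x \<ge> t}" for t
  \<comment> \<open>Layer cake: integrating over t gives q(h(x)) - q(0) on J, and integrating over x
    gives q'(t) times the distribution function.\<close>
  define f where "f x t = (if x \<in> J \<and> 0 \<le> t \<and> t \<le> h x then q' t else 0)" for x t
  have contq': "isCont q' t" for t unfolding q'_def by (intro continuous_intros)
  have hm: "(\<lambda>x. indicator J x * h x) \<in> borel_measurable borel"
    unfolding J_def by (rule concave_indicator_measurable[OF conc])
  define g where "g x = indicator J x * h x" for x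
  have [measurable]: "g \<in> borel_measurable borel" using hm by (simp add: g_def[abs_def])
  have [measurable]: "J \<in> sets borel" by (simp add: J_def)
  have [measurable]: "q' \<in> borel_measurable borel" unfolding q'_def by measurable
  have f_eq: "f x t = indicator J x * indicator {0..} t * indicator {..0} (t - g x) * q' t" for x t
    by (auto simp: f_def g_def indicator_def)
  have fm: "case_prod f \<in> borel_measurable (lborel \<Otimes>\<^sub>M lborel)"
    unfolding f_eq[abs_def] case_prod_beta by measurable
  have fint: "integrable (lborel \<Otimes>\<^sub>M lborel) (case_prod f)"
  proof (rule Bochner_Integration.integrable_bound)
    have "emeasure (lborel \<Otimes>\<^sub>M lborel) (J \<times> {0..M}) = emeasure lborel J * emeasure lborel {0..M}"
      by (rule lborel.emeasure_pair_measure_Times) auto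
    also have "\<dots> < \<infinity>" using \<open>a < b\<close> M(1) by (simp add: J_def ennreal_mult_less_top)
    finally show "integrable (lborel \<Otimes>\<^sub>M lborel) (\<lambda>z. (3 * M\<^sup>2) * indicator (J \<times> {0..M}) z :: real)"
      by (intro integrable_mult_right integrable_real_indicator) auto
    show "AE z in lborel \<Otimes>\<^sub>M lborel. norm (case_prod f z) \<le> norm (3 * M\<^sup>2 * indicat_real (J \<times> {0..M}) z)"
    proof (intro AE_I2)
      fix z :: "real \<times> real"
      obtain x t where z: "z = (x, t)" by (cases z)
      show "norm (case_prod f z) \<le> norm (3 * M\<^sup>2 * indicat_real (J \<times> {0..M}) z)"
      proof (cases "x \<in> J \<and> 0 \<le> t \<and> t \<le> h x")
        case True
        then have "t \<le> M" using M(2)[of x] by (auto simp: J_def)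
        then have "t\<^sup>2 \<le> M\<^sup>2" using True by (intro power_mono) auto
        then have "\<bar>q' t\<bar> \<le> 3 * M\<^sup>2" unfolding q'_def using zero_le_power2[of t] by linarith
        then show ?thesis using True \<open>t \<le> M\<close> by (simp add: z f_def)
      qed (auto simp: z f_def)
    qed
  qed (rule fm)
  have inner_t: "(LINT t|lborel. f x t) = (h x)^3 - 3/2 * M\<^sup>2 * h x" if x: "x \<in> J" for x
  proof -
    have hx: "h x \<ge> 0" using pos x by (auto simp: J_def intro: less_imp_le)
    have "(LINT t|lborel. f x t) = (LINT t|lborel. q' t * indicator {0..h x} t)"
      using x by (auto intro!: Bochner_Integration.integral_cong simp: f_def indicator_def)
    also have "\<dots> = ((h x)^3 - 3/2 * M\<^sup>2 * h x) - (0^3 - 3/2 * M\<^sup>2 * 0)"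
      by (rule integral_FTC_Icc_real[OF hx])
         (auto intro!: derivative_eq_intros contq' simp: q'_def)
    finally show ?thesis by simp
  qed
  have inner_x: "(LINT x|lborel. f x t) = q' t * (indicator {0..M} t * m t)" for t
  proof -
    have "{x \<in> J. h x \<ge> t} = {} \<or> t \<le> M" using M(2) by (force simp: J_def)
    then have M': "m t = 0 \<or> t \<le> M" unfolding m_def by (metis measure_empty)
    have "{x \<in> J. h x \<ge> t} \<in> sets borel" unfolding J_def by (rule superlevel_borel[OF conc])
    then have "(LINT x|lborel. (q' t * indicator {0..} t) * indicator {x \<in> J. h x \<ge> t} x) = q' t * indicator {0..} t * m t"
      by (simp add: m_def)
    moreover have "(LINT x|lborel. f x t) = (LINT x|lborel. (q' t * indicator {0..} t) * indicator {x \<in> J. h x \<ge> t} x)"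
      by (intro Bochner_Integration.integral_cong refl) (auto simp: f_def indicator_def)
    ultimately have "(LINT x|lborel. f x t) = q' t * indicator {0..} t * m t" by (rule trans[rotated])
    then show ?thesis using M' by (auto simp: indicator_def)
  qed
  have mint: "integrable lborel (\<lambda>t. q' t * (indicator {0..M} t * m t))"
    using lborel_pair.integrable_snd[OF fint] by (simp add: inner_x)
  have fub: "(LINT x|lborel. LINT t|lborel. f x t) = (LINT t|lborel. LINT x|lborel. f x t)"
    using lborel_pair.Fubini_integral[OF fint] by simp
  have c_int: "integrable lborel (\<lambda>x. indicator J x * (M^3/2))"
    using \<open>a < b\<close> by (intro integrable_mult_left integrable_real_indicator) (auto simp: J_def)
  have o_int: "integrable lborel (\<lambda>x. LINT t|lborel. f x t)" using lborel_pair.integrable_fst[OF fint] by simp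
  have "(LINT x|lborel. indicator J x * ((h x)^3 - 3/2 * M\<^sup>2 * h x + M^3/2)) =
     (LINT x|lborel. (LINT t|lborel. f x t) + indicator J x * (M^3/2))"
  proof (intro Bochner_Integration.integral_cong refl)
    fix x show "indicator J x * ((h x)^3 - 3/2 * M\<^sup>2 * h x + M^3/2) = (LINT t|lborel. f x t) + indicator J x * (M^3/2)"
    proof (cases "x \<in> J")
      case True then show ?thesis by (simp add: inner_t)
    next
      case False then show ?thesis by (simp add: f_def)
    qed
  qed
  also have "\<dots> = (LINT t|lborel. q' t * (indicator {0..M} t * m t)) + (b - a) * (M^3/2)"
    using \<open>a < b\<close> o_int c_int by (subst Bochner_Integration.integral_add) (auto simp: fub inner_x J_def)
  also have "(LINT t|lborel. q' t * (indicator {0..M} t * m t)) \<le> - ((b - a) * (M^3/2))"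
  proof -
    define ts where "ts = M / sqrt 2"
    have ts: "ts > 0" "ts < M" "ts\<^sup>2 = M\<^sup>2 / 2" using M(1) by (auto simp: ts_def power_divide field_simps)
    define s where "s = ((b - a) - m ts) / ts"
    define l where "l t = (b - a) - s * t" for t
    \<comment> \<open>Concavity of \<open>m\<close> along chords issuing from 0, where its value is
      b - a.\<close>
    have conv: "m t \<ge> (1 - t / t') * (b - a) + t / t' * m t'" if "0 \<le> t" "t \<le> t'" "0 < t'" "t' < M" for t t'
      using superlevel_measure_concave[OF \<open>a < b\<close> conc less_imp_le[OF pos] M(3)[OF that(4)], of "t / t'"] that
      by (simp add: m_def J_def)
    have pt: "q' t * m t \<le> q' t * l t" if t: "0 \<le> t" "t < M" for t
    proof (cases "t \<le> ts")
      case True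
      have "t\<^sup>2 \<le> ts\<^sup>2" using True t by (intro power_mono) auto
      then have "q' t \<le> 0" using ts(3) by (simp add: q'_def)
      moreover have "m t \<ge> l t"
        using conv[OF t(1) True ts(1,2)] ts(1) by (simp add: l_def s_def field_simps)
      ultimately show ?thesis by (rule mult_left_mono_neg[rotated])
    next
      case False
      have "ts\<^sup>2 \<le> t\<^sup>2" using False ts by (intro power_mono) auto
      then have "q' t \<ge> 0" using ts(3) by (simp add: q'_def)
      moreover have "m t \<le> l t"
      proof -
        have "m ts \<ge> (1 - ts / t) * (b - a) + ts / t * m t" using False ts t by (intro conv) auto
        then have "t * m ts \<ge> t * ((1 - ts / t) * (b - a) + ts / t * m t)" using t by (intro mult_left_mono) auto
        also have "t * ((1 - ts / t) * (b - a) + ts / t * m t) = (t - ts) * (b - a) + ts * m t"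
          using False ts t by (simp add: field_simps)
        finally show ?thesis using ts by (simp add: l_def s_def field_simps)
      qed
      ultimately show ?thesis by (rule mult_left_mono[rotated])
    qed
    have cont: "isCont (\<lambda>t. q' t * l t) t" for t unfolding q'_def l_def by (intro continuous_intros)
    have "(LINT t|lborel. q' t * (indicator {0..M} t * m t)) \<le> (LINT t|lborel. q' t * l t * indicator {0..M} t)"
    proof (rule integral_mono_AE[OF mint])
      show "integrable lborel (\<lambda>t. q' t * l t * indicator {0..M} t)"
        using borel_integrable_atLeastAtMost[of 0 M "\<lambda>t. q' t * l t"] cont by simp
      \<comment> \<open>The pointwise comparison stops short of t = M, where the superlevel set may
        be empty; a single point is negligible.\<close>
      show "AE t in lborel. q' t * (indicator {0..M} t * m t) \<le> q' t * l t * indicator {0..M} t"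
        using AE_lborel_singleton[of M] by eventually_elim (use pt in \<open>auto simp: indicator_def\<close>)
    qed
    \<comment> \<open>The coefficient 3/2 makes \<integral> t q'(t) dt over [0, M] vanish, so the
      slope \<open>s\<close> of the chord drops out.\<close>
    also have "\<dots> = ((b - a) * (M^3 - 3/2 * M\<^sup>2 * M) - s * (3/4 * M^4 - 3/4 * M\<^sup>2 * M\<^sup>2)) -
        ((b - a) * (0^3 - 3/2 * M\<^sup>2 * 0) - s * (3/4 * 0^4 - 3/4 * M\<^sup>2 * 0\<^sup>2))"
      by (rule integral_FTC_Icc_real)
         (use M(1) cont in \<open>auto intro!: derivative_eq_intros simp: q'_def l_def power2_eq_square power3_eq_cube field_simps\<close>)
    also have "\<dots> = - ((b - a) * (M^3/2))" by (simp add: power2_eq_square power3_eq_cube power4_eq_xxxx algebra_simps)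
    finally show ?thesis .
  qed
  finally show ?thesis by (simp add: J_def)
qed

text \<open>The layer-cake argument bounds the integral of h^3 by (3/2) M^2 A - (1/2) M^3 L, with A
  the integral of h and L = b - a. Over all M \<ge> 0 this is largest at M = 2A/L, with value 2
  A^3/L^2. A linear h vanishing at one end gives equality.\<close>

lemma berwald_cubic:
  fixes h :: "real \<Rightarrow> real"
  assumes "a < b" and conc: "concave_on {a<..<b} h" and pos: "\<And>x. x \<in> {a<..<b} \<Longrightarrow> h x > 0"
    and bd: "\<And>x. x \<in> {a<..<b} \<Longrightarrow> h x \<le> B"
  shows "(LINT x|lborel. indicator {a<..<b} x * (h x)^3) \<le> 2 * (LINT x|lborel. indicator {a<..<b} x * h x) ^ 3 / (b - a)\<^sup>2"
proof -
  define J where "J = {a<..<b}"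
  define M where "M = Sup (h ` J)"
  have Jne: "J \<noteq> {}" using \<open>a < b\<close> by (simp add: J_def)
  have bdd: "bdd_above (h ` J)" unfolding J_def by (rule bdd_aboveI2) (rule bd)
  have le: "h x \<le> M" if "x \<in> J" for x unfolding M_def using that bdd by (intro cSup_upper) auto
  have Mpos: "M > 0" using le[of "(a + b) / 2"] pos[of "(a + b) / 2"] \<open>a < b\<close> by (auto simp: J_def)
  have ex: "\<exists>x\<in>J. h x \<ge> t" if "t < M" for t
    using less_cSupD[of "h ` J" t] Jne that by (auto simp: M_def intro: less_imp_le)
  have hm: "(\<lambda>x. indicator J x * h x) \<in> borel_measurable borel"
    unfolding J_def by (rule concave_indicator_measurable[OF conc])
  have int: "integrable lborel (\<lambda>x. indicator J x * (h x)^n)" if "n > 0" for n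
  proof (rule Bochner_Integration.integrable_bound)
    show "integrable lborel (\<lambda>x. M ^ n * indicator J x)"
      using \<open>a < b\<close> by (intro integrable_mult_right integrable_real_indicator) (auto simp: J_def)
    have "(\<lambda>x. (indicator J x * h x)^n) \<in> borel_measurable borel" using hm by measurable
    moreover have "(\<lambda>x. (indicator J x * h x)^n) = (\<lambda>x. indicator J x * (h x)^n)"
      using that by (auto simp: indicator_def fun_eq_iff)
    ultimately show "(\<lambda>x. indicator J x * (h x)^n) \<in> borel_measurable lborel" by simp
    show "AE x in lborel. norm (indicator J x * (h x)^n) \<le> norm (M ^ n * indicator J x)"
      using le pos Mpos by (intro AE_I2) (auto simp: indicator_def J_def less_imp_le intro!: power_mono)
  qed
  define A where "A = (LINT x|lborel. indicator J x * h x)"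
  define C where "C = (LINT x|lborel. indicator J x * (h x)^3)"
  have "(LINT x|lborel. indicator J x * ((h x)^3 - 3/2 * M\<^sup>2 * h x + M^3/2)) \<le> 0"
    unfolding J_def by (rule cubic_layer_cake_le) (use assms Mpos le ex in \<open>auto simp: J_def\<close>)
  also have "(LINT x|lborel. indicator J x * ((h x)^3 - 3/2 * M\<^sup>2 * h x + M^3/2)) =
    (LINT x|lborel. indicator J x * (h x)^3 - (3/2 * M\<^sup>2) * (indicator J x * h x) + (M^3/2) * indicator J x)"
    by (intro Bochner_Integration.integral_cong refl) (simp add: algebra_simps)
  also have "\<dots> = C - (3/2 * M\<^sup>2) * A + (M^3/2) * (b - a)"
  proof -
    have i3: "integrable lborel (\<lambda>x. (M^3/2) * indicator J x)"
      using \<open>a < b\<close> by (intro integrable_mult_right integrable_real_indicator) (auto simp: J_def)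
    show ?thesis
      using int[of 3] int[of 1] i3 \<open>a < b\<close> by (simp add: C_def A_def J_def)
  qed
  finally have C: "C \<le> (3/2 * M\<^sup>2) * A - (M^3/2) * (b - a)" by simp
  define L where "L = b - a"
  have L: "L > 0" using \<open>a < b\<close> by (simp add: L_def)
  have A: "A \<ge> 0" unfolding A_def using pos by (intro integral_nonneg_AE AE_I2) (auto simp: indicator_def J_def less_imp_le)
  have "L\<^sup>2 * C \<le> L\<^sup>2 * ((3/2 * M\<^sup>2) * A - (M^3/2) * L)" using C by (intro mult_left_mono) (auto simp: L_def)
  \<comment> \<open>The subtracted term is nonnegative and vanishes at the critical value M L =
    2A.\<close>
  also have "\<dots> = 2 * A ^ 3 - (1/2) * (A + M * L) * (2 * A - M * L)\<^sup>2"
    by (simp add: power2_eq_square power3_eq_cube field_simps)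
  also have "\<dots> \<le> 2 * A ^ 3" using A Mpos L by simp
  finally show ?thesis using L by (simp add: C_def A_def J_def L_def field_simps)
qed

section \<open>Torsional rigidity and slices\<close>

definition vec2 :: "real \<Rightarrow> real \<Rightarrow> plane" where "vec2 x y = vector [x, y]"

lemma vec2_nth [simp]: "vec2 x y $ 1 = x" "vec2 x y $ 2 = y"
  by (simp_all add: vec2_def)

lemma vec2_eta [simp]: "vec2 (z $ 1) (z $ 2) = z"
  by (simp add: vec_eq_iff forall_2)

lemma vec2_combine: "u *\<^sub>R vec2 x y + v *\<^sub>R vec2 x' y' = vec2 (u * x + v * x') (u * y + v * y')"
  by (simp add: vec_eq_iff forall_2)

lemma continuous_vec2 [continuous_intros]:
  "continuous_on A f \<Longrightarrow> continuous_on A g \<Longrightarrow> continuous_on A (\<lambda>x. vec2 (f x) (g x))"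
proof -
  assume fg: "continuous_on A f" "continuous_on A g"
  have "continuous_on A (\<lambda>x. if i = 1 then f x else g x)" for i :: 2
    by (cases "i = 1") (use fg in simp_all)
  then have "continuous_on A (\<lambda>x. \<chi> i::2. if i = 1 then f x else g x)"
    by (intro continuous_on_vec_lambda)
  moreover have "(\<chi> i::2. if i = 1 then f x else g x) = vec2 (f x) (g x)" for x
    by (simp add: vec_eq_iff forall_2)
  ultimately show ?thesis by simp
qed

section \<open>Fubini's theorem in the plane\<close>

lemma vec2_measurable: "(\<lambda>z. vec2 (fst z) (snd z)) \<in> borel_measurable (lborel \<Otimes>\<^sub>M lborel)"
proof -
  have "(\<lambda>z. vec2 (fst z) (snd z)) \<in> borel_measurable borel"
    by (intro borel_measurable_continuous_onI continuous_intros)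
  then show ?thesis unfolding lborel_prod by simp
qed

text \<open>The two measures agree on boxes, which correspond to rectangles. This makes iterated
  integrals available for the vector type \<open>plane\<close>.\<close>

lemma distr_lborel_vec2: "distr (lborel \<Otimes>\<^sub>M lborel) borel (\<lambda>z. vec2 (fst z) (snd z)) = lborel"
proof (rule lborel_eqI[symmetric])
  fix l u :: plane assume lu: "\<And>b. b \<in> Basis \<Longrightarrow> l \<bullet> b \<le> u \<bullet> b"
  have lu': "l $ i \<le> u $ i" for i using lu[of "axis i 1"] by (simp add: inner_axis axis_in_Basis_iff)
  have "emeasure (distr (lborel \<Otimes>\<^sub>M lborel) borel (\<lambda>z. vec2 (fst z) (snd z))) (box l u) =
    emeasure (lborel \<Otimes>\<^sub>M lborel) ((\<lambda>z. vec2 (fst z) (snd z)) -` box l u \<inter> space (lborel \<Otimes>\<^sub>M lborel))"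
    by (rule emeasure_distr[OF vec2_measurable]) simp
  also have "(\<lambda>z. vec2 (fst z) (snd z)) -` box l u \<inter> space (lborel \<Otimes>\<^sub>M lborel) = {l $ 1<..<u $ 1} \<times> {l $ 2<..<u $ 2}"
    by (auto simp: mem_box_cart forall_2 space_pair_measure)
  also have "emeasure (lborel \<Otimes>\<^sub>M lborel) \<dots> = emeasure lborel {l $ 1<..<u $ 1} * emeasure lborel {l $ 2<..<u $ 2}"
    by (rule lborel.emeasure_pair_measure_Times) auto
  also have "\<dots> = ennreal ((u $ 1 - l $ 1) * (u $ 2 - l $ 2))"
    using lu' by (simp add: ennreal_mult)
  also have "(u $ 1 - l $ 1) * (u $ 2 - l $ 2) = (\<Prod>b\<in>Basis. (u - l) \<bullet> b)"
  proof -
    have "Basis = (\<lambda>i. axis i 1 :: plane) ` UNIV" by (auto simp: Basis_vec_def)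
    then have "(\<Prod>b\<in>Basis. (u - l) \<bullet> b) = (\<Prod>b\<in>(\<lambda>i. axis i 1 :: plane) ` UNIV. (u - l) \<bullet> b)" by simp
    also have "\<dots> = (\<Prod>i\<in>UNIV. (u - l) \<bullet> axis i 1)"
      by (subst prod.reindex) (auto simp: inj_on_def axis_eq_axis)
    finally have "(\<Prod>b\<in>Basis. (u - l) \<bullet> b) = (\<Prod>i\<in>UNIV. (u - l) \<bullet> axis i 1)" .
    then show ?thesis by (simp add: UNIV_2 inner_axis)
  qed
  finally show "emeasure (distr (lborel \<Otimes>\<^sub>M lborel) borel (\<lambda>z. vec2 (fst z) (snd z))) (box l u) = (\<Prod>b\<in>Basis. (u - l) \<bullet> b)" .
qed simp

lemma plane_Fubini:
  fixes F :: "plane \<Rightarrow> real"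
  assumes F: "integrable lborel F"
  shows "(LINT z|lborel. F z) = (LINT x|lborel. LINT y|lborel. F (vec2 x y))"
    and "integrable lborel (\<lambda>x. LINT y|lborel. F (vec2 x y))"
proof -
  have m: "F \<in> borel_measurable borel" using F by auto
  have i: "integrable (lborel \<Otimes>\<^sub>M lborel) (\<lambda>z. F (vec2 (fst z) (snd z)))"
    by (rule integrable_distr[OF vec2_measurable]) (use F distr_lborel_vec2 in simp)
  have "(LINT z|lborel. F z) = (LINT z|distr (lborel \<Otimes>\<^sub>M lborel) borel (\<lambda>z. vec2 (fst z) (snd z)). F z)"
    by (simp add: distr_lborel_vec2)
  also have "\<dots> = (LINT z|(lborel \<Otimes>\<^sub>M lborel). F (vec2 (fst z) (snd z)))"
    by (rule integral_distr[OF vec2_measurable m])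
  also have "\<dots> = (LINT x|lborel. LINT y|lborel. F (vec2 x y))"
    using lborel_pair.integral_fst'[OF i] by simp
  finally show "(LINT z|lborel. F z) = (LINT x|lborel. LINT y|lborel. F (vec2 x y))" .
  show "integrable lborel (\<lambda>x. LINT y|lborel. F (vec2 x y))"
    using lborel_pair.integrable_fst'[OF i] by simp
qed

lemma open_convex_bounded_real:
  fixes S :: "real set"
  assumes "open S" "convex S" "bounded S" "S \<noteq> {}"
  shows "S = {Inf S<..<Sup S}" "Inf S < Sup S"
proof -
  have b: "bdd_below S" "bdd_above S" using assms(3) by (auto simp: bounded_imp_bdd_below bounded_imp_bdd_above)
  show eq: "S = {Inf S<..<Sup S}"
  proof
    show "S \<subseteq> {Inf S<..<Sup S}"
    proof
      fix x assume x: "x \<in> S"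
      then obtain e where e: "e > 0" "ball x e \<subseteq> S" using assms(1) by (auto simp: open_contains_ball)
      then have "x - e / 2 \<in> S" "x + e / 2 \<in> S" by (auto simp: dist_real_def intro!: subsetD[OF e(2)])
      then have "Inf S \<le> x - e / 2" "x + e / 2 \<le> Sup S" using b by (auto intro: cInf_lower cSup_upper)
      then show "x \<in> {Inf S<..<Sup S}" using e(1) by auto
    qed
    show "{Inf S<..<Sup S} \<subseteq> S"
    proof
      fix x assume x: "x \<in> {Inf S<..<Sup S}"
      obtain y where y: "y \<in> S" "y < x" using cInf_lessD[of S x] x assms(4) by auto
      obtain z where z: "z \<in> S" "x < z" using less_cSupD[of S x] x assms(4) by auto
      have "closed_segment y z \<subseteq> S" using assms(2) y z by (simp add: convex_contains_segment)
      then show "x \<in> S" using y z by (auto simp: closed_segment_eq_real_ivl)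
    qed
  qed
  show "Inf S < Sup S"
  proof (rule ccontr)
    assume "\<not> Inf S < Sup S"
    then have "{Inf S<..<Sup S} = {}" by simp
    from trans[OF eq this] assms(4) show False by contradiction
  qed
qed

section \<open>Vertical slices of open convex sets\<close>

definition slice :: "plane set \<Rightarrow> real \<Rightarrow> real set" where "slice \<Omega> x = {y. vec2 x y \<in> \<Omega>}"

lemma slice_open: "open \<Omega> \<Longrightarrow> open (slice \<Omega> x)"
  unfolding slice_def vimage_def[symmetric] by (intro open_vimage continuous_intros) auto

lemma slice_convex_combination:
  assumes "convex \<Omega>" "y \<in> slice \<Omega> x" "y' \<in> slice \<Omega> x'" "0 \<le> u" "0 \<le> v" "u + v = 1"
  shows "u * y + v * y' \<in> slice \<Omega> (u * x + v * x')"
  using convexD[OF assms(1) assms(2)[unfolded slice_def, simplified] assms(3)[unfolded slice_def, simplified] assms(4-6)]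
  by (simp add: slice_def vec2_combine)

lemma slice_convex: "convex \<Omega> \<Longrightarrow> convex (slice \<Omega> x)"
proof (rule convexI)
  fix y y' u v :: real assume "convex \<Omega>" "y \<in> slice \<Omega> x" "y' \<in> slice \<Omega> x" "0 \<le> u" "0 \<le> v" "u + v = 1"
  from slice_convex_combination[OF this] show "u *\<^sub>R y + v *\<^sub>R y' \<in> slice \<Omega> x"
    using \<open>u + v = 1\<close> by (simp flip: distrib_right)
qed

lemma slice_bounded:
  assumes "\<forall>z\<in>\<Omega>. norm z \<le> R" "y \<in> slice \<Omega> x" shows "\<bar>y\<bar> \<le> R"
  using bspec[OF assms(1), of "vec2 x y"] assms(2) component_le_norm_cart[of "vec2 x y" 2] by (simp add: slice_def)

definition slice_length :: "plane set \<Rightarrow> real \<Rightarrow> real" where "slice_length \<Omega> x = Sup (slice \<Omega> x) - Inf (slice \<Omega> x)"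

lemma slice_length_le:
  assumes R: "\<forall>z\<in>\<Omega>. norm z \<le> R" and ne: "slice \<Omega> x \<noteq> {}"
  shows "slice_length \<Omega> x \<le> 2 * R"
proof -
  have "Sup (slice \<Omega> x) \<le> R"
    by (rule cSup_least[OF ne]) (rule order_trans[OF abs_ge_self slice_bounded[OF R]])
  moreover have "- R \<le> Inf (slice \<Omega> x)"
  proof (rule cInf_greatest[OF ne])
    fix y assume "y \<in> slice \<Omega> x"
    then have "\<bar>y\<bar> \<le> R" by (rule slice_bounded[OF R])
    then show "- R \<le> y" by simp
  qed
  ultimately show ?thesis by (simp add: slice_length_def)
qed

context
  fixes \<Omega> :: "plane set"
  assumes adm: "admissible \<Omega>"
begin

lemma slice_eq_interval:
  assumes "slice \<Omega> x \<noteq> {}"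
  shows "slice \<Omega> x = {Inf (slice \<Omega> x)<..<Sup (slice \<Omega> x)}" "Inf (slice \<Omega> x) < Sup (slice \<Omega> x)"
proof -
  obtain R where R: "\<forall>z\<in>\<Omega>. norm z \<le> R" using adm by (auto simp: admissible_def bounded_iff)
  have b: "bounded (slice \<Omega> x)" by (rule boundedI[of _ R]) (simp add: slice_bounded[OF R])
  have oc: "open (slice \<Omega> x)" "convex (slice \<Omega> x)"
    using adm by (auto simp: admissible_def intro: slice_open slice_convex)
  show "slice \<Omega> x = {Inf (slice \<Omega> x)<..<Sup (slice \<Omega> x)}" "Inf (slice \<Omega> x) < Sup (slice \<Omega> x)"
    by (rule open_convex_bounded_real[OF oc b assms])+
qed

text \<open>The abscissae with nonempty slice form the projection of \<Omega> to the first axis,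
  which is open, convex and bounded.\<close>

lemma projection_interval:
  obtains a b where "a < b" "\<And>x. slice \<Omega> x \<noteq> {} \<longleftrightarrow> x \<in> {a<..<b}"
proof -
  define P where "P = (\<lambda>z::plane. z $ 1) ` \<Omega>"
  have P: "P = (\<Union>y. {x. vec2 x y \<in> \<Omega>})"
  proof (intro set_eqI iffI)
    fix x assume "x \<in> P"
    then obtain z :: plane where "z \<in> \<Omega>" "x = z $ 1" by (auto simp: P_def)
    then have "vec2 x (z $ 2) \<in> \<Omega>" by simp
    then show "x \<in> (\<Union>y. {x. vec2 x y \<in> \<Omega>})" by blast
  next
    fix x assume "x \<in> (\<Union>y. {x. vec2 x y \<in> \<Omega>})"
    then obtain y where y: "vec2 x y \<in> \<Omega>" by blast
    show "x \<in> P" unfolding P_def by (rule image_eqI[OF _ y]) simp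
  qed
  have 1: "open P" unfolding P using adm
    by (intro open_UN ballI) (auto simp: admissible_def vimage_def[symmetric] intro!: open_vimage continuous_intros)
  have 2: "convex P" unfolding P_def using adm
    by (intro convex_linear_image) (auto simp: admissible_def linear_conv_bounded_linear bounded_linear_vec_nth)
  have 3: "bounded P" unfolding P_def using adm
    by (intro bounded_linear_image) (auto simp: admissible_def bounded_linear_vec_nth)
  have 4: "P \<noteq> {}" using adm by (auto simp: P_def admissible_def)
  note * = open_convex_bounded_real[OF 1 2 3 4]
  have "slice \<Omega> x \<noteq> {} \<longleftrightarrow> x \<in> P" for x unfolding P slice_def by blast
  also have "x \<in> P \<longleftrightarrow> x \<in> {Inf P<..<Sup P}" for x by (rule eqset_imp_iff[OF *(1)])
  finally show ?thesis by (rule that[OF *(2)])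
qed

lemma slice_length_measure:
  assumes "slice \<Omega> x \<noteq> {}"
  shows "measure lborel (slice \<Omega> x) = slice_length \<Omega> x" "slice_length \<Omega> x > 0"
  using arg_cong[OF slice_eq_interval(1)[OF assms], of "measure lborel"] slice_eq_interval(2)[OF assms]
  by (simp_all add: slice_length_def)

text \<open>Near-extreme points of the two slices are combined with weights u and v; by convexity
  the results lie in the slice at the combined abscissa. The slack \<open>e\<close> is needed
  because the slices are open and do not attain their ends.\<close>

lemma slice_Sup_Inf_combination:
  assumes ne: "slice \<Omega> x \<noteq> {}" "slice \<Omega> x' \<noteq> {}" and uv: "0 \<le> u" "0 \<le> v" "u + v = 1"
  shows "slice_length \<Omega> (u * x + v * x') \<ge> u * slice_length \<Omega> x + v * slice_length \<Omega> x'"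
proof (rule field_le_epsilon)
  fix e :: real assume "e > 0"
  have cv: "convex \<Omega>" using adm by (simp add: admissible_def)
  define w where "w = u * x + v * x'"
  obtain y1 where y1: "y1 \<in> slice \<Omega> x" "y1 < Inf (slice \<Omega> x) + e / 2"
    using cInf_lessD[OF ne(1), of "Inf (slice \<Omega> x) + e / 2"] \<open>e > 0\<close> by auto
  obtain y2 where y2: "y2 \<in> slice \<Omega> x" "y2 > Sup (slice \<Omega> x) - e / 2"
    using less_cSupD[OF ne(1), of "Sup (slice \<Omega> x) - e / 2"] \<open>e > 0\<close> by auto
  obtain z1 where z1: "z1 \<in> slice \<Omega> x'" "z1 < Inf (slice \<Omega> x') + e / 2"
    using cInf_lessD[OF ne(2), of "Inf (slice \<Omega> x') + e / 2"] \<open>e > 0\<close> by auto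
  obtain z2 where z2: "z2 \<in> slice \<Omega> x'" "z2 > Sup (slice \<Omega> x') - e / 2"
    using less_cSupD[OF ne(2), of "Sup (slice \<Omega> x') - e / 2"] \<open>e > 0\<close> by auto
  have w1: "u * y1 + v * z1 \<in> slice \<Omega> w" and w2: "u * y2 + v * z2 \<in> slice \<Omega> w"
    unfolding w_def using slice_convex_combination[OF cv _ _ uv] y1 y2 z1 z2 by auto
  then have "slice \<Omega> w \<noteq> {}" by auto
  note I = slice_eq_interval[OF this]
  have "Inf (slice \<Omega> w) < u * y1 + v * z1" "u * y2 + v * z2 < Sup (slice \<Omega> w)"
    using subsetD[OF equalityD1[OF I(1)] w1] subsetD[OF equalityD1[OF I(1)] w2] by simp_all
  then have "u * (y2 - y1) + v * (z2 - z1) \<le> slice_length \<Omega> w" by (simp add: slice_length_def algebra_simps)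
  moreover have "u * (slice_length \<Omega> x - e) \<le> u * (y2 - y1)" "v * (slice_length \<Omega> x' - e) \<le> v * (z2 - z1)"
    using y1 y2 z1 z2 uv by (intro mult_left_mono; simp add: slice_length_def)+
  moreover have "u * (slice_length \<Omega> x - e) + v * (slice_length \<Omega> x' - e) = u * slice_length \<Omega> x + v * slice_length \<Omega> x' - e"
  proof -
    have "u * e + v * e = e" using uv(3) by (simp flip: distrib_right)
    then show ?thesis by (simp add: algebra_simps)
  qed
  ultimately show "u * slice_length \<Omega> x + v * slice_length \<Omega> x' \<le> slice_length \<Omega> (u * x + v * x') + e"
    by (simp add: w_def)
qed

lemma slice_length_concave:
  assumes "\<And>x. slice \<Omega> x \<noteq> {} \<longleftrightarrow> x \<in> {a<..<b}"
  shows "concave_on {a<..<b} (slice_length \<Omega>)"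
  unfolding concave_on_iff
proof (intro conjI ballI allI impI)
  fix x y u v :: real assume "x \<in> {a<..<b}" "y \<in> {a<..<b}" "0 \<le> u" "0 \<le> v" "u + v = 1"
  then show "u * slice_length \<Omega> x + v * slice_length \<Omega> y \<le> slice_length \<Omega> (u *\<^sub>R x + v *\<^sub>R y)"
    using slice_Sup_Inf_combination[of x y u v] assms by simp
qed (rule convex_real_interval)

text \<open>With \<open>c\<close> the midpoint of the slice and \<open>f\<close> vanishing at its ends,
  \<open>2 f - f'\<^sup>2 \<le> 2 ((y - c) f)' + (y - c)\<^sup>2\<close>, and the derivative term integrates to \<open>0\<close>.\<close>

lemma slice_energy_le:
  assumes \<phi>: "\<phi> \<in> test_functions \<Omega>" and ne: "slice \<Omega> x \<noteq> {}"
  shows "(LINT y|lborel. 2 * \<phi> (vec2 x y) - (grad \<phi> (vec2 x y) $ 2)\<^sup>2) \<le> (slice_length \<Omega> x) ^ 3 / 12"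
proof -
  define a where "a = Inf (slice \<Omega> x)"
  define b where "b = Sup (slice \<Omega> x)"
  define c where "c = (a + b) / 2"
  have ab: "a < b" "slice \<Omega> x = {a<..<b}" unfolding a_def b_def by (rule slice_eq_interval[OF ne])+
  define f where "f y = \<phi> (vec2 x y)" for y
  define f' where "f' y = grad \<phi> (vec2 x y) $ 2" for y
  have D: "(f has_real_derivative f' y) (at y)" for y
  proof -
    have 1: "((\<lambda>y. vec2 x y) has_derivative (\<lambda>h. h *\<^sub>R axis 2 1)) (at y)"
    proof -
      have eq: "vec2 x = (\<lambda>y. vec2 x 0 + y *\<^sub>R axis 2 1)"
        by (rule ext) (simp add: vec_eq_iff forall_2 axis_def)
      show ?thesis by (subst eq) (auto intro!: derivative_eq_intros)
    qed
    have 2: "(\<phi> has_derivative (\<lambda>h. grad \<phi> (vec2 x y) \<bullet> h)) (at (vec2 x y))"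
      by (rule has_derivative_grad[OF test_functions_differentiable[OF \<phi>]])
    show ?thesis
      unfolding f_def[abs_def] f'_def
      by (rule has_derivative_imp_has_field_derivative[OF diff_chain_at[OF 1 2, unfolded o_def]])
         (simp add: inner_axis)
  qed
  have cf: "isCont f y" for y using D by (rule DERIV_isCont)
  have "continuous_on UNIV (\<lambda>y. vec2 x y)" by (intro continuous_vec2 continuous_on_const continuous_on_id)
  then have "continuous_on UNIV f'" unfolding f'_def[abs_def]
    by (rule continuous_on_compose2[OF test_functions_continuous[OF test_functions_grad[OF \<phi>, of 2]]]) simp
  then have cf': "isCont f' y" for y by (simp add: continuous_on_eq_continuous_at)
  have out: "f y = 0" "f' y = 0" if "y \<notin> {a<..<b}" for y
  proof -
    have "y \<notin> slice \<Omega> x" using that ab(2) by (rule ssubst[rotated])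
    then have "vec2 x y \<notin> \<Omega>" by (simp add: slice_def)
    then show "f y = 0" "f' y = 0"
      by (simp_all add: f_def f'_def test_function_zero_outside[OF \<phi>] test_function_grad_zero_outside[OF \<phi>])
  qed
  have "(LINT y|lborel. 2 * f y - (f' y)\<^sup>2) = (LINT y|lborel. (2 * f y - (f' y)\<^sup>2) * indicator {a..b} y)"
  proof (intro Bochner_Integration.integral_cong refl)
    fix y show "2 * f y - (f' y)\<^sup>2 = (2 * f y - (f' y)\<^sup>2) * indicator {a..b} y"
      by (cases "y \<in> {a<..<b}") (simp_all add: out)
  qed
  also have "\<dots> \<le> (LINT y|lborel. (2 * (f y + (y - c) * f' y) + (y - c)\<^sup>2) * indicator {a..b} y)"
  proof (rule integral_mono)
    show "integrable lborel (\<lambda>y. (2 * f y - (f' y)\<^sup>2) * indicator {a..b} y)"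
      using cf cf' by (intro borel_integrable_atLeastAtMost continuous_intros) auto
    show "integrable lborel (\<lambda>y. (2 * (f y + (y - c) * f' y) + (y - c)\<^sup>2) * indicator {a..b} y)"
      using cf cf' by (intro borel_integrable_atLeastAtMost continuous_intros) auto
    fix y
    \<comment> \<open>Equality would mean f' = c - y, the derivative of the one-dimensional torsion
      function (y - a)(b - y)/2.\<close>
    have "0 \<le> (f' y + (y - c))\<^sup>2" by simp
    then have "2 * f y - (f' y)\<^sup>2 \<le> 2 * (f y + (y - c) * f' y) + (y - c)\<^sup>2"
      by (simp add: power2_eq_square algebra_simps)
    then show "(2 * f y - (f' y)\<^sup>2) * indicator {a..b} y \<le> (2 * (f y + (y - c) * f' y) + (y - c)\<^sup>2) * indicator {a..b} y"
      by (rule mult_right_mono) simp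
  qed
  also have "\<dots> = (2 * ((b - c) * f b) + (b - c) ^ 3 / 3) - (2 * ((a - c) * f a) + (a - c) ^ 3 / 3)"
  proof (rule integral_FTC_Icc_real)
    show "a \<le> b" using ab by simp
    show "((\<lambda>y. 2 * ((y - c) * f y) + (y - c) ^ 3 / 3) has_real_derivative
      2 * (f y + (y - c) * f' y) + (y - c)\<^sup>2) (at y)" for y
      by (auto intro!: derivative_eq_intros D)
    show "isCont (\<lambda>y. 2 * (f y + (y - c) * f' y) + (y - c)\<^sup>2) y" for y
      using cf cf' by (intro continuous_intros) auto
  qed
  also have "\<dots> = (b - a) ^ 3 / 12"
    using out(1)[of a] out(1)[of b] by (simp add: c_def power3_eq_cube field_simps)
  finally show ?thesis by (simp add: f_def f'_def slice_length_def a_def b_def)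
qed

text \<open>Dropping the derivative along the first axis can only raise the energy, and what remains
  splits into independent problems on the vertical slices.\<close>

lemma torsional_rigidity_slices:
  assumes P: "a < b" "\<And>x. slice \<Omega> x \<noteq> {} \<longleftrightarrow> x \<in> {a<..<b}"
  shows "torsional_rigidity \<Omega> \<le> (LINT x|lborel. indicator {a<..<b} x * (slice_length \<Omega> x) ^ 3) / 12"
    and "measure lborel \<Omega> = (LINT x|lborel. indicator {a<..<b} x * slice_length \<Omega> x)"
proof -
  have \<Omega>: "open \<Omega>" "bounded \<Omega>" using adm by (auto simp: admissible_def)
  obtain R where R: "\<forall>z\<in>\<Omega>. norm z \<le> R" using adm by (auto simp: admissible_def bounded_iff)
  have "integrable lborel (indicat_real \<Omega>)" using \<Omega> bounded_finite_emeasure[OF \<Omega>(2)] by simp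
  from plane_Fubini(1)[OF this]
  have "measure lborel \<Omega> = (LINT x|lborel. LINT y|lborel. indicator \<Omega> (vec2 x y))" using \<Omega>(1) by simp
  also have "\<dots> = (LINT x|lborel. indicator {a<..<b} x * slice_length \<Omega> x)"
  proof (intro Bochner_Integration.integral_cong refl)
    fix x
    have "(\<lambda>y. indicat_real \<Omega> (vec2 x y)) = indicator (slice \<Omega> x)" by (auto simp: indicator_def slice_def)
    then have "(LINT y|lborel. indicat_real \<Omega> (vec2 x y)) = measure lborel (slice \<Omega> x)"
      using slice_open[OF \<Omega>(1), of x] by simp
    then show "(LINT y|lborel. indicat_real \<Omega> (vec2 x y)) = indicator {a<..<b} x * slice_length \<Omega> x"
      using P(2)[of x] slice_length_measure(1)[of x] by (cases "x \<in> {a<..<b}") auto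
  qed
  finally show "measure lborel \<Omega> = (LINT x|lborel. indicator {a<..<b} x * slice_length \<Omega> x)" .
  have len: "slice_length \<Omega> x \<le> 2 * R" "slice_length \<Omega> x \<ge> 0" if "x \<in> {a<..<b}" for x
  proof -
    have ne: "slice \<Omega> x \<noteq> {}" using that P(2) by blast
    show "slice_length \<Omega> x \<ge> 0" using slice_length_measure(2)[OF ne] by simp
    show "slice_length \<Omega> x \<le> 2 * R" by (rule slice_length_le[OF R ne])
  qed
  have int3: "integrable lborel (\<lambda>x. indicator {a<..<b} x * (slice_length \<Omega> x) ^ 3)"
  proof (rule Bochner_Integration.integrable_bound)
    show "integrable lborel (\<lambda>x. (2 * R) ^ 3 * indicator {a<..<b} x)"
      using P(1) by (intro integrable_mult_right integrable_real_indicator) auto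
    have "(\<lambda>x. (indicator {a<..<b} x * slice_length \<Omega> x) ^ 3) \<in> borel_measurable borel"
      using concave_indicator_measurable[OF slice_length_concave[OF P(2)]] by measurable
    moreover have "(\<lambda>x. (indicator {a<..<b} x * slice_length \<Omega> x) ^ 3) = (\<lambda>x. indicator {a<..<b} x * (slice_length \<Omega> x) ^ 3)"
      by (auto simp: indicator_def fun_eq_iff)
    ultimately show "(\<lambda>x. indicator {a<..<b} x * (slice_length \<Omega> x) ^ 3) \<in> borel_measurable lborel" by simp
    show "AE x in lborel. norm (indicator {a<..<b} x * (slice_length \<Omega> x) ^ 3) \<le> norm ((2 * R) ^ 3 * indicator {a<..<b} x)"
    proof (intro AE_I2)
      fix x
      show "norm (indicator {a<..<b} x * (slice_length \<Omega> x) ^ 3) \<le> norm ((2 * R) ^ 3 * indicator {a<..<b} x)"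
      proof (cases "x \<in> {a<..<b}")
        case True
        have "(slice_length \<Omega> x) ^ 3 \<le> (2 * R) ^ 3" by (rule power_mono[OF len[OF True]])
        moreover have "0 \<le> (slice_length \<Omega> x) ^ 3" using len(2)[OF True] by simp
        ultimately show ?thesis using True by simp
      qed simp
    qed
  qed
  show "torsional_rigidity \<Omega> \<le> (LINT x|lborel. indicator {a<..<b} x * (slice_length \<Omega> x) ^ 3) / 12"
  proof (rule torsional_rigidity_leI[OF \<Omega>])
    fix \<phi> assume \<phi>: "\<phi> \<in> test_functions \<Omega>"
    have i1: "integrable lborel \<phi>" by (rule integrable_test_function[OF \<phi>])
    have i2: "integrable lborel (\<lambda>z. (grad \<phi> z $ 2)\<^sup>2)" by (rule integrable_test_sq[OF test_functions_grad[OF \<phi>]])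
    have "torsion_energy \<phi> \<le> 2 * (LINT z|lborel. \<phi> z) - (LINT z|lborel. (grad \<phi> z $ 2)\<^sup>2)"
    proof -
      have "(grad \<phi> z $ 2)\<^sup>2 \<le> (norm (grad \<phi> z))\<^sup>2" for z
        using power_mono[OF component_le_norm_cart[of "grad \<phi> z" 2], of 2] by simp
      then have "(LINT z|lborel. (grad \<phi> z $ 2)\<^sup>2) \<le> (LINT z|lborel. (norm (grad \<phi> z))\<^sup>2)"
        by (intro integral_mono i2 integrable_grad_sq[OF \<phi>])
      then show ?thesis by (simp add: torsion_energy_def)
    qed
    also have "\<dots> = (LINT z|lborel. 2 * \<phi> z - (grad \<phi> z $ 2)\<^sup>2)" using i1 i2 by simp
    also have "\<dots> = (LINT x|lborel. LINT y|lborel. 2 * \<phi> (vec2 x y) - (grad \<phi> (vec2 x y) $ 2)\<^sup>2)"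
      by (rule plane_Fubini) (use i1 i2 in simp)
    also have "\<dots> \<le> (LINT x|lborel. indicator {a<..<b} x * (slice_length \<Omega> x) ^ 3 / 12)"
    proof (rule integral_mono)
      show "integrable lborel (\<lambda>x. LINT y|lborel. 2 * \<phi> (vec2 x y) - (grad \<phi> (vec2 x y) $ 2)\<^sup>2)"
        by (rule plane_Fubini) (use i1 i2 in simp)
      fix x
      show "(LINT y|lborel. 2 * \<phi> (vec2 x y) - (grad \<phi> (vec2 x y) $ 2)\<^sup>2) \<le> indicator {a<..<b} x * (slice_length \<Omega> x) ^ 3 / 12"
      proof (cases "x \<in> {a<..<b}")
        case True
        then show ?thesis using slice_energy_le[OF \<phi>, of x] P(2) by auto
      next
        case False
        then have "slice \<Omega> x = {}" using P(2) by blast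
        then have "vec2 x y \<notin> \<Omega>" for y by (auto simp: slice_def)
        then show ?thesis using False test_function_zero_outside[OF \<phi>] test_function_grad_zero_outside[OF \<phi>] by simp
      qed
    qed (use int3 in simp)
    finally show "torsion_energy \<phi> \<le> (LINT x|lborel. indicator {a<..<b} x * (slice_length \<Omega> x) ^ 3) / 12" by simp
  qed
qed

text \<open>The slice constant 1/12 times the factor 2 of the reverse Hoelder inequality gives 1/6,
  and the integral of the slice lengths is the area.\<close>

lemma torsional_rigidity_le_width:
  assumes P: "a < b" "\<And>x. slice \<Omega> x \<noteq> {} \<longleftrightarrow> x \<in> {a<..<b}"
  shows "torsional_rigidity \<Omega> \<le> (measure lborel \<Omega>) ^ 3 / (6 * (b - a)\<^sup>2)"
proof -
  obtain R where R: "\<forall>z\<in>\<Omega>. norm z \<le> R" using adm by (auto simp: admissible_def bounded_iff)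
  have "slice_length \<Omega> x > 0" if "x \<in> {a<..<b}" for x
    using that P(2) by (intro slice_length_measure(2)) blast
  moreover have "slice_length \<Omega> x \<le> 2 * R" if "x \<in> {a<..<b}" for x
  proof -
    have ne: "slice \<Omega> x \<noteq> {}" using that P(2) by blast
    show ?thesis by (rule slice_length_le[OF R ne])
  qed
  ultimately have "(LINT x|lborel. indicator {a<..<b} x * (slice_length \<Omega> x)^3) \<le>
    2 * (LINT x|lborel. indicator {a<..<b} x * slice_length \<Omega> x) ^ 3 / (b - a)\<^sup>2"
    by (intro berwald_cubic[OF P(1) slice_length_concave[OF P(2)]])
  then show ?thesis using torsional_rigidity_slices[OF P] by simp
qed

end

section \<open>Capacity of the disc\<close>

text \<open>Cauchy's formula for Ln(1 - cu) on the unit circle returns its value 0 at the centre.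
  The branch is holomorphic because 1 - cu stays in the right half-plane, and its real part is the
  logarithm of the modulus.\<close>

lemma log_mean_value:
  assumes "cmod c < 1"
  shows "((\<lambda>t. ln (cmod (1 - c * cis (2 * pi * t)))) has_integral 0) {0..1}"
proof -
  define f where "f u = Ln (1 - c * u)" for u
  have re: "Re (1 - c * u) > 0" if "cmod u \<le> 1" for u
  proof -
    have "Re (c * u) \<le> cmod c * cmod u" using complex_Re_le_cmod[of "c * u"] by (simp add: norm_mult)
    also have "\<dots> \<le> cmod c" using that by (simp add: mult_left_le)
    finally show ?thesis using assms by simp
  qed
  have "f holomorphic_on cball 0 1"
    unfolding f_def
  proof (intro holomorphic_intros)
    fix u assume "u \<in> cball (0::complex) 1"
    then have "Re (1 - c * u) > 0" by (intro re) simp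
    then show "1 - c * u \<notin> \<real>\<^sub>\<le>\<^sub>0" by (auto simp: complex_nonpos_Reals_iff)
  qed
  then have "((\<lambda>u. f u / (u - 0)) has_contour_integral 2 * of_real pi * \<i> * f 0) (circlepath 0 1)"
    by (rule Cauchy_integral_circlepath_simple) simp
  then have "((\<lambda>u. f u / u) has_contour_integral 0) (circlepath 0 1)" by (simp add: f_def)
  then have "((\<lambda>t. f (circlepath 0 1 t) / circlepath 0 1 t * vector_derivative (circlepath 0 1) (at t within {0..1})) has_integral 0) {0..1}"
    by (simp add: has_contour_integral_def)
  then have "((\<lambda>t. 2 * pi * \<i> * f (cis (2 * pi * t))) has_integral 0) {0..1}"
  proof (rule has_integral_eq[rotated])
    fix t :: real assume t: "t \<in> {0..1}"
    have c: "circlepath 0 1 t = cis (2 * pi * t)" by (simp add: circlepath cis_conv_exp mult_ac)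
    have vd: "vector_derivative (circlepath 0 1) (at t within {0..1}) = 2 * pi * \<i> * cis (2 * pi * t)"
      using t vector_derivative_circlepath01[of t 0 1] by (simp add: cis_conv_exp mult_ac)
    show "f (circlepath 0 1 t) / circlepath 0 1 t * vector_derivative (circlepath 0 1) (at t within {0..1})
        = 2 * pi * \<i> * f (cis (2 * pi * t))"
      unfolding c vd by simp
  qed
  from has_integral_mult_right[OF this, of "1 / (2 * pi * \<i>)"]
  have "((\<lambda>t. f (cis (2 * pi * t))) has_integral 0) {0..1}" by simp
  from has_integral_linear[OF this bounded_linear_Re]
  have "((\<lambda>t. Re (f (cis (2 * pi * t)))) has_integral 0) {0..1}" by (simp add: o_def)
  moreover have "Re (f (cis (2 * pi * t))) = ln (cmod (1 - c * cis (2 * pi * t)))" for t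
  proof -
    have "1 - c * cis (2 * pi * t) \<noteq> 0" using re[of "cis (2 * pi * t)"] by force
    then show ?thesis unfolding f_def by (rule Re_Ln)
  qed
  ultimately show ?thesis by simp
qed

text \<open>As a function of z, w - z has its zero inside the disc when w does, whereas 1 - cnj(w) z
  has none there. The moduli agree on the circle, so the mean value formula applies to the potential
  at w.\<close>

lemma cmod_diff_unit:
  assumes "cmod z = 1" shows "cmod (w - z) = cmod (1 - cnj w * z)"
proof -
  have "cmod (w - z) = cmod (cnj (w - z)) * cmod z" using assms by (simp only: complex_mod_cnj)
  also have "\<dots> = cmod ((cnj w - cnj z) * z)" by (simp add: norm_mult)
  also have "(cnj w - cnj z) * z = cnj w * z - 1"
    using assms complex_norm_square[of z] by (simp add: algebra_simps)
  finally show ?thesis by (simp add: norm_minus_commute)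
qed

text \<open>Distances from \<open>w\<close> to the circle are at most 2, so the shift by ln 2 makes
  the integrand nonnegative; the logarithm itself has mean 0.\<close>

lemma circle_potential_inside:
  assumes "cmod w < 1"
  shows "(\<integral>\<^sup>+t. ennreal ((ln 2 - ln (cmod (w - cis (2 * pi * t)))) * indicator {0..1} t) \<partial>lborel) = ennreal (ln 2)"
proof (rule nn_integral_has_integral_lborel)
  have "cmod (cnj w) < 1" using assms by simp
  from has_integral_diff[OF has_integral_const_real log_mean_value[OF this], of "ln 2"]
  have "((\<lambda>t. ln 2 - ln (cmod (w - cis (2 * pi * t)))) has_integral ln 2) {0..1}"
    by (simp add: cmod_diff_unit)
  then have "((\<lambda>t. if t \<in> {0..1} then ln 2 - ln (cmod (w - cis (2 * pi * t))) else 0) has_integral ln 2) UNIV"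
    by (simp only: has_integral_restrict_UNIV)
  moreover have "(\<lambda>t. if t \<in> {0..1} then ln 2 - ln (cmod (w - cis (2 * pi * t))) else 0) =
    (\<lambda>t. (ln 2 - ln (cmod (w - cis (2 * pi * t)))) * indicator {0..1} t)" by (auto simp: fun_eq_iff)
  ultimately show "((\<lambda>t. (ln 2 - ln (cmod (w - cis (2 * pi * t)))) * indicator {0..1} t) has_integral ln 2) UNIV" by simp
  have "(\<lambda>t. cmod (w - cis (2 * pi * t))) \<in> borel_measurable borel"
    by (intro borel_measurable_continuous_onI continuous_intros)
  then show "(\<lambda>t. (ln 2 - ln (cmod (w - cis (2 * pi * t)))) * indicator {0..1} t) \<in> borel_measurable borel"
    by measurable
  fix t :: real
  have "w \<noteq> cis (2 * pi * t)" using assms by auto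
  moreover have "cmod (w - cis (2 * pi * t)) \<le> 2"
    using norm_triangle_ineq4[of w "cis (2 * pi * t)"] assms by simp
  ultimately have "ln (cmod (w - cis (2 * pi * t))) \<le> ln 2" by (subst ln_le_cancel_iff) auto
  then show "0 \<le> (ln 2 - ln (cmod (w - cis (2 * pi * t)))) * indicator {0..1} t" by simp
qed

section \<open>The uniform measure on the unit circle\<close>

definition circle_point :: "real \<Rightarrow> plane" where "circle_point t = vec2 (cos (2 * pi * t)) (sin (2 * pi * t))"

lemma to_complex_circle_point: "to_complex (circle_point t) = cis (2 * pi * t)"
  by (simp add: to_complex_def circle_point_def complex_eq_iff)

lemma norm_to_complex: "cmod (to_complex x) = norm x"
  using norm_to_complex_diff[of x 0] by (simp add: to_complex_def complex_eq_iff zero_complex.code[symmetric])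

lemma norm_circle_point [simp]: "norm (circle_point t) = 1"
  by (simp flip: norm_to_complex add: to_complex_circle_point)

lemma continuous_circle_point: "continuous_on UNIV circle_point"
  unfolding circle_point_def[abs_def] by (intro continuous_vec2 continuous_intros)

text \<open>Inside the disc the potential of the circle vanishes; on the circle it is at most \<open>0\<close> by
  Fatou's lemma along \<open>r x\<close>, \<open>r \<rightarrow> 1\<close>.\<close>

lemma circle_potential_le:
  fixes x :: plane
  assumes "norm x \<le> 1"
  shows "(\<integral>\<^sup>+t. e2ennreal (log_kernel x (circle_point t) + ereal (ln 2)) * indicator {0..1} t \<partial>lborel) \<le> ennreal (ln 2)"
proof -
  define r where "r n = 1 - 1 / real (n + 2)" for n
  have r: "0 < r n" "r n < 1" for n by (auto simp: r_def field_simps)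
  have rlim: "r \<longlonglongrightarrow> 1" unfolding r_def by real_asymp
  define G where "G n t = ennreal ((ln 2 - ln (cmod (to_complex (r n *\<^sub>R x) - cis (2 * pi * t)))) * indicator {0..1} t)" for n t
  have Gm: "G n \<in> borel_measurable lborel" for n
  proof -
    have "(\<lambda>t. cmod (to_complex (r n *\<^sub>R x) - cis (2 * pi * t))) \<in> borel_measurable borel"
      by (intro borel_measurable_continuous_onI continuous_intros)
    then show ?thesis unfolding G_def[abs_def] by measurable
  qed
  have nd: "cmod (to_complex (r n *\<^sub>R x) - cis (2 * pi * t)) = norm (r n *\<^sub>R x - circle_point t)" for n t
    using norm_to_complex_diff[of "r n *\<^sub>R x" "circle_point t"] by (simp add: to_complex_circle_point)
  have rx: "norm (r n *\<^sub>R x) < 1" for n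
  proof -
    have "norm (r n *\<^sub>R x) \<le> r n" using r[of n] assms by (simp add: mult_left_le)
    then show ?thesis using r(2)[of n] by simp
  qed
  have le: "e2ennreal (log_kernel x (circle_point t) + ereal (ln 2)) * indicator {0..1} t \<le> liminf (\<lambda>n. G n t)" for t
  proof (cases "t \<in> {0..1}")
    case True
    have G: "G n t = ennreal (ln 2 - ln (norm (r n *\<^sub>R x - circle_point t)))" for n using True by (simp add: G_def nd)
    have lim: "(\<lambda>n. norm (r n *\<^sub>R x - circle_point t)) \<longlonglongrightarrow> norm (1 *\<^sub>R x - circle_point t)"
      by (intro tendsto_intros rlim)
    show ?thesis
    proof (cases "x = circle_point t")
      case False
      then have "(\<lambda>n. G n t) \<longlonglongrightarrow> ennreal (ln 2 - ln (norm (x - circle_point t)))"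
        unfolding G using lim by (intro tendsto_ennrealI tendsto_diff tendsto_const tendsto_ln) auto
      then have "liminf (\<lambda>n. G n t) = ennreal (ln 2 - ln (norm (x - circle_point t)))"
        by (rule lim_imp_Liminf[OF sequentially_bot])
      then show ?thesis using True False by (simp add: log_kernel_def ln_inverse e2ennreal_ereal)
    next
      \<comment> \<open>At the pole the kernel is infinite, but the approximating integrands diverge
        as well, so the pointwise bound needed for Fatou's lemma persists.\<close>
      case eq: True
      have nr: "norm (r n *\<^sub>R x - circle_point t) = 1 - r n" for n
      proof -
        have "r n *\<^sub>R x - circle_point t = (r n - 1) *\<^sub>R circle_point t" by (simp add: eq algebra_simps)
        then show ?thesis using r[of n] by simp
      qed
      have "filterlim (\<lambda>n. ln 2 - ln (1 - r n)) at_top sequentially" unfolding r_def by real_asymp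
      then have "(\<lambda>n. G n t) \<longlonglongrightarrow> top" unfolding G nr by (rule ennreal_tendsto_top_eq_at_top[THEN iffD2, unfolded infinity_ennreal_def])
      then have "liminf (\<lambda>n. G n t) = top" by (rule lim_imp_Liminf[OF sequentially_bot])
      then show ?thesis by simp
    qed
  qed simp
  have "(\<integral>\<^sup>+t. e2ennreal (log_kernel x (circle_point t) + ereal (ln 2)) * indicator {0..1} t \<partial>lborel)
      \<le> (\<integral>\<^sup>+t. liminf (\<lambda>n. G n t) \<partial>lborel)" by (intro nn_integral_mono le)
  also have "\<dots> \<le> liminf (\<lambda>n. \<integral>\<^sup>+t. G n t \<partial>lborel)" by (rule nn_integral_liminf[OF Gm])
  also have "(\<lambda>n. \<integral>\<^sup>+t. G n t \<partial>lborel) = (\<lambda>n. ennreal (ln 2))"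
    unfolding G_def using rx by (intro ext circle_potential_inside) (simp add: norm_to_complex)
  finally show ?thesis by (simp add: Liminf_const)
qed

text \<open>The uniform measure on the boundary circle has energy at most 0, because its potential,
  shifted by ln 2, is at most ln 2 at every point of the closed disc.\<close>

lemma log_capacity_disc: "log_capacity (cball 0 1) \<ge> 1"
proof -
  define U where "U = density lborel (indicator {0..1::real})"
  have U: "prob_space U"
    by (rule prob_spaceI) (simp add: U_def emeasure_density)
  define \<mu> where "\<mu> = distr U (restrict_space borel (cball 0 1)) circle_point"
  have mc: "circle_point \<in> measurable U (restrict_space borel (cball 0 1))"
    using borel_measurable_continuous_onI[OF continuous_circle_point]
    by (intro measurable_restrict_space2) (auto simp: U_def)
  have \<mu>: "\<mu> \<in> borel_prob_measures (cball 0 1)"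
    unfolding borel_prob_measures_def \<mu>_def using prob_space.prob_space_distr[OF U mc] by simp
  interpret prob_space \<mu> by (rule borel_prob_measuresD(1)[OF \<mu>])
  define F where "F z = e2ennreal (log_kernel (fst z) (snd z) + ereal (ln 2))" for z
  have mF: "F \<in> borel_measurable (\<mu> \<Otimes>\<^sub>M \<mu>)"
    unfolding F_def[abs_def] using log_kernel_measurable_pair[OF \<mu>] by measurable
  have "(\<integral>\<^sup>+z. F z \<partial>(\<mu> \<Otimes>\<^sub>M \<mu>)) = (\<integral>\<^sup>+x. \<integral>\<^sup>+y. F (x, y) \<partial>\<mu> \<partial>\<mu>)"
    by (rule nn_integral_fst[OF mF, symmetric])
  also have "\<dots> \<le> (\<integral>\<^sup>+x. ennreal (ln 2) \<partial>\<mu>)"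
  proof (rule nn_integral_mono)
    fix x assume x: "x \<in> space \<mu>"
    then have x1: "norm x \<le> 1" using borel_prob_measuresD(3)[OF \<mu>] by simp
    have mFx: "(\<lambda>y. F (x, y)) \<in> borel_measurable \<mu>" using measurable_Pair2[OF mF x] .
    then have m1: "(\<lambda>y. F (x, y)) \<in> borel_measurable (restrict_space borel (cball 0 1))" by (simp add: \<mu>_def)
    have "(\<integral>\<^sup>+y. F (x, y) \<partial>\<mu>) = (\<integral>\<^sup>+t. F (x, circle_point t) \<partial>U)"
      unfolding \<mu>_def by (rule nn_integral_distr[OF mc mFx[unfolded \<mu>_def]])
    also have "\<dots> = (\<integral>\<^sup>+t. indicator {0..1} t * F (x, circle_point t) \<partial>lborel)"
      unfolding U_def using measurable_compose[OF mc m1] by (intro nn_integral_density) (auto simp: U_def)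
    also have "\<dots> \<le> ennreal (ln 2)"
      using circle_potential_le[OF x1] by (simp add: F_def mult.commute)
    finally show "(\<integral>\<^sup>+y. F (x, y) \<partial>\<mu>) \<le> ennreal (ln 2)" .
  qed
  also have "\<dots> = ennreal (ln 2)" by (simp add: emeasure_space_1)
  finally have "enn2ereal (\<integral>\<^sup>+z. F z \<partial>(\<mu> \<Otimes>\<^sub>M \<mu>)) \<le> enn2ereal (ennreal (ln 2))"
    by (simp only: less_eq_ennreal.rep_eq)
  then have E: "enn2ereal (\<integral>\<^sup>+z. F z \<partial>(\<mu> \<Otimes>\<^sub>M \<mu>)) \<le> ereal (ln 2)" by (simp add: enn2ereal_ennreal)
  have dist: "\<forall>x\<in>cball (0::plane) 1. \<forall>y\<in>cball 0 1. norm (x - y) \<le> exp (ln 2 :: real)"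
  proof (intro ballI)
    fix x y :: plane assume "x \<in> cball 0 1" "y \<in> cball 0 1"
    then show "norm (x - y) \<le> exp (ln 2 :: real)" using norm_triangle_ineq4[of x y] by simp
  qed
  have "log_energy \<mu> \<le> ereal 0"
    using log_energy_shift[OF \<mu> _ dist] ereal_minus_mono[OF E order_refl, of "ereal (ln 2)"] by (simp add: F_def zero_ereal_def)
  then have "log_potential_energy (cball 0 1) \<le> ereal 0"
    unfolding log_potential_energy_def using INF_lower[OF \<mu>, of log_energy] by (rule order_trans[rotated])
  from log_capacity_geI[OF _ this] show ?thesis by simp
qed

section \<open>Compactness of convex sets via gauges\<close>

definition gauge_of :: "plane set \<Rightarrow> plane \<Rightarrow> real" where
  "gauge_of \<Omega> x = Inf {s. s > 0 \<and> (1/s) *\<^sub>R x \<in> \<Omega>}"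

text \<open>Keeping \<open>r\<close> and \<open>R\<close> as parameters makes the bounds on the
  gauge, in particular the Lipschitz constant 1/r, uniform along a sequence of domains.\<close>

locale gauge_domain =
  fixes \<Omega> :: "plane set" and r R :: real
  assumes cv: "convex \<Omega>" and r: "r > 0" and inner: "ball 0 r \<subseteq> \<Omega>" and outer: "\<Omega> \<subseteq> ball 0 R"
begin

lemma R_pos: "R > 0"
  using outer inner r by (metis centre_in_ball subset_iff)

text \<open>\<Omega> is star-shaped about 0, so the set whose infimum is the gauge is upward
  closed.\<close>

lemma gauge_set_up: "s > 0 \<Longrightarrow> (1/s) *\<^sub>R x \<in> \<Omega> \<Longrightarrow> s \<le> s' \<Longrightarrow> (1/s') *\<^sub>R x \<in> \<Omega>"
proof -
  assume s: "s > 0" "(1/s) *\<^sub>R x \<in> \<Omega>" "s \<le> s'"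
  have "0 \<in> \<Omega>" using inner r by auto
  then have "(1 - s/s') *\<^sub>R 0 + (s/s') *\<^sub>R ((1/s) *\<^sub>R x) \<in> \<Omega>"
    using s by (intro convexD[OF cv]) auto
  then show ?thesis using s by simp
qed

lemma gauge_set_large: "s > norm x / r \<Longrightarrow> s > 0 \<and> (1/s) *\<^sub>R x \<in> \<Omega>"
proof -
  assume s: "s > norm x / r"
  then have "s > 0" using r by (meson divide_nonneg_pos le_less_trans norm_ge_zero)
  moreover have "norm ((1/s) *\<^sub>R x) < r" using s \<open>s > 0\<close> r by (simp add: field_simps)
  ultimately show ?thesis using inner by auto
qed

lemma gauge_set_ne: "{s. s > 0 \<and> (1/s) *\<^sub>R x \<in> \<Omega>} \<noteq> {}"
  using gauge_set_large[of x "norm x / r + 1"] by auto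

lemma gauge_set_bdd: "bdd_below {s. s > 0 \<and> (1/s) *\<^sub>R x \<in> \<Omega>}"
  by (rule bdd_belowI[of _ 0]) auto

lemma gauge_le: "s > 0 \<Longrightarrow> (1/s) *\<^sub>R x \<in> \<Omega> \<Longrightarrow> gauge_of \<Omega> x \<le> s"
  unfolding gauge_of_def by (intro cInf_lower gauge_set_bdd) auto

lemma gauge_less: "gauge_of \<Omega> x < s \<Longrightarrow> s > 0 \<and> (1/s) *\<^sub>R x \<in> \<Omega>"
proof -
  assume "gauge_of \<Omega> x < s"
  then obtain s0 where "s0 > 0" "(1/s0) *\<^sub>R x \<in> \<Omega>" "s0 < s"
    unfolding gauge_of_def using cInf_lessD[OF gauge_set_ne] by blast
  then show ?thesis using gauge_set_up[of s0 x s] by auto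
qed

lemma gauge_leI: "(\<And>s. gauge_of \<Omega> y < s \<Longrightarrow> gauge_of \<Omega> x \<le> c * s) \<Longrightarrow> gauge_of \<Omega> x \<le> c * gauge_of \<Omega> y"
proof -
  assume *: "\<And>s. gauge_of \<Omega> y < s \<Longrightarrow> gauge_of \<Omega> x \<le> c * s"
  have "(\<lambda>n. c * (gauge_of \<Omega> y + 1 / real (Suc n))) \<longlonglongrightarrow> c * (gauge_of \<Omega> y + 0)"
    by (intro tendsto_intros) real_asymp
  then have "gauge_of \<Omega> x \<le> c * (gauge_of \<Omega> y + 0)"
    by (rule LIMSEQ_le_const) (intro exI[of _ 0] allI impI *, simp)
  then show ?thesis by simp
qed

lemma gauge_scale_le: "c > 0 \<Longrightarrow> gauge_of \<Omega> (c *\<^sub>R x) \<le> c * gauge_of \<Omega> x"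
proof (rule gauge_leI)
  fix s assume "c > 0" "gauge_of \<Omega> x < s"
  then show "gauge_of \<Omega> (c *\<^sub>R x) \<le> c * s"
    using gauge_less[of x s] by (intro gauge_le) auto
qed

lemma gauge_scale: "c > 0 \<Longrightarrow> gauge_of \<Omega> (c *\<^sub>R x) = c * gauge_of \<Omega> x"
proof (rule antisym)
  assume c: "c > 0"
  have "gauge_of \<Omega> x \<le> (1/c) * gauge_of \<Omega> (c *\<^sub>R x)"
    using gauge_scale_le[of "1/c" "c *\<^sub>R x"] c by simp
  then show "c * gauge_of \<Omega> x \<le> gauge_of \<Omega> (c *\<^sub>R x)" using c by (simp add: field_simps)
qed (rule gauge_scale_le)

text \<open>Convexity with weights s/(s + t) and t/(s + t), applied to x/s and y/t, puts (x + y)/(s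
  + t) into \<Omega>.\<close>

lemma gauge_add: "gauge_of \<Omega> (x + y) \<le> gauge_of \<Omega> x + gauge_of \<Omega> y"
proof (rule field_le_epsilon)
  fix e :: real assume "e > 0"
  define s where "s = gauge_of \<Omega> x + e / 2"
  define t where "t = gauge_of \<Omega> y + e / 2"
  have st: "s > 0" "(1/s) *\<^sub>R x \<in> \<Omega>" "t > 0" "(1/t) *\<^sub>R y \<in> \<Omega>"
    using gauge_less[of x s] gauge_less[of y t] \<open>e > 0\<close> by (auto simp: s_def t_def)
  have "(s/(s+t)) *\<^sub>R ((1/s) *\<^sub>R x) + (t/(s+t)) *\<^sub>R ((1/t) *\<^sub>R y) \<in> \<Omega>"
    using st by (intro convexD[OF cv]) (auto simp flip: add_divide_distrib)
  moreover have "(s/(s+t)) *\<^sub>R ((1/s) *\<^sub>R x) + (t/(s+t)) *\<^sub>R ((1/t) *\<^sub>R y) = (1/(s+t)) *\<^sub>R (x + y)"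
    using st by (simp add: scaleR_add_right)
  ultimately have "gauge_of \<Omega> (x + y) \<le> s + t" using st by (intro gauge_le) auto
  then show "gauge_of \<Omega> (x + y) \<le> gauge_of \<Omega> x + gauge_of \<Omega> y + e" by (simp add: s_def t_def)
qed

lemma gauge_upper: "gauge_of \<Omega> x \<le> norm x / r"
proof (rule dense_ge)
  fix s assume "norm x / r < s"
  from gauge_set_large[OF this] show "gauge_of \<Omega> x \<le> s" by (auto intro: gauge_le)
qed

lemma gauge_lower: "norm x / R \<le> gauge_of \<Omega> x"
  unfolding gauge_of_def
proof (rule cInf_greatest[OF gauge_set_ne])
  fix s assume "s \<in> {s. s > 0 \<and> (1/s) *\<^sub>R x \<in> \<Omega>}"
  then have s: "s > 0" "norm ((1/s) *\<^sub>R x) < R" using outer by auto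
  then show "norm x / R \<le> s" using R_pos by (simp add: field_simps)
qed

lemma gauge_lipschitz: "\<bar>gauge_of \<Omega> x - gauge_of \<Omega> y\<bar> \<le> norm (x - y) / r"
  using gauge_add[of "x - y" y] gauge_add[of "y - x" x] gauge_upper[of "x - y"] gauge_upper[of "y - x"]
  by (simp add: norm_minus_commute abs_le_iff)

end

text \<open>The gauges are uniformly Lipschitz, so a subsequence converges uniformly on the circle
  (Arzela--Ascoli); by homogeneity the error is small relative to the limit gauge, which sandwiches
  the sets between dilates of the limit.\<close>

lemma convex_sequence_compact:
  fixes \<Omega> :: "nat \<Rightarrow> plane set"
  assumes cv: "\<And>n. convex (\<Omega> n)" and r: "r > 0" and inner: "\<And>n. ball 0 r \<subseteq> \<Omega> n" and outer: "\<And>n. \<Omega> n \<subseteq> ball 0 R"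
  obtains \<Omega>0 k where "admissible \<Omega>0" "strict_mono (k :: nat \<Rightarrow> nat)"
    "\<And>t. t > 1 \<Longrightarrow> \<exists>N. \<forall>n\<ge>N. \<Omega> (k n) \<subseteq> (*\<^sub>R) t ` \<Omega>0 \<and> \<Omega>0 \<subseteq> (*\<^sub>R) t ` \<Omega> (k n)"
proof -
  interpret G: gauge_domain "\<Omega> n" r R for n by unfold_locales (use assms in auto)
  have R: "R > 0" by (rule G.R_pos)
  define F where "F n x = gauge_of (\<Omega> n) x" for n x
  obtain p0 k where k: "strict_mono (k :: nat \<Rightarrow> nat)"
    and conv: "\<And>e. 0 < e \<Longrightarrow> \<exists>N. \<forall>n x. n \<ge> N \<and> x \<in> sphere 0 1 \<longrightarrow> norm (F (k n) x - p0 x) < e"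
  proof (rule Arzela_Ascoli[of "sphere (0::plane) 1" F "1 / r"])
    show "norm (F n x) \<le> 1 / r" if "x \<in> sphere 0 1" for n x
    proof -
      have "0 \<le> norm x / R" using R by simp
      then have "0 \<le> F n x" unfolding F_def using G.gauge_lower by (rule order_trans)
      moreover have "F n x \<le> 1 / r" using G.gauge_upper[of n x] that by (simp add: F_def)
      ultimately show ?thesis by simp
    qed
    show "\<exists>d>0. \<forall>n y. y \<in> sphere 0 1 \<and> norm (x - y) < d \<longrightarrow> norm (F n x - F n y) < e" if "0 < e" for x e
    proof (intro exI[of _ "r * e"] conjI allI impI)
      fix n y assume "y \<in> sphere 0 1 \<and> norm (x - y) < r * e"
      then have "norm (x - y) / r < e" using r by (simp add: field_simps)
      then show "norm (F n x - F n y) < e" using G.gauge_lipschitz[of n x y] by (simp add: F_def)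
    qed (use r that in simp)
  qed (auto)
  \<comment> \<open>The limit is extended from the circle by homogeneity; at 0 the factor
    \<open>norm x\<close> makes the value 0.\<close>
  define p where "p x = norm x * p0 (x /\<^sub>R norm x)" for x
  have F0: "F n 0 = 0" for n
    using G.gauge_upper[of n 0] G.gauge_lower[of 0 n] by (simp add: F_def)
  have close: "\<exists>N. \<forall>n\<ge>N. \<forall>x. \<bar>F (k n) x - p x\<bar> \<le> e * norm x" if e: "e > 0" for e
  proof -
    obtain N where N: "\<And>n x. n \<ge> N \<Longrightarrow> x \<in> sphere 0 1 \<Longrightarrow> norm (F (k n) x - p0 x) < e"
      using conv[OF e] by blast
    have "\<bar>F (k n) x - p x\<bar> \<le> e * norm x" if "n \<ge> N" for n x
    proof (cases "x = 0")
      case True then show ?thesis by (simp add: F0 p_def)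
    next
      case False
      have "F (k n) x = F (k n) (norm x *\<^sub>R (x /\<^sub>R norm x))" using False by simp
      also have "\<dots> = norm x * F (k n) (x /\<^sub>R norm x)" unfolding F_def using False by (intro G.gauge_scale) auto
      finally have "\<bar>F (k n) x - p x\<bar> = norm x * \<bar>F (k n) (x /\<^sub>R norm x) - p0 (x /\<^sub>R norm x)\<bar>"
        by (simp add: p_def abs_mult flip: right_diff_distrib)
      also have "\<dots> \<le> norm x * e" using N[OF that, of "x /\<^sub>R norm x"] False by (intro mult_left_mono) auto
      finally show ?thesis by (simp add: mult.commute)
    qed
    then show ?thesis by blast
  qed
  have lim: "(\<lambda>n. F (k n) x) \<longlonglongrightarrow> p x" for x
  proof (rule LIMSEQ_I)
    fix e :: real assume e: "e > 0"
    then have e': "e / (norm x + 1) > 0" by (intro divide_pos_pos add_nonneg_pos) auto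
    obtain N where N: "\<And>n. n \<ge> N \<Longrightarrow> \<bar>F (k n) x - p x\<bar> \<le> e / (norm x + 1) * norm x" using close[OF e'] by blast
    have "e / (norm x + 1) * norm x < e"
    proof -
      have "norm x + 1 > 0" by (simp add: add_nonneg_pos)
      then show ?thesis using e by (simp add: field_simps)
    qed
    then show "\<exists>no. \<forall>n\<ge>no. norm (F (k n) x - p x) < e" using N by (intro exI[of _ N]) (auto intro: le_less_trans)
  qed
  have p_add: "p (x + y) \<le> p x + p y" for x y
    by (rule LIMSEQ_le[OF lim tendsto_add[OF lim lim]]) (auto simp: F_def G.gauge_add)
  have p_scale: "p (c *\<^sub>R x) = c * p x" if "c > 0" for c x
  proof (rule LIMSEQ_unique[OF lim])
    show "(\<lambda>n. F (k n) (c *\<^sub>R x)) \<longlonglongrightarrow> c * p x"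
      using tendsto_mult_left[OF lim, of c x] by (simp add: F_def G.gauge_scale[OF that])
  qed
  have p_lower: "norm x / R \<le> p x" for x
    by (rule LIMSEQ_le_const[OF lim]) (auto simp: F_def G.gauge_lower)
  have p_lip: "\<bar>p x - p y\<bar> \<le> norm (x - y) / r" for x y
    by (rule LIMSEQ_le_const2[OF tendsto_rabs[OF tendsto_diff[OF lim lim]]]) (auto simp: F_def G.gauge_lipschitz)
  have p0: "p 0 = 0" by (simp add: p_def)
  define \<Omega>0 where "\<Omega>0 = {x. p x < 1}"
  have "open \<Omega>0"
  proof -
    have "continuous_on UNIV p"
    proof (rule continuous_onI)
      fix x :: plane and e :: real assume "e > 0"
      show "\<exists>d>0. \<forall>x'\<in>UNIV. dist x' x < d \<longrightarrow> dist (p x') (p x) \<le> e"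
      proof (intro exI[of _ "r * e"] conjI ballI impI)
        fix x' assume "dist x' x < r * e"
        then have "norm (x' - x) / r \<le> e" using r by (simp add: dist_norm field_simps)
        then show "dist (p x') (p x) \<le> e" using p_lip[of x' x] by (simp add: dist_real_def)
      qed (use r \<open>e > 0\<close> in simp)
    qed
    then show ?thesis unfolding \<Omega>0_def by (intro open_Collect_less continuous_intros)
  qed
  moreover have "convex \<Omega>0"
  proof (rule convexI)
    fix x y :: plane and u v :: real assume xy: "x \<in> \<Omega>0" "y \<in> \<Omega>0" and uv: "0 \<le> u" "0 \<le> v" "u + v = 1"
    show "u *\<^sub>R x + v *\<^sub>R y \<in> \<Omega>0"
    proof (cases "u = 0 \<or> v = 0")
      case True then show ?thesis using xy uv by auto
    next
      case False
      then have pos: "u > 0" "v > 0" using uv by auto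
      have "p (u *\<^sub>R x + v *\<^sub>R y) \<le> u * p x + v * p y" using p_add[of "u *\<^sub>R x" "v *\<^sub>R y"] pos by (simp add: p_scale)
      also have "\<dots> < u * 1 + v * 1" using xy pos by (intro add_strict_mono mult_strict_left_mono) (auto simp: \<Omega>0_def)
      finally show ?thesis using uv by (simp add: \<Omega>0_def)
    qed
  qed
  moreover have "bounded \<Omega>0"
  proof (rule boundedI)
    fix x assume "x \<in> \<Omega>0"
    then have "norm x / R < 1" using p_lower[of x] by (simp add: \<Omega>0_def)
    then show "norm x \<le> R" using R by (simp add: field_simps)
  qed
  moreover have "0 \<in> \<Omega>0" by (simp add: \<Omega>0_def p0)
  ultimately have adm: "admissible \<Omega>0" by (auto simp: admissible_def)
  have "\<exists>N. \<forall>n\<ge>N. \<Omega> (k n) \<subseteq> (*\<^sub>R) t ` \<Omega>0 \<and> \<Omega>0 \<subseteq> (*\<^sub>R) t ` \<Omega> (k n)" if t: "t > 1" for t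
  proof -
    \<comment> \<open>The two inclusions require e R t < t - 1 and e R < t - 1 respectively.\<close>
    define e where "e = (t - 1) / (2 * t * R)"
    have "e * R = (t - 1) / (2 * t)" "e * R * t = (t - 1) / 2" using t R by (auto simp: e_def)
    moreover have "(t - 1) / (2 * t) < (t - 1) / 1" using t by (intro divide_strict_left_mono) auto
    moreover have "e > 0" using t R by (simp add: e_def)
    moreover have "(t - 1) / (2 * t) < 1" using t by (simp add: field_simps)
    ultimately have e: "e > 0" "e * R < t - 1" "e * R * t < t - 1" "e * R < 1" using t by auto
    obtain N where N: "\<And>n x. n \<ge> N \<Longrightarrow> \<bar>F (k n) x - p x\<bar> \<le> e * norm x" using close[OF e(1)] by blast
    have img: "x \<in> (*\<^sub>R) t ` A" if "(1/t) *\<^sub>R x \<in> A" for x :: plane and A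
      using that t by (intro image_eqI[of _ _ "(1/t) *\<^sub>R x"]) auto
    \<comment> \<open>The lower bound |x|/R for the limit gauge turns an error proportional to |x|
      into one relative to \<open>p x\<close>.\<close>
    have nR: "e * norm x \<le> e * R * p x" for x
      using p_lower[of x] R e(1) by (simp add: field_simps)
    have "\<Omega> (k n) \<subseteq> (*\<^sub>R) t ` \<Omega>0 \<and> \<Omega>0 \<subseteq> (*\<^sub>R) t ` \<Omega> (k n)" if n: "n \<ge> N" for n
    proof (intro conjI subsetI)
      fix x assume "x \<in> \<Omega> (k n)"
      then have "F (k n) x \<le> 1" unfolding F_def using G.gauge_le[of 1 x "k n"] by simp
      then have "p x \<le> 1 + e * R * p x" using N[OF n, of x] nR[of x] by simp
      then have le: "p x * (1 - e * R) \<le> 1" by (simp add: algebra_simps)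
      have "p x < t"
      proof (rule ccontr)
        assume "\<not> p x < t"
        have eR: "1 - e * R > 0" using e(4) by simp
        have "t * (1 - e * R) \<le> p x * (1 - e * R)" using \<open>\<not> p x < t\<close> eR by (intro mult_right_mono) auto
        then have "t * (1 - e * R) \<le> 1" using le by simp
        then show False using e(3) by (simp add: algebra_simps)
      qed
      then have "p ((1/t) *\<^sub>R x) < 1" using t by (simp add: p_scale)
      then show "x \<in> (*\<^sub>R) t ` \<Omega>0" by (intro img) (simp add: \<Omega>0_def)
    next
      fix x assume "x \<in> \<Omega>0"
      then have px: "p x < 1" by (simp add: \<Omega>0_def)
      have "e * R * p x \<le> e * R * 1" using px e(1) R by (intro mult_left_mono) auto
      then have "F (k n) x < t" using N[OF n, of x] nR[of x] px e(2) by simp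
      then show "x \<in> (*\<^sub>R) t ` \<Omega> (k n)" unfolding F_def using G.gauge_less[of "k n" x t] by (intro img) auto
    qed
    then show ?thesis by blast
  qed
  with adm k show ?thesis by (rule that)
qed

section \<open>Existence of a maximizer\<close>

lemma log_capacity_similarity:
  assumes S: "similarity c S" and K: "bounded K"
  shows "log_capacity (S ` K) = c * log_capacity K"
proof (rule antisym)
  have c: "c > 0" using S by (simp add: similarity_def)
  obtain S' where S': "similarity (1/c) S'" "\<And>x. S' (S x) = x" "\<And>x. S (S' x) = x"
    using similarity_inverse[OF S] by blast
  show "c * log_capacity K \<le> log_capacity (S ` K)"
    by (rule log_capacity_map_le[OF K similarity_bounded[OF S K] similarity_measurable[OF S] _ c])
       (auto simp: similarity_dist[OF S])
  have "(1/c) * log_capacity (S ` K) \<le> log_capacity K"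
    by (rule log_capacity_map_le[OF similarity_bounded[OF S K] K similarity_measurable[OF S'(1)]])
       (use c S'(2) in \<open>auto simp: similarity_dist[OF S'(1)]\<close>)
  then show "log_capacity (S ` K) \<le> c * log_capacity K" using c by (simp add: field_simps)
qed

section \<open>Scaling and comparison of the shape functional\<close>

lemma admissibleD:
  assumes "admissible \<Omega>"
  shows "open \<Omega>" "bounded \<Omega>" "convex \<Omega>" "\<Omega> \<noteq> {}" "\<Omega> \<in> sets borel" "bounded (closure \<Omega>)"
  using assms by (auto simp: admissible_def)

lemma measure_mono_bounded:
  fixes A B :: "plane set"
  assumes "A \<subseteq> B" "open A" "open B" "bounded B"
  shows "measure lborel A \<le> measure lborel B"
  using assms bounded_finite_emeasure[OF assms(4)]
  by (intro measure_mono_fmeasurable) (auto simp: fmeasurable_def)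

lemma admissible_area_pos:
  assumes "admissible \<Omega>" shows "measure lborel \<Omega> > 0"
proof -
  obtain x e where e: "e > 0" "ball x e \<subseteq> \<Omega>"
    using admissibleD[OF assms] by (meson all_not_in_conv open_contains_ball)
  have "0 < measure lborel (ball x e)" using e(1) content_ball_pos[of e x] by simp
  also have "\<dots> \<le> measure lborel \<Omega>" using e(2) admissibleD[OF assms] by (intro measure_mono_bounded) auto
  finally show ?thesis .
qed

lemma admissible_rigidity_nonneg: "admissible \<Omega> \<Longrightarrow> torsional_rigidity \<Omega> \<ge> 0"
  by (intro torsional_rigidity_nonneg admissibleD)

lemma powr_scale:
  fixes c x :: real
  assumes "c > 0" "x \<ge> 0"
  shows "(c ^ 4 * x) powr (1/2) = c\<^sup>2 * x powr (1/2)" "(c\<^sup>2 * x) powr (3/2) = c ^ 3 * x powr (3/2)"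
proof -
  have c: "c ^ 4 = c powr 4" "c\<^sup>2 = c powr 2" "c ^ 3 = c powr 3" using assms(1) by simp_all
  have "(c ^ 4) powr (1/2) = c\<^sup>2" "(c\<^sup>2) powr (3/2) = c ^ 3"
    unfolding c powr_powr by simp_all
  then show "(c ^ 4 * x) powr (1/2) = c\<^sup>2 * x powr (1/2)" "(c\<^sup>2 * x) powr (3/2) = c ^ 3 * x powr (3/2)"
    using assms by (simp_all add: powr_mult)
qed

text \<open>The factors c^2 and c of the numerator cancel c^3 in the denominator.\<close>

lemma shape_functional_similarity:
  assumes S: "similarity c S" and \<Omega>: "admissible \<Omega>"
  shows "shape_functional (S ` \<Omega>) = shape_functional \<Omega>"
proof -
  have c: "c > 0" using S by (simp add: similarity_def)
  note a = admissibleD[OF \<Omega>]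
  show ?thesis
    unfolding shape_functional_def torsional_rigidity_similarity[OF S a(1,2)] similarity_closure[OF S]
      log_capacity_similarity[OF S a(6)] similarity_measure[OF S a(5)]
      powr_scale(1)[OF c admissible_rigidity_nonneg[OF \<Omega>]] powr_scale(2)[OF c measure_nonneg]
    using c by (simp add: power2_eq_square power3_eq_cube)
qed

text \<open>The inclusion of \<open>\<Omega>'\<close> in the dilate of \<open>\<Omega>\<close> costs
  t^2 for the root of the rigidity and t for the capacity; the opposite inclusion costs t^3 for the
  power of the area.\<close>

lemma shape_functional_sandwich:
  assumes \<Omega>: "admissible \<Omega>" "admissible \<Omega>'" and t: "t > 0"
    and sub: "\<Omega>' \<subseteq> (*\<^sub>R) t ` \<Omega>" "\<Omega> \<subseteq> (*\<^sub>R) t ` \<Omega>'"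
  shows "shape_functional \<Omega>' \<le> t ^ 6 * shape_functional \<Omega>"
proof -
  note S = similarity_scale[OF t]
  note a = admissibleD[OF \<Omega>(1)] and b = admissibleD[OF \<Omega>(2)]
  have "torsional_rigidity \<Omega>' \<le> t ^ 4 * torsional_rigidity \<Omega>"
    unfolding torsional_rigidity_similarity[OF S a(1,2), symmetric]
    using similarity_open[OF S a(1)] similarity_bounded[OF S a(2)] by (intro torsional_rigidity_mono b sub)
  then have "torsional_rigidity \<Omega>' powr (1/2) \<le> (t ^ 4 * torsional_rigidity \<Omega>) powr (1/2)"
    using admissible_rigidity_nonneg[OF \<Omega>(2)] by (intro powr_mono2) auto
  then have 1: "torsional_rigidity \<Omega>' powr (1/2) \<le> t\<^sup>2 * torsional_rigidity \<Omega> powr (1/2)"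
    unfolding powr_scale(1)[OF t admissible_rigidity_nonneg[OF \<Omega>(1)]] .
  have "log_capacity (closure \<Omega>') \<le> log_capacity (closure ((*\<^sub>R) t ` \<Omega>))"
    using similarity_bounded[OF S a(2)] by (intro log_capacity_mono closure_mono sub) auto
  then have 2: "log_capacity (closure \<Omega>') \<le> t * log_capacity (closure \<Omega>)"
    unfolding similarity_closure[OF S] log_capacity_similarity[OF S a(6)] .
  have "measure lborel \<Omega> \<le> t\<^sup>2 * measure lborel \<Omega>'"
    unfolding similarity_measure[OF S b(5), symmetric]
    using similarity_open[OF S b(1)] similarity_bounded[OF S b(2)] by (intro measure_mono_bounded a sub)
  then have "measure lborel \<Omega> powr (3/2) \<le> (t\<^sup>2 * measure lborel \<Omega>') powr (3/2)" by (intro powr_mono2) auto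
  then have 3: "measure lborel \<Omega> powr (3/2) \<le> t ^ 3 * measure lborel \<Omega>' powr (3/2)"
    unfolding powr_scale(2)[OF t measure_nonneg] .
  define P where "P = torsional_rigidity \<Omega> powr (1/2) * log_capacity (closure \<Omega>)"
  have P: "P \<ge> 0" by (simp add: P_def log_capacity_nonneg)
  have pos: "measure lborel \<Omega> powr (3/2) > 0" "measure lborel \<Omega>' powr (3/2) > 0"
    using admissible_area_pos \<Omega> by force+
  have "torsional_rigidity \<Omega>' powr (1/2) * log_capacity (closure \<Omega>') \<le>
      (t\<^sup>2 * torsional_rigidity \<Omega> powr (1/2)) * (t * log_capacity (closure \<Omega>))"
    using t by (intro mult_mono 1 2) (auto simp: log_capacity_nonneg)
  also have "\<dots> = t ^ 3 * P" by (simp add: P_def power2_eq_square power3_eq_cube)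
  finally have "shape_functional \<Omega>' \<le> t ^ 3 * P / measure lborel \<Omega>' powr (3/2)"
    unfolding shape_functional_def using pos by (intro divide_right_mono) auto
  also have "\<dots> \<le> t ^ 3 * P * (t ^ 3 / measure lborel \<Omega> powr (3/2))"
  proof -
    have "1 / measure lborel \<Omega>' powr (3/2) \<le> t ^ 3 / measure lborel \<Omega> powr (3/2)"
      using 3 pos by (simp add: field_simps)
    from mult_left_mono[OF this, of "t ^ 3 * P"] show ?thesis using t P by simp
  qed
  also have "\<dots> = t ^ 6 * shape_functional \<Omega>" by (simp add: shape_functional_def P_def field_simps flip: power_add)
  finally show ?thesis .
qed

lemma admissible_ball: "r > 0 \<Longrightarrow> admissible (ball x r)"
  by (auto simp: admissible_def)

text \<open>The value obtained for the unit disc from rigidity \<pi>/8, capacity 1 and area \<pi>.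
  It serves as the threshold below which a set can be discarded.\<close>

definition disc_value :: real where "disc_value = (pi/8) powr (1/2) / pi powr (3/2)"

lemma disc_value_le: "disc_value \<le> shape_functional (ball 0 1)"
proof -
  have "(pi/8) powr (1/2) * 1 \<le> torsional_rigidity (ball 0 1) powr (1/2) * log_capacity (cball 0 1)"
    using torsional_rigidity_disc log_capacity_disc by (intro mult_mono powr_mono2) auto
  then show ?thesis
    unfolding disc_value_def shape_functional_def
    using measure_ball_plane[of 1] by (simp add: divide_right_mono)
qed

text \<open>\<open>\<surd>96 = 4 \<surd>6\<close>: the limiting value for flat domains is \<open>1/(4 \<surd>6) \<approx> 0.102\<close>, that of the disc
  \<open>1/(\<pi> \<surd>8) \<approx> 0.113\<close>.\<close>

lemma thin_value_less: "exp (2 * ln 768 / 255) / sqrt 96 < disc_value"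
proof -
  \<comment> \<open>With 768 \<le> 2^10 and ln 2 \<le> 25/36 one gets ln 768 \<le> 7, so the
    exponent after squaring is at most 28/255.\<close>
  have "ln (768::real) \<le> ln (2 ^ 10)" by (subst ln_le_cancel_iff) auto
  also have "\<dots> = 10 * ln 2" using ln_realpow[of 2 10] by simp
  also have "\<dots> \<le> 7" using ln_2_less_1 ln2_le_25_over_36 by simp
  finally have "exp (4 * ln 768 / 255) \<le> exp (28 / 255 :: real)" by simp
  also have "\<dots> \<le> 1 + 28/255 + (28/255)\<^sup>2" by (rule exp_bound) auto
  also have "\<dots> \<le> 1.13" by (simp add: power2_eq_square)
  finally have e: "exp (4 * ln 768 / 255) \<le> (1.13::real)" .
  have "pi \<le> 3.15" using pi_approx by simp
  then have "pi * pi \<le> 3.15 * 3.15" using pi_gt_zero by (intro mult_mono) auto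
  then have p: "pi\<^sup>2 \<le> 9.93" by (simp add: power2_eq_square)
  \<comment> \<open>Squaring removes the roots and reduces the comparison to 1.13/96 < 1/(8
    \<pi>^2).\<close>
  have "(exp (2 * ln 768 / 255) / sqrt 96)\<^sup>2 = exp (4 * ln 768 / 255) / (96::real)"
    by (simp add: power_divide flip: exp_double)
  also have "\<dots> \<le> 1.13 / 96" using e by simp
  also have "\<dots> < 1 / (8 * 9.93)" by simp
  also have "\<dots> \<le> 1 / (8 * pi\<^sup>2)" using p by (intro divide_left_mono mult_left_mono) auto
  also have "\<dots> = disc_value\<^sup>2"
  proof -
    have 1: "((pi/8) powr (1/2))\<^sup>2 = pi/8" by (simp add: powr_half_sqrt)
    have 2: "(pi powr (3/2))\<^sup>2 = pi ^ 3" 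
      unfolding power2_eq_square powr_add[symmetric] by simp
    show ?thesis unfolding disc_value_def power_divide 1 2 by (simp add: power2_eq_square power3_eq_cube)
  qed
  finally show ?thesis by (rule power2_less_imp_less) (simp add: disc_value_def)
qed

text \<open>The closure reaches the abscissae -2 and 2, so the projection has length at least 4 and
  the rigidity is at most A^3/96 with A the area. The powers of A cancel, leaving the capacity bound
  divided by sqrt 96.\<close>

lemma thin_shape_functional:
  assumes adm: "admissible \<Omega>" and wide: "vec2 (-2) 0 \<in> closure \<Omega>" "vec2 2 0 \<in> closure \<Omega>"
    and cap: "log_capacity (closure \<Omega>) \<le> exp (2 * ln 768 / 255)"
  shows "shape_functional \<Omega> < disc_value"
proof -
  obtain a b where P: "a < b" "\<And>x. slice \<Omega> x \<noteq> {} \<longleftrightarrow> x \<in> {a<..<b}"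
    using projection_interval[OF adm] by blast
  have "a < z $ 1 \<and> z $ 1 < b" if "z \<in> \<Omega>" for z :: plane
  proof -
    have "z $ 2 \<in> slice \<Omega> (z $ 1)" using that by (simp add: slice_def)
    then show ?thesis using P(2)[of "z $ 1"] by auto
  qed
  then have "\<Omega> \<subseteq> {z. a \<le> z $ 1 \<and> z $ 1 \<le> b}" by (auto intro: less_imp_le)
  moreover have "closed {z :: plane. a \<le> z $ 1 \<and> z $ 1 \<le> b}"
    by (intro closed_Collect_conj closed_Collect_le continuous_intros)
  ultimately have "closure \<Omega> \<subseteq> {z. a \<le> z $ 1 \<and> z $ 1 \<le> b}" by (rule closure_minimal)
  then have ab: "a \<le> -2" "2 \<le> b" using wide by auto
  define A where "A = measure lborel \<Omega>"
  have A: "A > 0" unfolding A_def by (rule admissible_area_pos[OF adm])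
  have "torsional_rigidity \<Omega> \<le> A ^ 3 / (6 * (b - a)\<^sup>2)"
    unfolding A_def by (rule torsional_rigidity_le_width[OF adm P])
  also have "\<dots> \<le> A ^ 3 / (6 * 4\<^sup>2)"
    using ab A by (intro divide_left_mono mult_left_mono power_mono) auto
  finally have "torsional_rigidity \<Omega> powr (1/2) \<le> (A ^ 3 / 96) powr (1/2)"
    using admissible_rigidity_nonneg[OF adm] by (intro powr_mono2) auto
  also have "\<dots> = A powr (3/2) / sqrt 96"
  proof -
    have "A ^ 3 = A powr 3" using A by simp
    then have "(A ^ 3) powr (1/2) = A powr (3/2)" by (simp only: powr_powr) simp
    then show ?thesis using A by (simp add: powr_divide powr_half_sqrt)
  qed
  finally have "torsional_rigidity \<Omega> powr (1/2) * log_capacity (closure \<Omega>) \<le> A powr (3/2) / sqrt 96 * exp (2 * ln 768 / 255)"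
    using cap by (intro mult_mono) (auto simp: log_capacity_nonneg)
  then have "shape_functional \<Omega> \<le> A powr (3/2) / sqrt 96 * exp (2 * ln 768 / 255) / A powr (3/2)"
    unfolding shape_functional_def A_def by (rule divide_right_mono) simp
  also have "\<dots> = exp (2 * ln 768 / 255) / sqrt 96" using A by simp
  also have "\<dots> < disc_value" by (rule thin_value_less)
  finally show ?thesis .
qed

text \<open>A diameter is moved onto the segment from (-2, 0) to (2, 0); the length 4 matches the
  segment on which the Chebyshev polynomials are bounded by 2.\<close>

lemma horizontal_normalization:
  assumes adm: "admissible \<Omega>"
  obtains c S where "similarity c S" "vec2 (-2) 0 \<in> closure (S ` \<Omega>)" "vec2 2 0 \<in> closure (S ` \<Omega>)"
    "\<And>z w. z \<in> closure (S ` \<Omega>) \<Longrightarrow> w \<in> closure (S ` \<Omega>) \<Longrightarrow> norm (z - w) \<le> 4"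
proof -
  note a = admissibleD[OF adm]
  have cpt: "compact (closure \<Omega>)" "closure \<Omega> \<noteq> {}" using a by (auto simp: compact_closure)
  obtain x y where xy: "x \<in> closure \<Omega>" "y \<in> closure \<Omega>" "dist x y = diameter (closure \<Omega>)"
    using diameter_compact_attained[OF cpt] by blast
  define d where "d = norm (y - x)"
  have bd: "norm (z - w) \<le> d" if "z \<in> closure \<Omega>" "w \<in> closure \<Omega>" for z w
    using diameter_bounded_bound[OF a(6) that] xy(3) by (simp add: d_def dist_norm norm_minus_commute)
  have d: "d > 0"
  proof -
    obtain u e where e: "e > 0" "ball u e \<subseteq> \<Omega>" using a by (meson all_not_in_conv open_contains_ball)
    have "u \<in> closure \<Omega>" "u + (e/2) *\<^sub>R axis 1 1 \<in> closure \<Omega>"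
      using e closure_subset[of \<Omega>] by (auto simp: dist_norm intro!: subsetD[OF closure_subset] subsetD[OF e(2)])
    from bd[OF this] show ?thesis using e(1) by simp
  qed
  have "norm (y - x) = norm (vec2 d 0)"
    using d by (simp add: d_def norm_vec_def[of "vec2 _ _"] L2_set_def sum_2)
  then obtain f where f: "orthogonal_transformation f" "f (y - x) = vec2 d 0"
    by (rule orthogonal_transformation_exists)
  define S where "S z = (vec2 (-2) 0 - (4/d) *\<^sub>R f x) + (4/d) *\<^sub>R f z" for z
  have S: "similarity (4/d) S" unfolding S_def using d f(1) by (intro similarityI) auto
  have cl: "closure (S ` \<Omega>) = S ` closure \<Omega>" by (rule similarity_closure[OF S])
  have Sx: "S x = vec2 (-2) 0" by (simp add: S_def)
  have "S y = vec2 (-2) 0 + (4/d) *\<^sub>R f (y - x)"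
    by (simp add: S_def linear_diff[OF orthogonal_transformation_linear[OF f(1)]] algebra_simps)
  then have Sy: "S y = vec2 2 0" using d by (simp add: f(2) vec_eq_iff forall_2)
  have "norm (z - w) \<le> 4" if z: "z \<in> closure (S ` \<Omega>)" and w: "w \<in> closure (S ` \<Omega>)" for z w
  proof -
    obtain z' w' where zw: "z' \<in> closure \<Omega>" "w' \<in> closure \<Omega>" "z = S z'" "w = S w'"
      using z w unfolding cl by blast
    have "norm (z - w) = (4/d) * norm (z' - w')" unfolding zw by (rule similarity_dist[OF S])
    also have "\<dots> \<le> (4/d) * d" using bd[OF zw(1,2)] d by (intro mult_left_mono) auto
    finally show ?thesis using d by simp
  qed
  moreover have "vec2 (-2) 0 \<in> closure (S ` \<Omega>)" unfolding cl Sx[symmetric] using xy(1) by (rule imageI)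
  moreover have "vec2 2 0 \<in> closure (S ` \<Omega>)" unfolding cl Sy[symmetric] using xy(2) by (rule imageI)
  ultimately show ?thesis using that[OF S] by blast
qed

text \<open>The ball around the centroid \<open>z/3\<close> of the triangle with vertices \<open>(-2, 0)\<close>, \<open>(2, 0)\<close>, \<open>z\<close>; the
  coefficients are barycentric coordinates.\<close>

lemma triangle_contains_ball:
  fixes z :: plane
  assumes C: "convex C" "vec2 (-2) 0 \<in> C" "vec2 2 0 \<in> C" "z \<in> C"
    and z: "\<bar>z $ 1\<bar> \<le> 2" "\<bar>z $ 2\<bar> > e" and e: "e > 0"
  shows "ball ((1/3) *\<^sub>R z) (min (1/4) (e/12)) \<subseteq> C"
proof
  fix w assume w: "w \<in> ball ((1/3) *\<^sub>R z) (min (1/4) (e/12))"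
  define v where "v = w - (1/3) *\<^sub>R z"
  have v: "norm v < 1/4" "norm v < e/12" using w by (auto simp: v_def dist_norm norm_minus_commute)
  have v1: "\<bar>v $ 1\<bar> \<le> 1/4" and v2: "\<bar>v $ 2\<bar> \<le> e/12"
    using component_le_norm_cart[of v 1] component_le_norm_cart[of v 2] v by auto
  have z2: "z $ 2 \<noteq> 0" using z(2) e by auto
  \<comment> \<open>The weight of \<open>z\<close> changes by \<open>d\<close> to match the second
    coordinate; the other two weights then correct the first. The radii 1/4 and e/12 give |d| \<le>
    1/12 and |d z_1| \<le> 1/6, which keeps all weights nonnegative.\<close>
  define d where "d = v $ 2 / z $ 2"
  have "\<bar>d\<bar> = \<bar>v $ 2\<bar> / \<bar>z $ 2\<bar>" by (simp add: d_def)
  also have "\<dots> \<le> (e/12) / e" using v2 z(2) e by (intro frac_le) auto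
  finally have d: "\<bar>d\<bar> \<le> 1/12" using e by simp
  have "\<bar>d * z $ 1\<bar> \<le> (1/12) * 2" unfolding abs_mult using d z(1) by (intro mult_mono) auto
  then have dz: "\<bar>d * z $ 1\<bar> \<le> 1/6" by simp
  define \<beta> where "\<beta> = 1/3 - d/2 + (v $ 1 - d * z $ 1) / 4"
  define \<alpha> where "\<alpha> = 1/3 - d/2 - (v $ 1 - d * z $ 1) / 4"
  define \<gamma> where "\<gamma> = 1/3 + d"
  have nn: "\<alpha> \<ge> 0" "\<beta> \<ge> 0" "\<gamma> \<ge> 0" using d dz v1 by (simp_all add: \<alpha>_def \<beta>_def \<gamma>_def abs_le_iff field_simps)
  have s: "\<alpha> + \<beta> + \<gamma> = 1" by (simp add: \<alpha>_def \<beta>_def \<gamma>_def)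
  have dz2: "d * z $ 2 = v $ 2" using z2 by (simp add: d_def)
  have "\<alpha> *\<^sub>R vec2 (-2) 0 + \<beta> *\<^sub>R vec2 2 0 + \<gamma> *\<^sub>R z = (1/3) *\<^sub>R z + v"
    using dz2 by (simp add: vec_eq_iff forall_2 \<alpha>_def \<beta>_def \<gamma>_def field_simps)
  also have "\<dots> = w" by (simp add: v_def)
  finally have w: "\<alpha> *\<^sub>R vec2 (-2) 0 + \<beta> *\<^sub>R vec2 2 0 + \<gamma> *\<^sub>R z = w" .
  have "\<alpha> *\<^sub>R vec2 (-2) 0 + \<beta> *\<^sub>R vec2 2 0 + \<gamma> *\<^sub>R z \<in> convex hull {vec2 (-2) 0, vec2 2 0, z}"
    unfolding convex_hull_3 using nn s by blast
  moreover have "convex hull {vec2 (-2) 0, vec2 2 0, z} \<subseteq> C"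
    using C by (intro hull_minimal) auto
  ultimately show "w \<in> C" using w by auto
qed

text \<open>A set with value at least \<open>disc_value\<close> cannot be flat after normalization,
  so its closure has a point at distance more than \<open>e\<close> from the horizontal axis, and
  the triangle it spans with the diameter contains a ball of fixed radius. Every point of the set is
  within 4 of the centre of that ball, so radius 5 suffices outside.\<close>

lemma normalization:
  "\<exists>r>0. \<forall>\<Omega>. admissible \<Omega> \<and> shape_functional \<Omega> \<ge> disc_value \<longrightarrow>
     (\<exists>\<Omega>'. admissible \<Omega>' \<and> shape_functional \<Omega>' = shape_functional \<Omega> \<and> ball 0 r \<subseteq> \<Omega>' \<and> \<Omega>' \<subseteq> ball 0 5)"
proof -
  obtain e where e: "e > 0"
    and thin: "\<And>K :: plane set. (\<forall>x\<in>K. \<bar>x $ 1\<bar> \<le> 2 \<and> \<bar>x $ 2\<bar> \<le> e) \<Longrightarrow> log_capacity K \<le> exp (2 * ln 768 / 255)"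
    using log_capacity_thin by blast
  define r where "r = min (1/4) (e/12)"
  have r: "r > 0" using e by (simp add: r_def)
  have "\<exists>\<Omega>'. admissible \<Omega>' \<and> shape_functional \<Omega>' = shape_functional \<Omega> \<and> ball 0 r \<subseteq> \<Omega>' \<and> \<Omega>' \<subseteq> ball 0 5"
    if adm: "admissible \<Omega>" and ge: "shape_functional \<Omega> \<ge> disc_value" for \<Omega>
  proof -
    obtain c S where S: "similarity c S" and pq: "vec2 (-2) 0 \<in> closure (S ` \<Omega>)" "vec2 2 0 \<in> closure (S ` \<Omega>)"
      and diam: "\<And>z w. z \<in> closure (S ` \<Omega>) \<Longrightarrow> w \<in> closure (S ` \<Omega>) \<Longrightarrow> norm (z - w) \<le> 4"
      using horizontal_normalization[OF adm] by metis
    define W where "W = S ` \<Omega>"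
    have W: "admissible W" unfolding W_def by (rule similarity_admissible[OF S adm])
    have HW: "shape_functional W = shape_functional \<Omega>" unfolding W_def by (rule shape_functional_similarity[OF S adm])
    note w = admissibleD[OF W]
    have z1: "\<bar>z $ 1\<bar> \<le> 2" if z: "z \<in> closure W" for z :: plane
    proof -
      have "\<bar>(z - vec2 (-2) 0) $ 1\<bar> \<le> 4" "\<bar>(z - vec2 2 0) $ 1\<bar> \<le> 4"
        using diam[OF z[unfolded W_def] pq(1)] diam[OF z[unfolded W_def] pq(2)]
          component_le_norm_cart[of "z - vec2 (-2) 0" 1] component_le_norm_cart[of "z - vec2 2 0" 1] by linarith+
      then show ?thesis by (simp add: abs_le_iff)
    qed
    have "\<exists>z\<in>closure W. \<bar>z $ 2\<bar> > e"
    proof (rule ccontr)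
      assume "\<not> ?thesis"
      then have "log_capacity (closure W) \<le> exp (2 * ln 768 / 255)" using z1 by (intro thin) auto
      from thin_shape_functional[OF W pq[folded W_def] this] show False using ge HW by simp
    qed
    then obtain z :: plane where z: "z \<in> closure W" "\<bar>z $ 2\<bar> > e" by blast
    have sub: "ball ((1/3) *\<^sub>R z) r \<subseteq> closure W"
      unfolding r_def by (rule triangle_contains_ball[OF convex_closure[OF w(3)] pq[folded W_def] z(1) z1[OF z(1)] z(2) e])
    \<comment> \<open>The ball is open, hence inside the interior of the closure, which is
      \<open>W\<close> itself because \<open>W\<close> is open and convex.\<close>
    then have "ball ((1/3) *\<^sub>R z) r \<subseteq> interior (closure W)" by (intro interior_maximal) auto
    then have inner: "ball ((1/3) *\<^sub>R z) r \<subseteq> W"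
      using convex_interior_closure[OF w(3)] w(1) by (simp add: interior_open)
    define W' where "W' = (+) (- ((1/3) *\<^sub>R z)) ` W"
    note tr = similarity_translate[of "- ((1/3) *\<^sub>R z)"]
    have "admissible W'" unfolding W'_def by (rule similarity_admissible[OF tr W])
    moreover have "shape_functional W' = shape_functional \<Omega>"
      unfolding W'_def using shape_functional_similarity[OF tr W] HW by simp
    moreover have "ball 0 r \<subseteq> W'"
    proof
      fix x :: plane assume "x \<in> ball 0 r"
      then have "(1/3) *\<^sub>R z + x \<in> W" by (intro subsetD[OF inner]) (simp add: dist_norm)
      then show "x \<in> W'" unfolding W'_def by (intro image_eqI[of _ _ "(1/3) *\<^sub>R z + x"]) auto
    qed
    moreover have "W' \<subseteq> ball 0 5"
    proof
      fix x assume "x \<in> W'"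
      then obtain y where y: "y \<in> W" "x = y - (1/3) *\<^sub>R z" by (auto simp: W'_def)
      have "(1/3) *\<^sub>R z \<in> closure W" using sub r by auto
      then have "norm (y - (1/3) *\<^sub>R z) \<le> 4"
        using diam[folded W_def] y(1) closure_subset by blast
      then show "x \<in> ball 0 5" by (simp add: y(2))
    qed
    ultimately show ?thesis by blast
  qed
  then show ?thesis using r by blast
qed

text \<open>Rigidity and capacity are controlled by the outer disc and the area by the inner one;
  this makes the supremum over normalized sets finite.\<close>

lemma shape_functional_bounded:
  assumes "admissible \<Omega>" "ball 0 r \<subseteq> \<Omega>" "\<Omega> \<subseteq> ball 0 R" "r > 0"
  shows "shape_functional \<Omega> \<le>
    torsional_rigidity (ball 0 R) powr (1/2) * log_capacity (cball 0 R) / measure lborel (ball (0::plane) r) powr (3/2)"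
proof -
  note a = admissibleD[OF assms(1)]
  have "torsional_rigidity \<Omega> powr (1/2) \<le> torsional_rigidity (ball 0 R) powr (1/2)"
    using admissible_rigidity_nonneg[OF assms(1)] a assms(3) by (intro powr_mono2 torsional_rigidity_mono) auto
  moreover have "log_capacity (closure \<Omega>) \<le> log_capacity (cball 0 R)"
    using assms(3) by (intro log_capacity_mono closure_minimal) auto
  moreover have "measure lborel (ball (0::plane) r) powr (3/2) \<le> measure lborel \<Omega> powr (3/2)"
    using a assms(2) by (intro powr_mono2 measure_mono_bounded) auto
  moreover have "measure lborel (ball (0::plane) r) powr (3/2) > 0"
    using assms(4) admissible_area_pos[OF admissible_ball[of r 0]] by simp
  ultimately show ?thesis
    unfolding shape_functional_def by (intro frac_le mult_mono) (auto simp: log_capacity_nonneg)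
qed

theorem theorem3p3:
  shows "\<exists>\<Omega>\<^sub>0. admissible \<Omega>\<^sub>0 \<and>
    (\<forall>\<Omega>. admissible \<Omega> \<longrightarrow> shape_functional \<Omega> \<le> shape_functional \<Omega>\<^sub>0)"
proof -
  obtain r where r: "r > 0" and norm: "\<And>\<Omega>. admissible \<Omega> \<Longrightarrow> shape_functional \<Omega> \<ge> disc_value \<Longrightarrow>
     \<exists>\<Omega>'. admissible \<Omega>' \<and> shape_functional \<Omega>' = shape_functional \<Omega> \<and> ball 0 r \<subseteq> \<Omega>' \<and> \<Omega>' \<subseteq> ball 0 5"
    using normalization by blast
  \<comment> \<open>The supremum is taken over normalized sets only; \<open>reach\<close> then
    extends it to every admissible set with value at least \<open>disc_value\<close>.\<close>
  define V where "V = shape_functional ` {\<Omega>. admissible \<Omega> \<and> ball 0 r \<subseteq> \<Omega> \<and> \<Omega> \<subseteq> ball 0 5}"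
  define s where "s = Sup V"
  have bdd: "bdd_above V"
    unfolding V_def by (rule bdd_aboveI2) (use shape_functional_bounded[OF _ _ _ r] in blast)
  have reach: "shape_functional \<Omega> \<le> s" if "admissible \<Omega>" "shape_functional \<Omega> \<ge> disc_value" for \<Omega>
  proof -
    have "shape_functional \<Omega> \<in> V" using norm[OF that] by (auto simp: V_def image_iff)
    then show ?thesis unfolding s_def using bdd by (rule cSup_upper)
  qed
  have disc: "disc_value \<le> s"
    using disc_value_le reach[OF admissible_ball[of 1 0] disc_value_le] by simp
  have "V \<noteq> {}" using norm[OF admissible_ball[of 1 0] disc_value_le] by (auto simp: V_def)
  then have "\<exists>\<Omega>. admissible \<Omega> \<and> ball 0 r \<subseteq> \<Omega> \<and> \<Omega> \<subseteq> ball 0 5 \<and> shape_functional \<Omega> > s - 1 / real (Suc n)" for n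
    using less_cSup_iff[of V "s - 1 / real (Suc n)"] bdd unfolding s_def[symmetric] by (auto simp: V_def)
  then have "\<exists>\<Omega>. \<forall>n. admissible (\<Omega> n) \<and> ball 0 r \<subseteq> \<Omega> n \<and> \<Omega> n \<subseteq> ball 0 5
      \<and> shape_functional (\<Omega> n) > s - 1 / real (Suc n)" by (intro choice allI)
  then obtain \<Omega> where "\<forall>n. admissible (\<Omega> n) \<and> ball 0 r \<subseteq> \<Omega> n \<and> \<Omega> n \<subseteq> ball 0 5
      \<and> shape_functional (\<Omega> n) > s - 1 / real (Suc n)" by (rule exE)
  then have \<Omega>: "\<And>n. admissible (\<Omega> n)" "\<And>n. ball 0 r \<subseteq> \<Omega> n" "\<And>n. \<Omega> n \<subseteq> ball 0 5"
    and H: "\<And>n. shape_functional (\<Omega> n) > s - 1 / real (Suc n)" by simp_all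
  obtain \<Omega>0 k where \<Omega>0: "admissible \<Omega>0" and k: "strict_mono (k :: nat \<Rightarrow> nat)"
    and sand: "\<And>t. t > 1 \<Longrightarrow> \<exists>N. \<forall>n\<ge>N. \<Omega> (k n) \<subseteq> (*\<^sub>R) t ` \<Omega>0 \<and> \<Omega>0 \<subseteq> (*\<^sub>R) t ` \<Omega> (k n)"
    by (rule convex_sequence_compact[of \<Omega> r 5, OF admissibleD(3)[OF \<Omega>(1)] r \<Omega>(2,3)]) (rule that)
  have "s \<le> t ^ 6 * shape_functional \<Omega>0" if t: "t > 1" for t
  proof -
    obtain N where N: "\<And>n. n \<ge> N \<Longrightarrow> \<Omega> (k n) \<subseteq> (*\<^sub>R) t ` \<Omega>0 \<and> \<Omega>0 \<subseteq> (*\<^sub>R) t ` \<Omega> (k n)"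
      using sand[OF t] by blast
    have le: "s - 1 / real (Suc n) \<le> t ^ 6 * shape_functional \<Omega>0" if n: "n \<ge> N" for n
    proof -
      have "1 / real (Suc (k n)) \<le> 1 / real (Suc n)"
        using seq_suble[OF k, of n] by (intro divide_left_mono) auto
      moreover have "shape_functional (\<Omega> (k n)) \<le> t ^ 6 * shape_functional \<Omega>0"
        using N[OF n] t by (intro shape_functional_sandwich \<Omega>0 \<Omega>) auto
      ultimately show ?thesis using H[of "k n"] by linarith
    qed
    have "(\<lambda>n. s - 1 / real (Suc n)) \<longlonglongrightarrow> s" by real_asymp
    then show ?thesis by (rule LIMSEQ_le_const2) (use le in blast)
  qed
  note le = this
  \<comment> \<open>The sandwich is available only for t > 1; letting t tend to 1 removes the factor
    t^6.\<close>
  have "(\<lambda>n. (1 + 1 / real (Suc n)) ^ 6 * shape_functional \<Omega>0) \<longlonglongrightarrow> 1 ^ 6 * shape_functional \<Omega>0"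
    by (intro tendsto_intros) real_asymp
  then have "s \<le> 1 ^ 6 * shape_functional \<Omega>0"
    by (rule LIMSEQ_le_const) (intro exI[of _ 0] allI impI le, simp)
  then have s: "s \<le> shape_functional \<Omega>0" by simp
  \<comment> \<open>Sets below the threshold are beaten as well, since the disc already shows
    \<open>disc_value \<le> s\<close>.\<close>
  have "shape_functional \<Omega> \<le> shape_functional \<Omega>0" if "admissible \<Omega>" for \<Omega>
    using reach[OF that] disc s by (cases "shape_functional \<Omega> \<ge> disc_value") auto
  then show ?thesis using \<Omega>0 by blast
qed

end
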